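(* Let $\gamma>0$ and $1<p<\infty$. The fractional integral of order $\gamma$, $I_\gamma^{\alpha,\beta}$, defined on polynomials $f$ by $I_\gamma^{\alpha,\beta}f=\sum_{n=1}^\infty r_n^{-\gamma/2}J_n^{\alpha,\beta}f$, admits a continuous extension to $L^p([-1,1]^d,\mu^d_{\alpha,\beta})$.
   Context: $\mathbb{N}=\{0,1,2,\dots\}$. Fix $d\ge 1$ and $\alpha=(\alpha_1,\dots,\alpha_d),\ \beta=(\beta_1,\dots,\beta_d)\in\mathbb{R}^d$ with $\alpha_i,\beta_i>-\frac12$ for all $i$. The normalized Jacobi measure on $[-1,1]^d$ is the probability measure $\mu^d_{\alpha,\beta}(dx)=\prod_{i=1}^d \frac{1}{2^{\alpha_i+\beta_i+1}B(\alpha_i+1,\beta_i+1)}(1-x_i)^{\alpha_i}(1+x_i)^{\beta_i}dx_i$, where $B$ is the Beta function. For $n\in\mathbb{N}$ and real $a,b>-1$, $p_n^{a,b}$ is the one-dimensional Jacobi polynomial of degree $n$, given by Rodrigues' formula $(1-x)^a(1+x)^b c_n p_n^{a,b}(x)=\frac{(-1)^n}{2^n n!}\frac{d^n}{dx^n}\{(1-x)^{a+n}(1+x)^{b+n}\}$, with constant $c_n>0$ chosen so that $p_n^{a,b}$ has $L^2$ norm $1$ with respect to the one-dimensional normalized Jacobi measure. For $\kappa=(\kappa_1,\dots,\kappa_d)\in\mathbb{N}^d$ put $\vec p_\kappa^{\,\alpha,\beta}(x)=\prod_{i=1}^d p_{\kappa_i}^{\alpha_i,\beta_i}(x_i)$;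 these form an orthonormal basis of $L^2([-1,1]^d,\mu^d_{\alpha,\beta})$. Put $\lambda_\kappa=\sum_{i=1}^d\kappa_i(\kappa_i+\alpha_i+\beta_i+1)$. The set $\{\lambda_\kappa:\kappa\in\mathbb{N}^d\}$ is written in increasing order as $\{r_n\}_{n=0}^\infty$, $0=r_0<r_1<r_2<\cdots$, and $A_n^{\alpha,\beta}=\{\kappa\in\mathbb{N}^d:\lambda_\kappa=r_n\}$. $J_n^{\alpha,\beta}$ is the orthogonal projection of $L^2([-1,1]^d,\mu^d_{\alpha,\beta})$ onto the span of $\{\vec p_\kappa^{\,\alpha,\beta}:\kappa\in A_n^{\alpha,\beta}\}$, i.e. $J_n^{\alpha,\beta}f=\sum_{\kappa\in A_n^{\alpha,\beta}}\hat f(\kappa)\,\vec p_\kappa^{\,\alpha,\beta}$ with $\hat f(\kappa)=\int_{[-1,1]^d} f\,\vec p_\kappa^{\,\alpha,\beta}\,d\mu^d_{\alpha,\beta}$. The Jacobi operator is $\mathcal{L}^{\alpha,\beta}=\sum_{i=1}^d\big[(1-x_i^2)\frac{\partial^2}{\partial x_i^2}+(\beta_i-\alpha_i-(\alpha_i+\beta_i+2)x_i)\frac{\partial}{\partial x_i}\big]$, with $\mathcal{L}^{\alpha,\beta}\vec p_\kappa^{\,\alpha,\beta}=-\lambda_\kappa\vec p_\kappa^{\,\alpha,\beta}$. The fractional integral is $I_\gamma^{\alpha,\beta}=(-\mathcal{L}^{\alpha,\beta})^{-\gamma/2}\Pi_0$ with $\Pi_0=I-J_0^{\alpha,\beta}$,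 which on polynomials is the sum in the claim. *)

theory Defs
  imports "HOL-Analysis.Analysis"
begin

section \<open>Jacobi measures\<close>

text \<open>On the boundary \<open>0 powr a = 0\<close> by convention; this only concerns null sets.\<close>

definition jacobi_density :: "real \<Rightarrow> real \<Rightarrow> real \<Rightarrow> real" where
  "jacobi_density a b x =
     (1 - x) powr a * (1 + x) powr b / (2 powr (a + b + 1) * Beta (a + 1) (b + 1))"

definition jacobi_measure_1 :: "real \<Rightarrow> real \<Rightarrow> real measure" where
  "jacobi_measure_1 a b =
     density (restrict_space lborel {-1..1}) (\<lambda>x. ennreal (jacobi_density a b x))"

definition jacobi_measure :: "real ^ 'n \<Rightarrow> real ^ 'n \<Rightarrow> (real ^ 'n) measure" where
  "jacobi_measure \<alpha> \<beta> =
     density (restrict_space lborel (cbox (-1) 1))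
       (\<lambda>x. ennreal (\<Prod>i\<in>UNIV. jacobi_density (\<alpha> $ i) (\<beta> $ i) (x $ i)))"


section \<open>Jacobi polynomials and the associated spectral decomposition\<close>

text \<open>Rodrigues' formula is required on the open interval, where the weights are smooth. It fixes
  the polynomial up to the factor \<open>c > 0\<close>, which the normalisation of the norm then determines.\<close>

definition is_jacobi_poly :: "nat \<Rightarrow> real \<Rightarrow> real \<Rightarrow> real poly \<Rightarrow> bool" where
  "is_jacobi_poly n a b P \<longleftrightarrow>
     (\<exists>c>0. \<forall>x\<in>{-1<..<1::real}.
        (1 - x) powr a * (1 + x) powr b * c * poly P x =
          (-1) ^ n / (2 ^ n * fact n) *
          (deriv ^^ n) (\<lambda>t. (1 - t) powr (a + real n) * (1 + t) powr (b + real n)) x) \<and>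
     (\<integral>x. (poly P x)\<^sup>2 \<partial>jacobi_measure_1 a b) = 1"

definition jacobi_poly :: "nat \<Rightarrow> real \<Rightarrow> real \<Rightarrow> real poly" where
  "jacobi_poly n a b = (THE P. is_jacobi_poly n a b P)"

definition jacobi_basis :: "real ^ 'n \<Rightarrow> real ^ 'n \<Rightarrow> nat ^ 'n \<Rightarrow> real ^ 'n \<Rightarrow> real" where
  "jacobi_basis \<alpha> \<beta> \<kappa> x = (\<Prod>i\<in>UNIV. poly (jacobi_poly (\<kappa> $ i) (\<alpha> $ i) (\<beta> $ i)) (x $ i))"

definition jacobi_eigenvalue :: "real ^ 'n \<Rightarrow> real ^ 'n \<Rightarrow> nat ^ 'n \<Rightarrow> real" where
  "jacobi_eigenvalue \<alpha> \<beta> \<kappa> =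
     (\<Sum>i\<in>UNIV. real (\<kappa> $ i) * (real (\<kappa> $ i) + \<alpha> $ i + \<beta> $ i + 1))"

definition jacobi_spectrum :: "real ^ 'n \<Rightarrow> real ^ 'n \<Rightarrow> nat \<Rightarrow> real" where
  "jacobi_spectrum \<alpha> \<beta> = (THE r. strict_mono r \<and> range r = range (jacobi_eigenvalue \<alpha> \<beta>))"

definition jacobi_level :: "real ^ 'n \<Rightarrow> real ^ 'n \<Rightarrow> nat \<Rightarrow> (nat ^ 'n) set" where
  "jacobi_level \<alpha> \<beta> n = {\<kappa>. jacobi_eigenvalue \<alpha> \<beta> \<kappa> = jacobi_spectrum \<alpha> \<beta> n}"

definition jacobi_coeff ::
    "real ^ 'n \<Rightarrow> real ^ 'n \<Rightarrow> (real ^ 'n \<Rightarrow> real) \<Rightarrow> nat ^ 'n \<Rightarrow> real" where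
  "jacobi_coeff \<alpha> \<beta> f \<kappa> = (\<integral>x. f x * jacobi_basis \<alpha> \<beta> \<kappa> x \<partial>jacobi_measure \<alpha> \<beta>)"

definition jacobi_proj ::
    "real ^ 'n \<Rightarrow> real ^ 'n \<Rightarrow> nat \<Rightarrow> (real ^ 'n \<Rightarrow> real) \<Rightarrow> real ^ 'n \<Rightarrow> real" where
  "jacobi_proj \<alpha> \<beta> n f x =
     (\<Sum>\<kappa>\<in>jacobi_level \<alpha> \<beta> n. jacobi_coeff \<alpha> \<beta> f \<kappa> * jacobi_basis \<alpha> \<beta> \<kappa> x)"

text \<open>The series is meant for polynomial \<open>f\<close>, for which only finitely many terms are nonzero.\<close>

definition jacobi_frac_integral ::
    "real ^ 'n \<Rightarrow> real ^ 'n \<Rightarrow> real \<Rightarrow> (real ^ 'n \<Rightarrow> real) \<Rightarrow> real ^ 'n \<Rightarrow> real" where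
  "jacobi_frac_integral \<alpha> \<beta> \<gamma> f x =
     (\<Sum>n. jacobi_spectrum \<alpha> \<beta> (Suc n) powr (- \<gamma> / 2) * jacobi_proj \<alpha> \<beta> (Suc n) f x)"


section \<open>Continuous operators on $L^p$\<close>

text \<open>Elements of $L^p$ are represented by functions; operators act on representatives and all
  identities are up to null sets.\<close>

definition Lp_space :: "'a measure \<Rightarrow> real \<Rightarrow> ('a \<Rightarrow> real) set" where
  "Lp_space M p = {f \<in> borel_measurable M. integrable M (\<lambda>x. \<bar>f x\<bar> powr p)}"

definition Lp_norm :: "'a measure \<Rightarrow> real \<Rightarrow> ('a \<Rightarrow> real) \<Rightarrow> real" where
  "Lp_norm M p f = (\<integral>x. \<bar>f x\<bar> powr p \<partial>M) powr (1 / p)"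

definition Lp_bounded_linear ::
    "'a measure \<Rightarrow> real \<Rightarrow> (('a \<Rightarrow> real) \<Rightarrow> ('a \<Rightarrow> real)) \<Rightarrow> bool" where
  "Lp_bounded_linear M p T \<longleftrightarrow>
     (\<forall>f\<in>Lp_space M p. T f \<in> Lp_space M p) \<and>
     (\<forall>f\<in>Lp_space M p. \<forall>g\<in>Lp_space M p.
        (AE x in M. f x = g x) \<longrightarrow> (AE x in M. T f x = T g x)) \<and>
     (\<forall>f\<in>Lp_space M p. \<forall>g\<in>Lp_space M p. AE x in M. T (\<lambda>y. f y + g y) x = T f x + T g x) \<and>
     (\<forall>c. \<forall>f\<in>Lp_space M p. AE x in M. T (\<lambda>y. c * f y) x = c * T f x) \<and>
     (\<exists>C. \<forall>f\<in>Lp_space M p. Lp_norm M p (T f) \<le> C * Lp_norm M p f)"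

end

theory Submission
  imports Defs
begin

text \<open>On polynomials the fractional integral is the multiplier \<open>\<lambda> powr (- \<theta>)\<close>, \<open>\<theta> = \<gamma> / 2\<close>, of the
  Jacobi expansion, with the value \<open>0\<close> on constants. Once it is bounded in the \<open>L\<^sup>p\<close> norm on
  polynomials, it extends, because polynomials are dense (lemma \<open>polynomials_dense\<close>, theorem
  \<open>Lp_bounded_extension\<close>). The bound comes from splitting the multiplier in two.

  The first part only uses positivity. The resolvents of the Jacobi operator \<open>L\<close>, the inverses of
  \<open>1 - h * L\<close> for \<open>h \<ge> 0\<close>, act on polynomials, and the maximum principle makes them positive (lemma
  \<open>resolvent_nonneg\<close>). They fix constants and preserve the integral, so Jensen's inequality makes them contractions of \<open>L\<^sup>p\<close>
  (lemma \<open>resolvent_contraction\<close>). Contractive multipliers are closed under products, convex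
  combinations and pointwise limits, and the binomial series writes \<open>(1 + \<lambda>) powr (- \<theta>)\<close> as a limit of
  convex combinations of powers of resolvents (lemma \<open>contractive_powr\<close>).

  The second part only uses decay. With \<open>s = 1 + \<lambda>\<close>, another binomial series gives
  \<open>\<lambda> powr (- \<theta>) = \<Sum>j. c j * s powr (- \<theta> - j)\<close> for nonconstant modes, where the \<open>c j\<close> are numbers. The
  first \<open>M\<close> terms are multiples of contractive multipliers, and the remainder is of order
  \<open>s powr (- M)\<close>. The normalised Jacobi polynomials grow at most polynomially in the degree (lemma
  \<open>jacobi_poly_polynomial_growth\<close>), so for large \<open>M\<close> the remainder is an integral operator with a
  bounded kernel (lemma \<open>bounded_mult_rapid_decay\<close>). The two parts meet in lemma
  \<open>bounded_mult_fractional\<close>.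

  Instead of the \<open>L\<^sup>p\<close> norm, the estimates use its \<open>p\<close>-th power, which satisfies a triangle inequality
  up to the factor \<open>2 powr p\<close>; only the existence of some constant matters.\<close>

section \<open>Jacobi polynomials in one variable\<close>

text \<open>The derivative of \<open>(1 - x) powr A * (1 + x) powr B * q x\<close> is
  \<open>(1 - x) powr (A - 1) * (1 + x) powr (B - 1)\<close> times this polynomial.\<close>
definition rodrigues_step :: "real \<Rightarrow> real \<Rightarrow> real poly \<Rightarrow> real poly" where
  "rodrigues_step A B q = [:1, 0, -1:] * pderiv q + [:B - A, -(A + B):] * q"

text \<open>The polynomial factor of the \<open>n\<close>-th derivative in Rodrigues' formula; the exponents drop by one in
  each differentiation, so the recursion starts from the innermost step with the largest exponents.\<close>
fun rodrigues_poly :: "nat \<Rightarrow> real \<Rightarrow> real \<Rightarrow> real poly" where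
  "rodrigues_poly 0 a b = 1"
| "rodrigues_poly (Suc n) a b = rodrigues_step (a + 1) (b + 1) (rodrigues_poly n (a + 1) (b + 1))"

text \<open>The one-dimensional Jacobi operator in divergence form.\<close>
definition jacobi_op :: "real \<Rightarrow> real \<Rightarrow> real poly \<Rightarrow> real poly" where
  "jacobi_op a b q = rodrigues_step (a + 1) (b + 1) (pderiv q)"

lemma poly_rodrigues_step:
  "poly (rodrigues_step A B q) x =
     (1 - x\<^sup>2) * poly (pderiv q) x + (B * (1 - x) - A * (1 + x)) * poly q x"
  by (simp add: rodrigues_step_def algebra_simps power2_eq_square)

lemma poly_jacobi_op:
  "poly (jacobi_op a b q) x =
     (1 - x\<^sup>2) * poly (pderiv (pderiv q)) x + (b - a - (a + b + 2) * x) * poly (pderiv q) x"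
  by (simp add: jacobi_op_def poly_rodrigues_step algebra_simps)

lemma has_derivative_jacobi_weight:
  assumes "x \<in> {-1<..<1}"
  shows "((\<lambda>t. (1 - t) powr A * (1 + t) powr B * poly q t) has_real_derivative
     (1 - x) powr (A - 1) * (1 + x) powr (B - 1) * poly (rodrigues_step A B q) x) (at x)"
proof -
  have pos: "1 - x > 0" "1 + x > 0" using assms by auto
  have e1: "(1 - x) powr A = (1 - x) powr (A - 1) * (1 - x)"
    using pos powr_add[of "1 - x" "A - 1" 1] by simp
  have e2: "(1 + x) powr B = (1 + x) powr (B - 1) * (1 + x)"
    using pos powr_add[of "1 + x" "B - 1" 1] by simp
  have "((\<lambda>t. (1 - t) powr A * (1 + t) powr B * poly q t) has_real_derivative
     (- (A * (1 - x) powr (A - 1)) * (1 + x) powr B + (B * (1 + x) powr (B - 1)) * (1 - x) powr A) * poly q x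
       + poly (pderiv q) x * ((1 - x) powr A * (1 + x) powr B)) (at x)"
    using pos by (auto intro!: derivative_eq_intros)
  then show ?thesis
    by (simp add: e1 e2 poly_rodrigues_step algebra_simps power2_eq_square)
qed

lemma deriv_iterate_jacobi_weight:
  assumes "x \<in> {-1<..<1}"
  shows "(deriv ^^ n) (\<lambda>t. (1 - t) powr (a + real n) * (1 + t) powr (b + real n)) x =
     (1 - x) powr a * (1 + x) powr b * poly (rodrigues_poly n a b) x"
  using assms
proof (induction n arbitrary: a b x)
  case 0
  then show ?case by simp
next
  case (Suc n)
  let ?f = "\<lambda>t. (1 - t) powr (a + real (Suc n)) * (1 + t) powr (b + real (Suc n))"
  have ev: "\<forall>\<^sub>F t in nhds x. (deriv ^^ n) ?f t =
     (1 - t) powr (a + 1) * (1 + t) powr (b + 1) * poly (rodrigues_poly n (a + 1) (b + 1)) t"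
  proof (rule eventually_mono[OF eventually_nhds_in_open[of "{-1<..<1}" x]])
    show "(deriv ^^ n) ?f t = (1 - t) powr (a + 1) * (1 + t) powr (b + 1) *
        poly (rodrigues_poly n (a + 1) (b + 1)) t" if "t \<in> {-1<..<1}" for t
      using Suc.IH[OF that, of "a + 1" "b + 1"] by (simp add: add.assoc)
  qed (use Suc.prems in auto)
  have "(deriv ^^ Suc n) ?f x = deriv (\<lambda>t. (1 - t) powr (a + 1) * (1 + t) powr (b + 1) *
      poly (rodrigues_poly n (a + 1) (b + 1)) t) x"
    using deriv_cong_ev[OF ev refl] by simp
  also have "\<dots> = (1 - x) powr a * (1 + x) powr b * poly (rodrigues_poly (Suc n) a b) x"
    using DERIV_imp_deriv[OF has_derivative_jacobi_weight[OF Suc.prems]] by simp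
  finally show ?case .
qed

text \<open>Differentiation commutes with a Rodrigues step up to a shift of the parameters and a constant.\<close>
lemma pderiv_rodrigues_step:
  "pderiv (rodrigues_step A B q) = rodrigues_step (A + 1) (B + 1) (pderiv q) - smult (A + B) q"
  unfolding poly_eq_poly_eq_iff[symmetric]
  by (rule ext) (simp add: rodrigues_step_def pderiv_add pderiv_diff pderiv_minus pderiv_smult
      pderiv_mult pderiv_pCons algebra_simps)

lemma rodrigues_step_smult: "rodrigues_step A B (smult c q) = smult c (rodrigues_step A B q)"
  by (simp add: rodrigues_step_def pderiv_smult smult_add_right)

lemma jacobi_op_smult: "jacobi_op a b (smult c q) = smult c (jacobi_op a b q)"
  by (simp add: jacobi_op_def pderiv_smult rodrigues_step_smult)

text \<open>Moving the derivative inwards past one Rodrigues step with \<open>pderiv_rodrigues_step\<close> leaves the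
  constant \<open>a + b + 2\<close> and the Jacobi operator with both parameters raised by one, acting on the
  remaining steps; the constants add up to the eigenvalue.\<close>
lemma jacobi_op_rodrigues_poly:
  "jacobi_op a b (rodrigues_poly n a b) =
     smult (- (real n * (real n + a + b + 1))) (rodrigues_poly n a b)"
proof (induction n arbitrary: a b)
  case 0
  then show ?case by (simp add: jacobi_op_def rodrigues_step_def)
next
  case (Suc n)
  let ?q = "rodrigues_poly n (a + 1) (b + 1)"
  have IH: "rodrigues_step (a + 2) (b + 2) (pderiv ?q) = smult (- (real n * (real n + (a + 1) + (b + 1) + 1))) ?q"
    using Suc.IH[of "a + 1" "b + 1"] by (simp add: jacobi_op_def add.assoc)
  have "pderiv (rodrigues_poly (Suc n) a b) =
      smult (- (real n * (real n + (a + 1) + (b + 1) + 1))) ?q - smult (a + b + 2) ?q"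
    using IH by (simp add: pderiv_rodrigues_step add.assoc algebra_simps)
  also have "\<dots> = smult (- (real (Suc n) * (real (Suc n) + a + b + 1))) ?q"
    unfolding smult_diff_left[symmetric] by (rule arg_cong2[where f = smult]) (simp_all add: algebra_simps)
  finally have e: "pderiv (rodrigues_poly (Suc n) a b) =
      smult (- (real (Suc n) * (real (Suc n) + a + b + 1))) ?q" .
  show ?case unfolding jacobi_op_def e rodrigues_step_smult by simp
qed

text \<open>A Rodrigues step with exponent \<open>A > 0\<close> multiplies the value at \<open>1\<close> by \<open>- 2 * A\<close>.\<close>
lemma rodrigues_poly_at_1_nonzero:
  assumes "a > -1"
  shows "poly (rodrigues_poly n a b) 1 \<noteq> 0"
  using assms
proof (induction n arbitrary: a b)
  case (Suc n)
  then show ?case using Suc.IH[of "a + 1" "b + 1"] by (simp add: poly_rodrigues_step)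
qed simp

lemma rodrigues_poly_nonzero: "a > -1 \<Longrightarrow> rodrigues_poly n a b \<noteq> 0"
  using rodrigues_poly_at_1_nonzero[of a n b] by auto

lemma lead_coeff_jacobi_op:
  "coeff (jacobi_op a b q) (degree q) = - (real (degree q) * (real (degree q) + a + b + 1)) * lead_coeff q"
proof -
  let ?m = "degree q"
  have e: "jacobi_op a b q = pderiv (pderiv q) - pCons 0 (pCons 0 (pderiv (pderiv q))) +
      smult (b - a) (pderiv q) - smult (a + b + 2) (pCons 0 (pderiv q))"
    unfolding poly_eq_poly_eq_iff[symmetric]
    by (rule ext) (simp add: poly_jacobi_op algebra_simps power2_eq_square)
  have z: "coeff q (Suc ?m) = 0" "coeff q (Suc (Suc ?m)) = 0"
    by (simp_all add: coeff_eq_0)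
  show ?thesis
  proof (cases ?m)
    case 0
    then show ?thesis unfolding e using z by (simp add: coeff_pderiv)
  next
    case (Suc k)
    then show ?thesis unfolding e using z
      by (cases k) (simp_all add: coeff_pderiv algebra_simps)
  qed
qed

text \<open>Leading coefficients show that \<open>n\<close> and the degree have the same eigenvalue, and the eigenvalues
  are strictly increasing because \<open>a + b + 1 > 0\<close>.\<close>
lemma degree_jacobi_eigenfunction:
  assumes "jacobi_op a b q = smult (- (real n * (real n + a + b + 1))) q" "q \<noteq> 0" "a + b + 1 > 0"
  shows "degree q = n"
proof -
  let ?m = "degree q"
  have "real n * (real n + a + b + 1) = real ?m * (real ?m + a + b + 1)"
    using lead_coeff_jacobi_op[of a b q] assms(1,2) by simp
  then have "(real n - real ?m) * (real n + real ?m + (a + b + 1)) = 0"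
    by (simp add: algebra_simps)
  then show ?thesis using assms(3) by (auto simp: add_nonneg_eq_0_iff)
qed

text \<open>Green's identity in pointwise form: the right-hand side has weighted integral zero.\<close>
lemma jacobi_op_symmetric_defect:
  "jacobi_op a b q * r - q * jacobi_op a b r = rodrigues_step (a + 1) (b + 1) (pderiv q * r - q * pderiv r)"
  unfolding poly_eq_poly_eq_iff[symmetric]
  by (rule ext) (simp add: jacobi_op_def poly_rodrigues_step pderiv_diff pderiv_mult algebra_simps)

text \<open>The maximum principle in one variable: at an endpoint the second-order term vanishes and the
  drift points inwards.\<close>
lemma jacobi_op_nonneg_at_min:
  assumes ab: "a > -1" "b > -1" and x: "x \<in> {-1..1}"
    and min: "\<And>y. y \<in> {-1..1} \<Longrightarrow> poly q x \<le> poly q y"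
  shows "poly (jacobi_op a b q) x \<ge> 0"
proof -
  consider "x = 1" | "x = -1" | "x \<in> {-1<..<1}"
    using x by (metis atLeastAtMost_iff greaterThanLessThan_iff less_eq_real_def)
  then show ?thesis
  proof cases
    case 1
    have "poly (pderiv q) 1 \<le> 0"
    proof (rule ccontr)
      assume "\<not> ?thesis"
      then obtain d where d: "d > 0" "\<And>h. 0 < h \<Longrightarrow> h < d \<Longrightarrow> poly q (1 - h) < poly q 1"
        using DERIV_pos_inc_left[OF poly_DERIV[of q 1]] by auto
      have "poly q (1 - min (d / 2) 1) < poly q 1" using d by auto
      moreover have "1 - min (d / 2) 1 \<in> {-1..1}" using d by auto
      ultimately show False using min[of "1 - min (d / 2) 1"] 1 by auto
    qed
    then have "(a + 1) * poly (pderiv q) 1 \<le> 0" using ab by (simp add: mult_nonneg_nonpos)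
    moreover have "poly (jacobi_op a b q) 1 = - 2 * ((a + 1) * poly (pderiv q) 1)"
      unfolding poly_jacobi_op by (simp add: ring_distribs)
    ultimately show ?thesis using 1 by simp
  next
    case 2
    have "poly (pderiv q) (-1) \<ge> 0"
    proof (rule ccontr)
      assume "\<not> ?thesis"
      then obtain d where d: "d > 0" "\<And>h. 0 < h \<Longrightarrow> h < d \<Longrightarrow> poly q (-1 + h) < poly q (-1)"
        using DERIV_neg_dec_right[OF poly_DERIV[of q "-1"]] by auto
      have "poly q (-1 + min (d / 2) 1) < poly q (-1)" using d by auto
      moreover have "-1 + min (d / 2) 1 \<in> {-1..1}" using d by auto
      ultimately show False using min[of "-1 + min (d / 2) 1"] 2 by auto
    qed
    then have "(b + 1) * poly (pderiv q) (-1) \<ge> 0" using ab by simp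
    moreover have "poly (jacobi_op a b q) (-1) = 2 * ((b + 1) * poly (pderiv q) (-1))"
      unfolding poly_jacobi_op by (simp add: ring_distribs)
    ultimately show ?thesis using 2 by simp
  next
    case 3
    define d where "d = min (1 - x) (1 + x)"
    have d: "d > 0" "\<And>y. \<bar>x - y\<bar> < d \<Longrightarrow> y \<in> {-1..1}" using 3 by (auto simp: d_def)
    have q1: "poly (pderiv q) x = 0"
      using DERIV_local_min[OF poly_DERIV d(1)] d(2) min by blast
    have "poly (pderiv (pderiv q)) x \<ge> 0"
    proof (rule ccontr)
      assume "\<not> ?thesis"
      then obtain e where e: "e > 0" "\<And>h. 0 < h \<Longrightarrow> h < e \<Longrightarrow> poly (pderiv q) (x + h) < poly (pderiv q) x"
        using DERIV_neg_dec_right[OF poly_DERIV[of "pderiv q" x]] by auto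
      define h where "h = min e d / 2"
      have h: "0 < h" "h < e" "h < d" using e d by (auto simp: h_def)
      obtain z where z: "x < z" "z < x + h" "poly q (x + h) - poly q x = h * poly (pderiv q) z"
        using poly_MVT[of x "x + h" q] h by auto
      have "poly (pderiv q) z < 0" using e(2)[of "z - x"] z h q1 by auto
      then have "poly q (x + h) < poly q x" using z h by (smt (verit) mult_pos_neg)
      moreover have "x + h \<in> {-1..1}" using d(2)[of "x + h"] h by auto
      ultimately show False using min by force
    qed
    moreover have "1 - x\<^sup>2 \<ge> 0" using abs_square_le_1[of x] 3 by auto
    ultimately show ?thesis using q1 by (simp add: poly_jacobi_op)
  qed
qed

section \<open>The one-dimensional Jacobi weight\<close>

text \<open>Extended by zero to the whole line, so that products of such weights are integrated with respect
  to Lebesgue measure on the full vector space.\<close>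
definition jacobi_weight :: "real \<Rightarrow> real \<Rightarrow> real \<Rightarrow> real" where
  "jacobi_weight a b x = indicator {-1..1} x * jacobi_density a b x"

lemma Beta_pos: "a > -1 \<Longrightarrow> b > -1 \<Longrightarrow> Beta (a + 1) (b + 1) > (0::real)"
  by (simp add: Beta_def Gamma_real_pos)

lemma jacobi_density_const_pos: "a > -1 \<Longrightarrow> b > -1 \<Longrightarrow> 2 powr (a + b + 1) * Beta (a + 1) (b + 1) > (0::real)"
  by (simp add: Beta_pos)

lemma jacobi_density_nonneg: "a > -1 \<Longrightarrow> b > -1 \<Longrightarrow> jacobi_density a b x \<ge> 0"
  using jacobi_density_const_pos[of a b] by (simp add: jacobi_density_def)

lemma jacobi_weight_nonneg: "a > -1 \<Longrightarrow> b > -1 \<Longrightarrow> jacobi_weight a b x \<ge> 0"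
  using jacobi_density_nonneg[of a b x] by (simp add: jacobi_weight_def)

lemma jacobi_density_measurable [measurable]: "jacobi_density a b \<in> borel_measurable borel"
  unfolding jacobi_density_def[abs_def] by measurable

lemma jacobi_weight_measurable [measurable]: "jacobi_weight a b \<in> borel_measurable borel"
  unfolding jacobi_weight_def[abs_def] by measurable

lemma has_integral_jacobi_density:
  assumes "a > -1" "b > -1"
  shows "(jacobi_density a b has_integral 1) {-1..1}"
proof -
  define Z where "Z = 2 powr (a + b + 1) * Beta (a + 1) (b + 1)"
  have Z: "Z > 0" unfolding Z_def using jacobi_density_const_pos[OF assms] .
  have "((\<lambda>t. t powr b * (1 - t) powr a) has_integral Beta (a + 1) (b + 1)) {0..1}"
    using has_integral_Beta_real[of "b + 1" "a + 1"] assms by (simp add: Beta_commute)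
  from has_integral_affinity'[of _ _ 0 1 "1/2" "1/2", OF this[unfolded cbox_interval[symmetric]]]
  have "((\<lambda>x. (x / 2 + 1 / 2) powr b * (1 - (x / 2 + 1 / 2)) powr a) has_integral
      2 * Beta (a + 1) (b + 1)) {-1..1}"
    by simp
  from has_integral_mult_right[OF this, of "2 powr (a + b) / Z"]
  have "((\<lambda>x. 2 powr (a + b) / Z * ((x / 2 + 1 / 2) powr b * (1 - (x / 2 + 1 / 2)) powr a))
      has_integral 2 powr (a + b) / Z * (2 * Beta (a + 1) (b + 1))) {-1..1}" .
  also have "2 powr (a + b) / Z * (2 * Beta (a + 1) (b + 1)) = 1"
  proof -
    have "Beta (a + 1) (b + 1) \<noteq> 0" using Z by (auto simp: Z_def)
    then show ?thesis by (simp add: Z_def powr_add)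
  qed
  finally show ?thesis
  proof (rule has_integral_eq[rotated])
    fix x :: real assume x: "x \<in> {-1..1}"
    have "(x / 2 + 1 / 2) powr b = (1 + x) powr b / 2 powr b"
      using x powr_divide[of "1 + x" 2 b] by (simp add: add_divide_distrib add.commute)
    moreover have "(1 - (x / 2 + 1 / 2)) powr a = (1 - x) powr a / 2 powr a"
      using x powr_divide[of "1 - x" 2 a] by (simp add: diff_divide_distrib)
    ultimately show "2 powr (a + b) / Z * ((x / 2 + 1 / 2) powr b * (1 - (x / 2 + 1 / 2)) powr a) =
        jacobi_density a b x"
      by (simp add: jacobi_density_def Z_def powr_add mult_ac)
  qed
qed

lemma jacobi_weight_integral:
  assumes "a > -1" "b > -1"
  shows "integrable lborel (jacobi_weight a b)" "(\<integral>x. jacobi_weight a b x \<partial>lborel) = 1"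
proof -
  have "jacobi_density a b absolutely_integrable_on {-1..1}"
    using has_integral_jacobi_density[OF assms] jacobi_density_nonneg[OF assms]
    by (intro nonnegative_absolutely_integrable_1) auto
  then have "integrable lebesgue (jacobi_weight a b)"
    by (simp add: set_integrable_def jacobi_weight_def[abs_def])
  then show i: "integrable lborel (jacobi_weight a b)"
    by (subst (asm) integrable_completion) auto
  have "(jacobi_weight a b has_integral (\<integral>x. jacobi_weight a b x \<partial>lborel)) UNIV"
    using has_integral_integral_lborel[OF i] .
  moreover have "(jacobi_weight a b has_integral 1) UNIV"
  proof -
    have "((\<lambda>x. if x \<in> {-1..1} then jacobi_density a b x else 0) has_integral 1) UNIV"
      using has_integral_jacobi_density[OF assms] by (simp only: has_integral_restrict_UNIV)
    then show ?thesis by (rule has_integral_eq[rotated]) (simp add: jacobi_weight_def)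
  qed
  ultimately show "(\<integral>x. jacobi_weight a b x \<partial>lborel) = 1"
    by (rule has_integral_unique)
qed

lemma continuous_on_poly_real: "continuous_on S (poly (q :: real poly))"
  by (rule continuous_at_imp_continuous_on) simp

lemma poly_borel_measurable [measurable]: "poly q \<in> borel_measurable (borel :: real measure)"
  by (rule borel_measurable_continuous_onI[OF continuous_on_poly_real])

lemma poly_bounded_interval: "\<exists>M\<ge>0. \<forall>x\<in>{-1..1::real}. \<bar>poly q x\<bar> \<le> M"
proof -
  have "bounded (poly q ` {-1..1})"
    by (rule compact_imp_bounded[OF compact_continuous_image[OF continuous_on_poly_real compact_Icc]])
  then obtain M where M: "\<forall>y\<in>poly q ` {-1..1}. \<bar>y\<bar> \<le> M"
    unfolding bounded_real by auto
  have "\<bar>poly q x\<bar> \<le> M" if "x \<in> {-1..1}" for x using M that by blast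
  moreover have "0 \<le> M" using calculation[of 0]
    by (meson abs_ge_zero atLeastAtMost_iff order_trans le_minus_one_simps(1) zero_le_one)
  ultimately show ?thesis by blast
qed

lemma integrable_jacobi_weight_poly:
  assumes "a > -1" "b > -1"
  shows "integrable lborel (\<lambda>x. jacobi_weight a b x * poly q x)"
proof -
  obtain M where M: "M \<ge> 0" "\<forall>x\<in>{-1..1}. \<bar>poly q x\<bar> \<le> M" using poly_bounded_interval by blast
  show ?thesis
  proof (rule Bochner_Integration.integrable_bound)
    show "integrable lborel (\<lambda>x. M * jacobi_weight a b x)"
      using jacobi_weight_integral[OF assms] by simp
    show "AE x in lborel. norm (jacobi_weight a b x * poly q x) \<le> norm (M * jacobi_weight a b x)"
    proof (rule AE_I2)
      fix x
      have "\<bar>jacobi_weight a b x\<bar> * \<bar>poly q x\<bar> \<le> \<bar>jacobi_weight a b x\<bar> * M"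
        using M by (cases "x \<in> {-1..1}") (auto intro: mult_left_mono simp: jacobi_weight_def)
      then show "norm (jacobi_weight a b x * poly q x) \<le> norm (M * jacobi_weight a b x)"
        using M(1) by (simp add: abs_mult mult.commute)
    qed
  qed measurable
qed

lemma integral_jacobi_measure_1:
  assumes ab: "a > -1" "b > -1" and f [measurable]: "f \<in> borel_measurable borel"
  shows "integral\<^sup>L (jacobi_measure_1 a b) f = (\<integral>x. jacobi_weight a b x * f x \<partial>lborel)"
proof -
  have "integral\<^sup>L (jacobi_measure_1 a b) f =
      integral\<^sup>L (restrict_space lborel {-1..1}) (\<lambda>x. jacobi_density a b x *\<^sub>R f x)"
    unfolding jacobi_measure_1_def
  proof (rule integral_density)
    show "AE x in restrict_space lborel {-1..1}. 0 \<le> jacobi_density a b x"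
      using jacobi_density_nonneg[OF ab] by simp
  qed (simp_all add: measurable_restrict_space1)
  also have "\<dots> = (\<integral>x. indicator {-1..1} x *\<^sub>R (jacobi_density a b x *\<^sub>R f x) \<partial>lborel)"
    by (rule integral_restrict_space) auto
  finally show ?thesis by (simp add: jacobi_weight_def mult.assoc)
qed

lemma continuous_on_jacobi_weight_poly:
  fixes q :: "real poly"
  assumes "A > 0" "B > 0" "S \<subseteq> {-1..1}"
  shows "continuous_on S (\<lambda>t. (1 - t) powr A * (1 + t) powr B * poly q t)"
proof -
  have "continuous_on S (\<lambda>t. (1 - t) powr A)"
    by (rule continuous_on_powr'[of S "\<lambda>t. 1 - t" "\<lambda>_. A"]) (use assms in \<open>auto intro!: continuous_intros\<close>)
  moreover have "continuous_on S (\<lambda>t. (1 + t) powr B)"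
    by (rule continuous_on_powr'[of S "\<lambda>t. 1 + t" "\<lambda>_. B"]) (use assms in \<open>auto intro!: continuous_intros\<close>)
  ultimately show ?thesis by (intro continuous_on_mult continuous_on_poly_real)
qed

text \<open>The integrand is the derivative of \<open>(1 - x) powr (a + 1) * (1 + x) powr (b + 1) * v x\<close>, which
  vanishes at both endpoints since the exponents are positive.\<close>
lemma integral_rodrigues_step:
  assumes ab: "a > -1" "b > -1"
  shows "(\<integral>x. jacobi_weight a b x * poly (rodrigues_step (a + 1) (b + 1) v) x \<partial>lborel) = 0"
proof -
  define Z where "Z = 2 powr (a + b + 1) * Beta (a + 1) (b + 1)"
  let ?r = "poly (rodrigues_step (a + 1) (b + 1) v)"
  let ?F = "\<lambda>t. (1 - t) powr (a + 1) * (1 + t) powr (b + 1) * poly v t"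
  have "((\<lambda>x. (1 - x) powr a * (1 + x) powr b * ?r x) has_integral (?F 1 - ?F (-1))) {-1..1}"
  proof (rule fundamental_theorem_of_calculus_interior)
    show "continuous_on {-1..1} ?F"
      using ab by (intro continuous_on_jacobi_weight_poly) auto
    show "(?F has_vector_derivative (1 - x) powr a * (1 + x) powr b * ?r x) (at x)"
      if "x \<in> {-1<..<1}" for x
      using has_derivative_jacobi_weight[OF that, of "a + 1" "b + 1" v]
      by (simp add: has_real_derivative_iff_has_vector_derivative)
  qed simp
  then have "((\<lambda>x. (1 - x) powr a * (1 + x) powr b * ?r x / Z) has_integral 0) {-1..1}"
    using has_integral_divide[of _ 0 "{-1..1}" Z] by simp
  then have "((\<lambda>x. jacobi_weight a b x * ?r x) has_integral 0) UNIV"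
  proof -
    assume "((\<lambda>x. (1 - x) powr a * (1 + x) powr b * ?r x / Z) has_integral 0) {-1..1}"
    then have "((\<lambda>x. if x \<in> {-1..1} then (1 - x) powr a * (1 + x) powr b * ?r x / Z else 0)
        has_integral 0) UNIV"
      by (simp only: has_integral_restrict_UNIV)
    then show ?thesis
      by (rule has_integral_eq[rotated]) (simp add: jacobi_weight_def jacobi_density_def Z_def)
  qed
  moreover have "((\<lambda>x. jacobi_weight a b x * ?r x) has_integral
      (\<integral>x. jacobi_weight a b x * ?r x \<partial>lborel)) UNIV"
    by (intro has_integral_integral_lborel integrable_jacobi_weight_poly ab)
  ultimately show ?thesis by (rule has_integral_unique[symmetric])
qed

lemma jacobi_eigenfunctions_orthogonal:
  assumes ab: "a > -1" "b > -1"
    and p: "jacobi_op a b p = smult l p" and q: "jacobi_op a b q = smult m q" and "l \<noteq> m"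
  shows "(\<integral>x. jacobi_weight a b x * (poly p x * poly q x) \<partial>lborel) = 0"
proof -
  have "smult (l - m) (p * q) = jacobi_op a b p * q - p * jacobi_op a b q"
    unfolding p q mult_smult_left mult_smult_right smult_diff_left ..
  also have "\<dots> = rodrigues_step (a + 1) (b + 1) (pderiv p * q - p * pderiv q)"
    by (rule jacobi_op_symmetric_defect)
  finally have "(\<integral>x. jacobi_weight a b x * poly (smult (l - m) (p * q)) x \<partial>lborel) = 0"
    using integral_rodrigues_step[OF ab] by simp
  then have "(l - m) * (\<integral>x. jacobi_weight a b x * (poly p x * poly q x) \<partial>lborel) = 0"
    by (simp add: mult.left_commute)
  then show ?thesis using \<open>l \<noteq> m\<close> by simp
qed

subsection \<open>Sup norms against square means\<close>

lemma jacobi_density_lower: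
  assumes ab: "a > -1" "b > -1" and e: "0 < e" "e \<le> 1" "e \<le> 1 - x" "e \<le> 1 + x"
  shows "(e / 2) powr (\<bar>a\<bar> + \<bar>b\<bar>) / (2 powr (a + b + 1) * Beta (a + 1) (b + 1)) \<le> jacobi_density a b x"
proof -
  \<comment> \<open>For \<open>c < 0\<close> the worst case is \<open>y = 2\<close>, and \<open>e / 2 \<le> 1 / 2\<close> covers it.\<close>
  have *: "(e / 2) powr \<bar>c\<bar> \<le> y powr c" if "e \<le> y" "y \<le> 2" for c y
  proof (cases "c \<ge> 0")
    case True
    then have "(e / 2) powr c \<le> y powr c" using that e by (intro powr_mono2) auto
    then show ?thesis using True by simp
  next
    case False
    have "(e / 2) powr \<bar>c\<bar> \<le> (1 / 2) powr \<bar>c\<bar>"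
      using e by (intro powr_mono2) auto
    also have "\<dots> = 2 powr c"
      using False by (simp add: powr_divide powr_minus_divide)
    also have "\<dots> \<le> y powr c" using False that e by (intro powr_mono2') auto
    finally show ?thesis .
  qed
  have "(e / 2) powr \<bar>a\<bar> * (e / 2) powr \<bar>b\<bar> \<le> (1 - x) powr a * (1 + x) powr b"
    using e by (intro mult_mono *) auto
  then show ?thesis
    using jacobi_density_const_pos[OF ab]
    by (simp add: jacobi_density_def powr_add divide_right_mono)
qed

text \<open>If the derivative of \<open>q\<close> is at most \<open>K * \<bar>q x0\<bar>\<close>, then \<open>\<bar>q\<bar>\<close> stays above \<open>\<bar>q x0\<bar> / 2\<close> on an interval of
  length \<open>1 / (2 * K)\<close> at \<open>x0\<close>. The middle half of this interval keeps away from the endpoints, so its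
  weight is bounded below by a negative power of \<open>K\<close>.\<close>
lemma square_mean_lower_bound:
  assumes ab: "a > -1" "b > -1" and K: "K \<ge> 1" and x0: "x0 \<in> {-1..1}"
    and q': "\<And>x. x \<in> {-1..1} \<Longrightarrow> \<bar>poly (pderiv q) x\<bar> \<le> K * \<bar>poly q x0\<bar>"
  shows "(poly q x0)\<^sup>2 * (1 / (16 * K)) powr (1 + \<bar>a\<bar> + \<bar>b\<bar>) / (4 * (2 powr (a + b + 1) * Beta (a + 1) (b + 1)))
     \<le> (\<integral>x. jacobi_weight a b x * (poly q x)\<^sup>2 \<partial>lborel)"
proof -
  define Z where "Z = 2 powr (a + b + 1) * Beta (a + 1) (b + 1)"
  have Z: "Z > 0" unfolding Z_def using jacobi_density_const_pos[OF ab] .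
  define M where "M = \<bar>poly q x0\<bar>"
  define l where "l = 1 / (2 * K)"
  have l: "0 < l" "l \<le> 1 / 2" "K * l = 1 / 2" using K by (auto simp: l_def field_simps)
  \<comment> \<open>The interval extends from \<open>x0\<close> towards the origin, so it does not leave \<open>[-1, 1]\<close>.\<close>
  define u where "u = (if x0 \<le> 0 then x0 else x0 - l)"
  have u: "u \<le> x0" "x0 \<le> u + l" "-1 \<le> u" "u + l \<le> 1"
    using x0 l by (auto simp: u_def)
  define J where "J = {u + l / 4..u + 3 * l / 4}"
  define c where "c = (l / 8) powr (\<bar>a\<bar> + \<bar>b\<bar>) / Z * (M\<^sup>2 / 4)"
  have half: "M / 2 \<le> \<bar>poly q x\<bar>" if "x \<in> J" for x
  proof -
    have x: "\<bar>x - x0\<bar> \<le> l" "x \<in> {-1..1}" using that u l by (auto simp: J_def)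
    have "norm (poly q x - poly q x0) \<le> K * M * norm (x - x0)"
    proof (rule field_differentiable_bound[of "{-1..1}"])
      show "(poly q has_field_derivative poly (pderiv q) z) (at z within {-1..1})" for z
        using poly_DERIV[of q z] by (rule has_field_derivative_at_within)
    qed (use q' x x0 in \<open>auto simp: M_def\<close>)
    also have "\<dots> \<le> K * M * l" using x K by (intro mult_left_mono) (auto simp: M_def)
    also have "\<dots> = M / 2" using l(3) by (simp add: mult.commute mult.left_commute)
    finally show ?thesis unfolding M_def real_norm_def by linarith
  qed
  have "l / 2 * c = (\<integral>x. indicator J x * c \<partial>lborel)"
    using l by (simp add: J_def mult.commute)
  also have "\<dots> \<le> (\<integral>x. jacobi_weight a b x * (poly q x)\<^sup>2 \<partial>lborel)"
  proof (rule integral_mono)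
    show "integrable lborel (\<lambda>x. indicator J x * c)"
      by (intro integrable_mult_left integrable_real_indicator)
        (auto simp: J_def emeasure_lborel_Icc_eq)
    show "integrable lborel (\<lambda>x. jacobi_weight a b x * (poly q x)\<^sup>2)"
      using integrable_jacobi_weight_poly[OF ab, of "q\<^sup>2"] by simp
    fix x
    show "indicator J x * c \<le> jacobi_weight a b x * (poly q x)\<^sup>2"
    proof (cases "x \<in> J")
      case True
      have x: "l / 4 \<le> 1 - x" "l / 4 \<le> 1 + x" "x \<in> {-1..1}" using True u l by (auto simp: J_def)
      have "(l / 4 / 2) powr (\<bar>a\<bar> + \<bar>b\<bar>) / Z \<le> jacobi_density a b x"
        unfolding Z_def using x l by (intro jacobi_density_lower ab) auto
      moreover have "(M / 2)\<^sup>2 \<le> \<bar>poly q x\<bar>\<^sup>2"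
        using half[OF True] by (intro power_mono) (auto simp: M_def)
      ultimately have "c \<le> jacobi_density a b x * (poly q x)\<^sup>2"
        unfolding c_def using Z jacobi_density_nonneg[OF ab, of x]
        by (intro mult_mono) (auto simp: power_divide)
      then show ?thesis using True x by (simp add: jacobi_weight_def)
    next
      case False
      then show ?thesis using jacobi_weight_nonneg[OF ab, of x] by simp
    qed
  qed
  finally have main: "l / 2 * c \<le> (\<integral>x. jacobi_weight a b x * (poly q x)\<^sup>2 \<partial>lborel)" .
  have l8: "l / 8 = 1 / (16 * K)" by (simp add: l_def)
  have "M\<^sup>2 * (l / 8) powr (1 + \<bar>a\<bar> + \<bar>b\<bar>) / (4 * Z) = l / 8 * c"
    using l by (simp add: c_def powr_add)
  also have "\<dots> \<le> l / 2 * c" using l Z by (intro mult_right_mono) (auto simp: c_def)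
  finally have "M\<^sup>2 * (l / 8) powr (1 + \<bar>a\<bar> + \<bar>b\<bar>) / (4 * Z)
      \<le> (\<integral>x. jacobi_weight a b x * (poly q x)\<^sup>2 \<partial>lborel)"
    using main by (rule order_trans)
  then show ?thesis unfolding l8 M_def Z_def power2_abs .
qed

lemma poly_max_attained: "\<exists>x0\<in>{-1..1}. \<forall>x\<in>{-1..1::real}. \<bar>poly q x\<bar> \<le> \<bar>poly q x0\<bar>"
  by (rule continuous_attains_sup[OF compact_Icc _ continuous_on_rabs[OF continuous_on_poly_real]]) simp

lemma square_mean_pos:
  assumes ab: "a > -1" "b > -1" and q: "q \<noteq> 0"
  shows "(\<integral>x. jacobi_weight a b x * (poly q x)\<^sup>2 \<partial>lborel) > 0"
proof -
  obtain x0 where x0: "x0 \<in> {-1..1}" "\<forall>x\<in>{-1..1}. \<bar>poly q x\<bar> \<le> \<bar>poly q x0\<bar>"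
    using poly_max_attained by blast
  have nz: "poly q x0 \<noteq> 0"
  proof
    assume "poly q x0 = 0"
    then have "{-1..1} \<subseteq> {x. poly q x = 0}" using x0 by auto
    then show False using poly_roots_finite[OF q] infinite_Icc[of "-1::real" 1] finite_subset
      by (metis less_numeral_extra(3) neg_less_iff_less neg_less_pos zero_less_one)
  qed
  obtain M where M: "M \<ge> 0" "\<forall>x\<in>{-1..1}. \<bar>poly (pderiv q) x\<bar> \<le> M" using poly_bounded_interval by blast
  define K where "K = max 1 (M / \<bar>poly q x0\<bar>)"
  have "M / \<bar>poly q x0\<bar> * \<bar>poly q x0\<bar> \<le> K * \<bar>poly q x0\<bar>"
    by (intro mult_right_mono) (auto simp: K_def)
  then have "\<bar>poly (pderiv q) x\<bar> \<le> K * \<bar>poly q x0\<bar>" if "x \<in> {-1..1}" for x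
    using M(2) that nz by fastforce
  then have "(poly q x0)\<^sup>2 * (1 / (16 * K)) powr (1 + \<bar>a\<bar> + \<bar>b\<bar>) /
      (4 * (2 powr (a + b + 1) * Beta (a + 1) (b + 1)))
     \<le> (\<integral>x. jacobi_weight a b x * (poly q x)\<^sup>2 \<partial>lborel)"
    using x0(1) by (intro square_mean_lower_bound ab) (auto simp: K_def)
  moreover have "0 < (poly q x0)\<^sup>2 * (1 / (16 * K)) powr (1 + \<bar>a\<bar> + \<bar>b\<bar>) /
      (4 * (2 powr (a + b + 1) * Beta (a + 1) (b + 1)))"
    using nz Beta_pos[OF ab]
    by (intro divide_pos_pos mult_pos_pos) (auto simp: K_def)
  ultimately show ?thesis by linarith
qed

subsection \<open>Growth of Jacobi polynomials\<close>

text \<open>The flux \<open>(1 - t) powr (a + 1) * (1 + t) powr (b + 1) * q' t\<close> of an eigenfunction vanishes at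
  \<open>t = 1\<close> and has derivative \<open>- l * (1 - t) powr a * (1 + t) powr b * q t\<close>; comparing it with a
  multiple of \<open>(1 - t) powr (a + 1)\<close> on the right half of the interval cancels the degenerate
  factor.\<close>
lemma eigenfunction_deriv_bound_right:
  assumes ab: "a > -1" "b > -1" and l: "l \<ge> 0"
    and eig: "jacobi_op a b q = smult (- l) q"
    and M: "\<And>x. x \<in> {-1..1} \<Longrightarrow> \<bar>poly q x\<bar> \<le> M" and x: "x \<in> {0..1}"
  shows "\<bar>poly (pderiv q) x\<bar> \<le> 2 powr \<bar>b\<bar> / (a + 1) * l * M"
proof -
  define C where "C = 2 powr \<bar>b\<bar>"
  have C: "C \<ge> 1" unfolding C_def by (rule ge_one_powr_ge_zero) auto
  have M0: "M \<ge> 0" using M[of 0] by auto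
  define g where "g t = (1 - t) powr (a + 1) * (1 + t) powr (b + 1) * poly (pderiv q) t" for t
  define h where "h t = l * M * C / (a + 1) * (1 - t) powr (a + 1)" for t
  have cont_g: "continuous_on {x..1} g" unfolding g_def
    using x ab by (intro continuous_on_jacobi_weight_poly) auto
  have "continuous_on {x..1} (\<lambda>t. (1 - t) powr (a + 1))"
    by (rule continuous_on_powr'[of "{x..1}" "\<lambda>t. 1 - t" "\<lambda>_. a + 1"])
      (use ab in \<open>auto intro!: continuous_intros\<close>)
  then have cont_h: "continuous_on {x..1} h" unfolding h_def by (intro continuous_on_mult continuous_on_const)
  have dg: "(g has_real_derivative - l * ((1 - t) powr a * (1 + t) powr b * poly q t)) (at t)"
    if "t \<in> {-1<..<1}" for t
    using has_derivative_jacobi_weight[OF that, of "a + 1" "b + 1" "pderiv q"] eig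
    unfolding g_def by (simp add: jacobi_op_def mult_ac)
  have dh: "(h has_real_derivative - (l * M * C * (1 - t) powr a)) (at t)" if "t \<in> {-1<..<1}" for t
    unfolding h_def using that ab by (auto intro!: derivative_eq_intros)
  have bd: "\<bar>l * ((1 - t) powr a * (1 + t) powr b * poly q t)\<bar> \<le> l * M * C * (1 - t) powr a"
    if t: "t \<in> {0<..<1}" for t
  proof -
    have "(1 + t) powr b \<le> (1 + t) powr \<bar>b\<bar>" using t by (intro powr_mono) auto
    also have "\<dots> \<le> C" unfolding C_def using t by (intro powr_mono2) auto
    finally have "(1 + t) powr b * \<bar>poly q t\<bar> \<le> C * M"
      using M[of t] t C by (intro mult_mono) auto
    then have "l * (1 - t) powr a * ((1 + t) powr b * \<bar>poly q t\<bar>) \<le> l * (1 - t) powr a * (C * M)"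
      using l by (intro mult_left_mono) auto
    then show ?thesis using l by (simp add: abs_mult mult_ac)
  qed
  show ?thesis
  proof (cases "x = 1")
    case True
    have "2 * (a + 1) * poly (pderiv q) 1 = l * poly q 1"
      using arg_cong[OF eig, of "\<lambda>p. poly p 1"] by (simp add: poly_jacobi_op algebra_simps)
    from arg_cong[OF this, of abs] have "2 * (a + 1) * \<bar>poly (pderiv q) 1\<bar> = l * \<bar>poly q 1\<bar>"
      using ab l by (simp add: abs_mult)
    also have "\<dots> \<le> l * M" using M[of 1] l by (intro mult_left_mono) auto
    also have "\<dots> \<le> 2 * (C * (l * M))"
      using C l M0 mult_right_mono[of 1 C "l * M"] mult_nonneg_nonneg[OF l M0] by linarith
    finally have "(a + 1) * \<bar>poly (pderiv q) 1\<bar> \<le> C * (l * M)"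
      unfolding mult.assoc by linarith
    then show ?thesis using True ab by (simp add: C_def field_simps)
  next
    case False
    then have x: "0 \<le> x" "x < 1" using x by auto
    have "h 1 - g 1 \<le> h x - g x"
    proof (rule DERIV_nonpos_imp_decreasing_open[where f = "\<lambda>t. h t - g t"])
      fix t assume t: "x < t" "t < 1"
      have "((\<lambda>t. h t - g t) has_real_derivative - (l * M * C * (1 - t) powr a) -
          - l * ((1 - t) powr a * (1 + t) powr b * poly q t)) (at t)"
        using t x by (intro DERIV_diff dg dh) auto
      moreover have "- (l * M * C * (1 - t) powr a) -
          - l * ((1 - t) powr a * (1 + t) powr b * poly q t) \<le> 0"
        using bd[of t] t x by auto
      ultimately show "\<exists>y. ((\<lambda>t. h t - g t) has_real_derivative y) (at t) \<and> y \<le> 0"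
        by blast
    qed (use x in \<open>auto intro!: continuous_on_diff cont_g cont_h\<close>)
    moreover have "h 1 + g 1 \<le> h x + g x"
    proof (rule DERIV_nonpos_imp_decreasing_open[where f = "\<lambda>t. h t + g t"])
      fix t assume t: "x < t" "t < 1"
      have "((\<lambda>t. h t + g t) has_real_derivative - (l * M * C * (1 - t) powr a) +
          - l * ((1 - t) powr a * (1 + t) powr b * poly q t)) (at t)"
        using t x by (intro DERIV_add dg dh) auto
      moreover have "- (l * M * C * (1 - t) powr a) +
          - l * ((1 - t) powr a * (1 + t) powr b * poly q t) \<le> 0"
        using bd[of t] t x by auto
      ultimately show "\<exists>y. ((\<lambda>t. h t + g t) has_real_derivative y) (at t) \<and> y \<le> 0"
        by blast
    qed (use x in \<open>auto intro!: continuous_on_add cont_g cont_h\<close>)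
    moreover have "h 1 = 0" "g 1 = 0" using ab by (simp_all add: h_def g_def)
    ultimately have "\<bar>g x\<bar> \<le> h x" by linarith
    moreover have "\<bar>g x\<bar> = (1 - x) powr (a + 1) * ((1 + x) powr (b + 1) * \<bar>poly (pderiv q) x\<bar>)"
      using x by (simp add: g_def abs_mult)
    ultimately have "(1 - x) powr (a + 1) * ((1 + x) powr (b + 1) * \<bar>poly (pderiv q) x\<bar>)
        \<le> (1 - x) powr (a + 1) * (l * M * C / (a + 1))"
      by (simp add: h_def mult.commute)
    then have "(1 + x) powr (b + 1) * \<bar>poly (pderiv q) x\<bar> \<le> l * M * C / (a + 1)"
      using x by (subst (asm) mult_le_cancel_left_pos) auto
    moreover have "1 * \<bar>poly (pderiv q) x\<bar> \<le> (1 + x) powr (b + 1) * \<bar>poly (pderiv q) x\<bar>"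
      using x ab by (intro mult_right_mono ge_one_powr_ge_zero) auto
    ultimately show ?thesis by (simp add: C_def mult_ac)
  qed
qed

lemma jacobi_op_reflect:
  "jacobi_op b a (pcompose q [:0, -1:]) = pcompose (jacobi_op a b q) [:0, -1:]"
  unfolding poly_eq_poly_eq_iff[symmetric]
  by (rule ext) (simp add: poly_jacobi_op poly_pcompose pderiv_pcompose pderiv_mult pderiv_pCons
      pderiv_minus algebra_simps)

text \<open>The left half of the interval follows from the right one by the reflection \<open>x \<mapsto> - x\<close>, which swaps
  the parameters.\<close>
lemma eigenfunction_deriv_bound:
  assumes ab: "a > -1" "b > -1" and l: "l \<ge> 0"
    and eig: "jacobi_op a b q = smult (- l) q"
    and M: "\<And>x. x \<in> {-1..1} \<Longrightarrow> \<bar>poly q x\<bar> \<le> M" and x: "x \<in> {-1..1}"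
  shows "\<bar>poly (pderiv q) x\<bar> \<le> (2 powr \<bar>b\<bar> / (a + 1) + 2 powr \<bar>a\<bar> / (b + 1)) * l * M"
proof -
  have M0: "M \<ge> 0" using M[of 0] by auto
  define R where "R = 2 powr \<bar>b\<bar> / (a + 1) * l * M"
  define L where "L = 2 powr \<bar>a\<bar> / (b + 1) * l * M"
  have nn: "R \<ge> 0" "L \<ge> 0" using ab l M0 by (simp_all add: R_def L_def)
  have "\<bar>poly (pderiv q) x\<bar> \<le> R + L"
  proof (cases "x \<ge> 0")
    case True
    then show ?thesis
      using eigenfunction_deriv_bound_right[OF ab l eig M, of x] x nn by (simp add: R_def)
  next
    case False
    let ?r = "pcompose q [:0, -1:]"
    have "\<bar>poly (pderiv ?r) (- x)\<bar> \<le> L" unfolding L_def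
    proof (rule eigenfunction_deriv_bound_right)
      show "jacobi_op b a ?r = smult (- l) ?r"
        by (simp add: jacobi_op_reflect eig pcompose_smult pcompose_uminus)
      show "\<bar>poly ?r y\<bar> \<le> M" if "y \<in> {-1..1}" for y
        using M[of "- y"] that by (simp add: poly_pcompose)
    qed (use ab l x False in auto)
    then show ?thesis using nn by (simp add: pderiv_pcompose poly_pcompose pderiv_pCons)
  qed
  then show ?thesis by (simp add: R_def L_def algebra_simps)
qed

subsection \<open>The normalised Jacobi polynomials\<close>

lemma poly_eq_if_eq_on_interval:
  fixes p q :: "real poly"
  assumes "\<And>x. x \<in> {-1<..<1} \<Longrightarrow> poly p x = poly q x"
  shows "p = q"
proof (rule ccontr)
  assume "p \<noteq> q"
  then have "finite {x. poly (p - q) x = 0}" by (intro poly_roots_finite) simp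
  moreover have "{-1<..<1::real} \<subseteq> {x. poly (p - q) x = 0}" using assms by auto
  ultimately show False
    using infinite_Ioo[of "-1::real" 1] finite_subset by (metis minus_less_iff neg_less_pos zero_less_one)
qed

text \<open>Rodrigues' formula determines the polynomial up to a positive factor, which the norm fixes; so the
  definite description denotes a nonzero multiple of the Rodrigues polynomial.\<close>
lemma jacobi_poly_properties:
  assumes ab: "a > -1" "b > -1"
  shows "jacobi_op a b (jacobi_poly n a b) =
      smult (- (real n * (real n + a + b + 1))) (jacobi_poly n a b)"
    and "(\<integral>x. jacobi_weight a b x * (poly (jacobi_poly n a b) x)\<^sup>2 \<partial>lborel) = 1"
    and "jacobi_poly n a b \<noteq> 0"
proof -
  define Q where "Q = rodrigues_poly n a b"
  have Q0: "Q \<noteq> 0" unfolding Q_def by (rule rodrigues_poly_nonzero[OF ab(1)])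
  define I where "I = (\<integral>x. jacobi_weight a b x * (poly Q x)\<^sup>2 \<partial>lborel)"
  have I: "I > 0" unfolding I_def by (rule square_mean_pos[OF ab Q0])
  define e where "e = (-1) ^ n / (2 ^ n * fact n :: real)"
  have e: "e \<noteq> 0" "\<bar>e\<bar> > 0" by (auto simp: e_def)
  define k where "k = (-1) ^ n / sqrt I"
  have k: "k \<noteq> 0" "k\<^sup>2 * I = 1" using I by (auto simp: k_def power_divide power_mult[symmetric])
  have norm: "(\<integral>x. (poly (smult c Q) x)\<^sup>2 \<partial>jacobi_measure_1 a b) = c\<^sup>2 * I" for c
  proof -
    have "(\<integral>x. (poly (smult c Q) x)\<^sup>2 \<partial>jacobi_measure_1 a b) =
        (\<integral>x. jacobi_weight a b x * (poly (smult c Q) x)\<^sup>2 \<partial>lborel)"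
      by (rule integral_jacobi_measure_1[OF ab]) measurable
    also have "\<dots> = (\<integral>x. c\<^sup>2 * (jacobi_weight a b x * (poly Q x)\<^sup>2) \<partial>lborel)"
      by (simp add: power_mult_distrib mult_ac)
    finally show ?thesis by (simp add: I_def)
  qed
  have rodr: "(\<forall>x\<in>{-1<..<1}. (1 - x) powr a * (1 + x) powr b * c * poly P x =
      (-1) ^ n / (2 ^ n * fact n) *
        (deriv ^^ n) (\<lambda>t. (1 - t) powr (a + real n) * (1 + t) powr (b + real n)) x)
    \<longleftrightarrow> smult c P = smult e Q" for c P
  proof
    assume *: "\<forall>x\<in>{-1<..<1}. (1 - x) powr a * (1 + x) powr b * c * poly P x =
      (-1) ^ n / (2 ^ n * fact n) *
        (deriv ^^ n) (\<lambda>t. (1 - t) powr (a + real n) * (1 + t) powr (b + real n)) x"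
    show "smult c P = smult e Q"
    proof (rule poly_eq_if_eq_on_interval)
      fix x :: real assume x: "x \<in> {-1<..<1}"
      then have "((1 - x) powr a * (1 + x) powr b) * (c * poly P x) =
          ((1 - x) powr a * (1 + x) powr b) * (e * poly Q x)"
        using * deriv_iterate_jacobi_weight[OF x, of n a b] by (simp add: e_def Q_def mult_ac)
      then show "poly (smult c P) x = poly (smult e Q) x" using x by simp
    qed
  next
    assume *: "smult c P = smult e Q"
    show "\<forall>x\<in>{-1<..<1}. (1 - x) powr a * (1 + x) powr b * c * poly P x =
      (-1) ^ n / (2 ^ n * fact n) *
        (deriv ^^ n) (\<lambda>t. (1 - t) powr (a + real n) * (1 + t) powr (b + real n)) x"
    proof
      fix x :: real assume x: "x \<in> {-1<..<1}"
      have "c * poly P x = e * poly Q x" using arg_cong[OF *, of "\<lambda>p. poly p x"] by simp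
      then have "(1 - x) powr a * (1 + x) powr b * (c * poly P x) =
          (1 - x) powr a * (1 + x) powr b * (e * poly Q x)" by simp
      then show "(1 - x) powr a * (1 + x) powr b * c * poly P x =
        (-1) ^ n / (2 ^ n * fact n) *
          (deriv ^^ n) (\<lambda>t. (1 - t) powr (a + real n) * (1 + t) powr (b + real n)) x"
        unfolding deriv_iterate_jacobi_weight[OF x] e_def Q_def by (simp add: mult_ac)
    qed
  qed
  have iff: "is_jacobi_poly n a b P \<longleftrightarrow> P = smult k Q" for P
  proof
    assume "is_jacobi_poly n a b P"
    then obtain c where c: "c > 0" "smult c P = smult e Q"
      and P1: "(\<integral>x. (poly P x)\<^sup>2 \<partial>jacobi_measure_1 a b) = 1"
      unfolding is_jacobi_poly_def rodr by blast
    have "smult (1 / c) (smult c P) = smult (1 / c) (smult e Q)" unfolding c(2) ..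
    then have P: "P = smult (e / c) Q" using c(1) by simp
    then have "(e / c)\<^sup>2 * I = 1" using norm[of "e / c"] P1 by simp
    then have "(e / c)\<^sup>2 = k\<^sup>2" using k(2) I by (metis mult_right_cancel less_irrefl)
    moreover have "sgn (e / c) = sgn k"
      using c(1) I by (simp add: e_def k_def sgn_divide sgn_mult)
    ultimately have "e / c = k" by (metis power2_eq_iff sgn_minus sgn_0_0 neg_equal_zero e(1) k(1))
    then show "P = smult k Q" using P by simp
  next
    assume P: "P = smult k Q"
    have "sqrt I / (2 ^ n * fact n) > 0" using I by simp
    moreover have "smult (sqrt I / (2 ^ n * fact n)) P = smult e Q"
      using I by (simp add: P k_def e_def)
    moreover have "(\<integral>x. (poly P x)\<^sup>2 \<partial>jacobi_measure_1 a b) = 1"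
      unfolding P norm k(2) ..
    ultimately show "is_jacobi_poly n a b P"
      unfolding is_jacobi_poly_def rodr by blast
  qed
  have P: "jacobi_poly n a b = smult k Q" unfolding jacobi_poly_def iff by simp
  show "jacobi_op a b (jacobi_poly n a b) =
      smult (- (real n * (real n + a + b + 1))) (jacobi_poly n a b)"
    unfolding P jacobi_op_smult by (simp add: Q_def jacobi_op_rodrigues_poly mult.commute)
  show "(\<integral>x. jacobi_weight a b x * (poly (jacobi_poly n a b) x)\<^sup>2 \<partial>lborel) = 1"
    using norm[of k] k(2) integral_jacobi_measure_1[OF ab, of "\<lambda>x. (poly (smult k Q) x)\<^sup>2"]
    unfolding P by simp
  show "jacobi_poly n a b \<noteq> 0" using P Q0 k by simp
qed

lemma degree_jacobi_poly:
  assumes "a > -1/2" "b > -1/2"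
  shows "degree (jacobi_poly n a b) = n"
  using assms by (intro degree_jacobi_eigenfunction[of a b] jacobi_poly_properties) auto

lemma jacobi_poly_orthonormal:
  assumes ab: "a > -1/2" "b > -1/2"
  shows "(\<integral>x. jacobi_weight a b x * (poly (jacobi_poly m a b) x * poly (jacobi_poly n a b) x) \<partial>lborel) =
    (if m = n then 1 else 0)"
proof (cases "m = n")
  case True
  then show ?thesis using jacobi_poly_properties(2)[of a b n] ab by (simp add: power2_eq_square)
next
  case False
  have "real n * (real n + a + b + 1) - real m * (real m + a + b + 1)
      = (real n - real m) * (real n + real m + (a + b + 1))"
    by (simp add: algebra_simps)
  moreover have "real n + real m + (a + b + 1) > 0" using ab by linarith
  ultimately have "real n * (real n + a + b + 1) \<noteq> real m * (real m + a + b + 1)"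
    using False by auto
  then show ?thesis
    using False ab by (simp add: jacobi_eigenfunctions_orthogonal[OF _ _ jacobi_poly_properties(1) jacobi_poly_properties(1)])
qed

text \<open>The derivative bound for eigenfunctions allows \<open>K\<close> of order \<open>n\<^sup>2\<close> in \<open>square_mean_lower_bound\<close>, taken
  at a maximum point. Since the square mean is \<open>1\<close>, this bounds the maximum by a power of \<open>n\<close>.\<close>
lemma jacobi_poly_polynomial_growth:
  assumes ab: "a > -1/2" "b > -1/2"
  shows "\<exists>C N. 0 \<le> C \<and> (\<forall>n. \<forall>x\<in>{-1..1}. \<bar>poly (jacobi_poly n a b) x\<bar> \<le> C * real (Suc n) ^ N)"
proof -
  have ab': "a > -1" "b > -1" using ab by auto
  define Z where "Z = 2 powr (a + b + 1) * Beta (a + 1) (b + 1)"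
  have Z: "Z > 0" unfolding Z_def using jacobi_density_const_pos[OF ab'] .
  define D where "D = 2 powr \<bar>b\<bar> / (a + 1) + 2 powr \<bar>a\<bar> / (b + 1)"
  have D: "D > 0" using ab' by (simp add: D_def add_pos_pos)
  define s where "s = 1 + \<bar>a\<bar> + \<bar>b\<bar>"
  have s: "s > 0" by (simp add: s_def add_pos_nonneg)
  define c where "c = a + b + 1"
  have c: "c > 0" using ab by (simp add: c_def)
  define E where "E = 16 * (1 + D * (1 + c))"
  have E: "E > 0" using D c by (simp add: E_def add_pos_pos)
  define N where "N = nat \<lceil>s\<rceil>"
  have N: "s \<le> real N" by (simp add: N_def real_nat_ceiling_ge)
  show ?thesis
  proof (intro exI conjI allI ballI)
    show "0 \<le> sqrt (4 * Z * E powr s)" using Z by simp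
    fix n :: nat and x :: real assume x: "x \<in> {-1..1}"
    let ?P = "jacobi_poly n a b"
    define l where "l = real n * (real n + a + b + 1)"
    have l0: "l \<ge> 0" using ab by (simp add: l_def)
    have l: "l \<le> (1 + c) * (real (Suc n))\<^sup>2"
    proof -
      have "l = real n * real n + c * real n" by (simp add: l_def c_def algebra_simps)
      also have "\<dots> \<le> (real (Suc n))\<^sup>2 + c * (real (Suc n))\<^sup>2"
        using c by (intro add_mono mult_left_mono) (auto simp: power2_eq_square algebra_simps)
      finally show ?thesis by (simp add: algebra_simps)
    qed
    obtain x0 where x0: "x0 \<in> {-1..1}" "\<forall>x\<in>{-1..1}. \<bar>poly ?P x\<bar> \<le> \<bar>poly ?P x0\<bar>"
      using poly_max_attained by blast
    define K where "K = 1 + D * l"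
    have K: "K \<ge> 1" using D l0 by (simp add: K_def)
    have "(poly ?P x0)\<^sup>2 * (1 / (16 * K)) powr s / (4 * Z)
      \<le> (\<integral>x. jacobi_weight a b x * (poly ?P x)\<^sup>2 \<partial>lborel)"
      unfolding s_def Z_def
    proof (rule square_mean_lower_bound[OF ab' K x0(1)])
      fix y :: real assume y: "y \<in> {-1..1}"
      have "\<bar>poly (pderiv ?P) y\<bar> \<le> D * l * \<bar>poly ?P x0\<bar>"
        unfolding D_def
        by (rule eigenfunction_deriv_bound[OF ab' l0 _ _ y])
          (use x0(2) jacobi_poly_properties(1)[OF ab'] in \<open>auto simp: l_def\<close>)
      also have "\<dots> \<le> K * \<bar>poly ?P x0\<bar>" by (intro mult_right_mono) (auto simp: K_def)
      finally show "\<bar>poly (pderiv ?P) y\<bar> \<le> K * \<bar>poly ?P x0\<bar>" .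
    qed
    then have "(poly ?P x0)\<^sup>2 / (16 * K) powr s / (4 * Z) \<le> 1"
      using K by (simp add: jacobi_poly_properties(2)[OF ab'] powr_divide)
    then have "(poly ?P x0)\<^sup>2 \<le> 4 * Z * (16 * K) powr s"
      using Z K by (simp add: field_simps)
    also have "\<dots> \<le> 4 * Z * (E * (real (Suc n))\<^sup>2) powr s"
    proof (intro mult_left_mono powr_mono2)
      have "K \<le> (real (Suc n))\<^sup>2 + D * ((1 + c) * (real (Suc n))\<^sup>2)"
        unfolding K_def using D l by (intro add_mono mult_left_mono) auto
      then show "16 * K \<le> E * (real (Suc n))\<^sup>2" by (simp add: E_def algebra_simps)
    qed (use s K Z in auto)
    also have "\<dots> = 4 * Z * E powr s * (real (Suc n) powr s)\<^sup>2"
      using E by (simp add: powr_mult power2_eq_square)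
    also have "\<dots> \<le> 4 * Z * E powr s * (real (Suc n) ^ N)\<^sup>2"
    proof -
      have "real (Suc n) powr s \<le> real (Suc n) powr real N" using N by (intro powr_mono) auto
      then have "real (Suc n) powr s \<le> real (Suc n) ^ N" by (simp add: powr_realpow)
      then show ?thesis using Z by (intro mult_left_mono power_mono) auto
    qed
    finally have "\<bar>poly ?P x0\<bar> \<le> sqrt (4 * Z * E powr s * (real (Suc n) ^ N)\<^sup>2)"
      using real_sqrt_le_mono by fastforce
    also have "\<dots> = sqrt (4 * Z * E powr s) * real (Suc n) ^ N"
      by (simp add: real_sqrt_mult)
    finally show "\<bar>poly ?P x\<bar> \<le> sqrt (4 * Z * E powr s) * real (Suc n) ^ N"
      using x0(2) x by force
  qed
qed

section \<open>The product measure and the orthonormal basis\<close>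

text \<open>Lebesgue measure is by construction an image of a product over the basis, and the basis vectors of
  \<open>real ^ 'n\<close> are the axes; so Fubini's theorem becomes available for products over the coordinates.\<close>
lemma lborel_vec_product_integral:
  fixes f :: "'n::finite \<Rightarrow> real \<Rightarrow> real"
  assumes int: "\<And>i. integrable lborel (f i)"
  shows "integrable lborel (\<lambda>x::real^'n. \<Prod>i\<in>UNIV. f i (x $ i))"
    and "(\<integral>x. (\<Prod>i\<in>UNIV. f i (x $ i)) \<partial>(lborel :: (real^'n) measure)) = (\<Prod>i\<in>UNIV. \<integral>y. f i y \<partial>lborel)"
proof -
  interpret product_sigma_finite "\<lambda>_::real^'n. lborel :: real measure"
    by standard
  have [measurable]: "f i \<in> borel_measurable borel" for i
    using borel_measurable_integrable[OF int[of i]] by simp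
  define T :: "(real^'n \<Rightarrow> real) \<Rightarrow> real^'n" where "T y = (\<Sum>b\<in>Basis. y b *\<^sub>R b)" for y
  have T: "T \<in> measurable (\<Pi>\<^sub>M b\<in>Basis. lborel) borel"
    unfolding T_def[abs_def] by measurable
  have lb: "(lborel :: (real^'n) measure) = distr (\<Pi>\<^sub>M b\<in>Basis. lborel) borel T"
    unfolding T_def[abs_def] by (rule lborel_eq)
  have basis: "(Basis :: (real^'n) set) = range (\<lambda>i. axis i 1)"
    by (auto simp: Basis_vec_def)
  have inj: "inj (\<lambda>i::'n. axis i (1::real))"
    by (auto simp: inj_on_def axis_eq_axis)
  have comp: "T y $ i = y (axis i 1)" for y i
    unfolding T_def basis by (subst sum.reindex[OF inj]) (simp add: axis_def if_distrib cong: if_cong)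
  have reindex: "(\<Prod>i\<in>UNIV. f i (T y $ i)) = (\<Prod>b\<in>Basis. f (axis_index b) (y b))" for y
    unfolding comp basis by (subst prod.reindex[OF inj]) simp
  have meas: "(\<lambda>x::real^'n. \<Prod>i\<in>UNIV. f i (x $ i)) \<in> borel_measurable borel"
    by measurable
  have int': "integrable (\<Pi>\<^sub>M b\<in>Basis. lborel) (\<lambda>y. \<Prod>b\<in>(Basis :: (real^'n) set). f (axis_index b) (y b))"
    by (rule product_integrable_prod) (auto intro: int)
  then show "integrable lborel (\<lambda>x::real^'n. \<Prod>i\<in>UNIV. f i (x $ i))"
    unfolding lb integrable_distr_eq[OF T meas] reindex .
  have "(\<integral>x. (\<Prod>i\<in>UNIV. f i (x $ i)) \<partial>(lborel :: (real^'n) measure)) =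
      (\<integral>y. (\<Prod>b\<in>(Basis :: (real^'n) set). f (axis_index b) (y b)) \<partial>(\<Pi>\<^sub>M b\<in>Basis. lborel))"
    unfolding lb integral_distr[OF T meas] reindex ..
  also have "\<dots> = (\<Prod>b\<in>(Basis :: (real^'n) set). \<integral>y. f (axis_index b) y \<partial>lborel)"
    by (rule product_integral_prod) (auto intro: int)
  also have "\<dots> = (\<Prod>i\<in>UNIV. \<integral>y. f i y \<partial>lborel)"
    unfolding basis by (subst prod.reindex[OF inj]) simp
  finally show "(\<integral>x. (\<Prod>i\<in>UNIV. f i (x $ i)) \<partial>(lborel :: (real^'n) measure)) =
      (\<Prod>i\<in>UNIV. \<integral>y. f i y \<partial>lborel)" .
qed

text \<open>By removing leading terms.\<close>
lemma graded_basis_expansion: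
  fixes P :: "nat \<Rightarrow> real poly"
  assumes "\<And>k. degree (P k) = k" "\<And>k. P k \<noteq> 0" "\<And>k. k \<ge> n \<Longrightarrow> coeff q k = 0"
  shows "\<exists>c. q = (\<Sum>k<n. smult (c k) (P k))"
  using assms(3)
proof (induction n arbitrary: q)
  case 0
  then have "q = 0" by (intro poly_eqI) simp
  then show ?case by simp
next
  case (Suc n)
  define d where "d = coeff q n / lead_coeff (P n)"
  have "coeff (q - smult d (P n)) k = 0" if "k \<ge> n" for k
  proof (cases "k = n")
    case True
    moreover have "coeff (P n) n \<noteq> 0" using assms(1,2)[of n] leading_coeff_0_iff[of "P n"] by simp
    ultimately show ?thesis using assms(1)[of n] by (simp add: d_def)
  next
    case False
    then show ?thesis using that Suc.prems[of k] assms(1)[of n] by (simp add: coeff_eq_0)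
  qed
  then obtain c where "q - smult d (P n) = (\<Sum>k<n. smult (c k) (P k))"
    using Suc.IH by blast
  then have "q = (\<Sum>k<Suc n. smult ((c(n := d)) k) (P k))"
    by (simp add: algebra_simps)
  then show ?case by blast
qed

lemma real_polynomial_function_poly:
  assumes "real_polynomial_function f"
  shows "real_polynomial_function (\<lambda>x. poly q (f x))"
  by (induction q) (use assms in auto)

lemma mem_cube_iff: "x \<in> cbox (-1) (1 :: real^'n) \<longleftrightarrow> (\<forall>i. x $ i \<in> {-1..1})"
  by (auto simp: mem_box_cart)

locale jacobi =
  fixes \<alpha> \<beta> :: "real^'n"
  assumes alpha: "\<alpha> $ i > - 1 / 2" and beta: "\<beta> $ i > - 1 / 2"
begin

abbreviation "\<mu> \<equiv> jacobi_measure \<alpha> \<beta>"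
abbreviation "basis \<equiv> jacobi_basis \<alpha> \<beta>"
abbreviation "lam \<equiv> jacobi_eigenvalue \<alpha> \<beta>"
abbreviation "cf \<equiv> jacobi_coeff \<alpha> \<beta>"
abbreviation "jp i k \<equiv> jacobi_poly k (\<alpha> $ i) (\<beta> $ i)"

lemma alpha_gt: "\<alpha> $ i > -1/2" "\<alpha> $ i > -1" and beta_gt: "\<beta> $ i > -1/2" "\<beta> $ i > -1"
  using alpha[of i] beta[of i] by linarith+

definition weight :: "real^'n \<Rightarrow> real" where
  "weight x = (\<Prod>i\<in>UNIV. jacobi_weight (\<alpha> $ i) (\<beta> $ i) (x $ i))"

lemma weight_measurable [measurable]: "weight \<in> borel_measurable borel"
  unfolding weight_def[abs_def] by measurable

lemma weight_eq:
  "weight x = indicator (cbox (-1) 1) x * (\<Prod>i\<in>UNIV. jacobi_density (\<alpha> $ i) (\<beta> $ i) (x $ i))"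
proof (cases "x \<in> cbox (-1) 1")
  case True
  then show ?thesis by (simp add: weight_def jacobi_weight_def mem_cube_iff)
next
  case False
  then obtain i where "x $ i \<notin> {-1..1}" by (auto simp: mem_cube_iff)
  then have "jacobi_weight (\<alpha> $ i) (\<beta> $ i) (x $ i) = 0" by (simp add: jacobi_weight_def)
  then have "weight x = 0" unfolding weight_def by (intro prod_zero) auto
  then show ?thesis using False by simp
qed

lemma density_nonneg: "(\<Prod>i\<in>UNIV. jacobi_density (\<alpha> $ i) (\<beta> $ i) (x $ i)) \<ge> 0"
  by (intro prod_nonneg jacobi_density_nonneg alpha_gt beta_gt)

lemma space_mu: "space \<mu> = cbox (-1) 1"
  by (simp add: jacobi_measure_def space_restrict_space)

lemma borel_measurable_mu: "f \<in> borel_measurable borel \<Longrightarrow> f \<in> borel_measurable \<mu>"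
  unfolding jacobi_measure_def by (simp add: measurable_restrict_space1)

lemma integrable_mu_iff:
  fixes f :: "real^'n \<Rightarrow> real"
  assumes [measurable]: "f \<in> borel_measurable borel"
  shows "integrable \<mu> f \<longleftrightarrow> integrable lborel (\<lambda>x. weight x * f x)"
proof -
  have "integrable \<mu> f \<longleftrightarrow> integrable (restrict_space lborel (cbox (-1) 1))
      (\<lambda>x. (\<Prod>i\<in>UNIV. jacobi_density (\<alpha> $ i) (\<beta> $ i) (x $ i)) *\<^sub>R f x)"
    unfolding jacobi_measure_def
    by (rule integrable_density) (auto intro!: measurable_restrict_space1 density_nonneg)
  also have "\<dots> \<longleftrightarrow> integrable lborel (\<lambda>x. weight x * f x)"
    by (subst integrable_restrict_space) (auto simp: weight_eq mult.assoc)
  finally show ?thesis .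
qed

lemma integral_mu_eq:
  fixes f :: "real^'n \<Rightarrow> real"
  assumes [measurable]: "f \<in> borel_measurable borel"
  shows "integral\<^sup>L \<mu> f = (\<integral>x. weight x * f x \<partial>lborel)"
proof -
  have "integral\<^sup>L \<mu> f = integral\<^sup>L (restrict_space lborel (cbox (-1) 1))
      (\<lambda>x. (\<Prod>i\<in>UNIV. jacobi_density (\<alpha> $ i) (\<beta> $ i) (x $ i)) *\<^sub>R f x)"
    unfolding jacobi_measure_def
    by (rule integral_density) (auto intro!: measurable_restrict_space1 density_nonneg)
  also have "\<dots> = (\<integral>x. weight x * f x \<partial>lborel)"
    by (subst integral_restrict_space) (auto simp: weight_eq mult.assoc)
  finally show ?thesis .
qed

lemma product_poly_integral:
  fixes q :: "'n \<Rightarrow> real poly"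
  shows "integrable \<mu> (\<lambda>x. \<Prod>i\<in>UNIV. poly (q i) (x $ i))" (is ?int)
    and "(\<integral>x. (\<Prod>i\<in>UNIV. poly (q i) (x $ i)) \<partial>\<mu>) =
      (\<Prod>i\<in>UNIV. \<integral>y. jacobi_weight (\<alpha> $ i) (\<beta> $ i) y * poly (q i) y \<partial>lborel)" (is ?eq)
proof -
  have meas: "(\<lambda>x::real^'n. \<Prod>i\<in>UNIV. poly (q i) (x $ i)) \<in> borel_measurable borel"
    by measurable
  have *: "weight x * (\<Prod>i\<in>UNIV. poly (q i) (x $ i)) =
      (\<Prod>i\<in>UNIV. jacobi_weight (\<alpha> $ i) (\<beta> $ i) (x $ i) * poly (q i) (x $ i))" for x
    by (simp add: weight_def prod.distrib)
  have int: "integrable lborel (\<lambda>y. jacobi_weight (\<alpha> $ i) (\<beta> $ i) y * poly (q i) y)" for i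
    by (intro integrable_jacobi_weight_poly alpha_gt beta_gt)
  show ?int unfolding integrable_mu_iff[OF meas] * by (rule lborel_vec_product_integral(1)[OF int])
  show ?eq unfolding integral_mu_eq[OF meas] * by (rule lborel_vec_product_integral(2)[OF int])
qed

sublocale mu: finite_measure \<mu>
proof
  have "integrable \<mu> (\<lambda>_. 1::real)" using product_poly_integral(1)[of "\<lambda>_. 1"] by simp
  then have "(\<integral>\<^sup>+x. ennreal (norm (1::real)) \<partial>\<mu>) < \<infinity>" unfolding integrable_iff_bounded by blast
  then show "emeasure \<mu> (space \<mu>) \<noteq> \<infinity>" by simp
qed

lemma measure_mu: "measure \<mu> (space \<mu>) = 1"
  using product_poly_integral(2)[of "\<lambda>_. 1"]
  by (simp add: jacobi_weight_integral(2)[OF alpha_gt(2) beta_gt(2)])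

lemma integrable_mu_bounded:
  fixes f :: "real^'n \<Rightarrow> real"
  assumes "f \<in> borel_measurable \<mu>" "\<And>x. x \<in> cbox (-1) 1 \<Longrightarrow> \<bar>f x\<bar> \<le> B"
  shows "integrable \<mu> f"
  using assms by (intro mu.integrable_const_bound[of _ B] AE_I2) (auto simp: space_mu)

lemma integrable_mu_continuous:
  fixes f :: "real^'n \<Rightarrow> real"
  assumes f: "continuous_on UNIV f"
  shows "integrable \<mu> f"
proof -
  have "bounded (f ` cbox (-1) 1)"
    by (intro compact_imp_bounded compact_continuous_image continuous_on_subset[OF f]) auto
  then obtain B where "\<forall>y\<in>f ` cbox (-1) 1. \<bar>y\<bar> \<le> B" unfolding bounded_real by auto
  then show ?thesis
    by (intro integrable_mu_bounded[of _ B] borel_measurable_mu borel_measurable_continuous_onI f) auto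
qed

lemma polynomial_continuous: "real_polynomial_function f \<Longrightarrow> continuous_on S f"
  for f :: "real^'n \<Rightarrow> real"
  by (simp add: continuous_on_polymonial_function real_polynomial_function_eq)

lemma integrable_mu_polynomial:
  fixes f :: "real^'n \<Rightarrow> real"
  shows "real_polynomial_function f \<Longrightarrow> integrable \<mu> f"
  by (intro integrable_mu_continuous polynomial_continuous)

lemma basis_polynomial: "real_polynomial_function (basis \<kappa>)"
proof -
  have "real_polynomial_function (\<lambda>x. \<Prod>i\<in>I. poly (jp i (\<kappa> $ i)) (x $ i))" if "finite I" for I
    using that
  proof (induction I rule: finite_induct)
    case (insert i I)
    have "real_polynomial_function (\<lambda>x. poly (jp i (\<kappa> $ i)) (x $ i))"
      by (intro real_polynomial_function_poly real_polynomial_function.intros(1) bounded_linear_vec_nth)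
    then show ?case using insert by (simp add: real_polynomial_function.intros(4))
  qed auto
  from this[of UNIV] show ?thesis by (simp add: jacobi_basis_def[abs_def])
qed

lemma basis_orthonormal: "(\<integral>x. basis \<kappa> x * basis \<kappa>' x \<partial>\<mu>) = (if \<kappa> = \<kappa>' then 1 else 0)"
proof -
  have "(\<integral>x. basis \<kappa> x * basis \<kappa>' x \<partial>\<mu>) =
      (\<integral>x. (\<Prod>i\<in>UNIV. poly (jp i (\<kappa> $ i) * jp i (\<kappa>' $ i)) (x $ i)) \<partial>\<mu>)"
    by (simp add: jacobi_basis_def prod.distrib)
  also have "\<dots> = (\<Prod>i\<in>UNIV. if \<kappa> $ i = \<kappa>' $ i then 1 else 0)"
    unfolding product_poly_integral(2)
    by (intro prod.cong refl) (use jacobi_poly_orthonormal[OF alpha_gt(1) beta_gt(1)] in simp)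
  also have "\<dots> = (if \<kappa> = \<kappa>' then 1 else 0)"
    by (auto simp: vec_eq_iff)
  finally show ?thesis .
qed

definition in_span :: "(real^'n \<Rightarrow> real) \<Rightarrow> bool" where
  "in_span f \<longleftrightarrow> (\<exists>K c. finite K \<and> f = (\<lambda>x. \<Sum>\<kappa>\<in>K. c \<kappa> * basis \<kappa> x))"

lemma in_span_add:
  assumes "in_span f" "in_span g"
  shows "in_span (\<lambda>x. f x + g x)"
proof -
  obtain K c where K: "finite K" "f = (\<lambda>x. \<Sum>\<kappa>\<in>K. c \<kappa> * basis \<kappa> x)"
    using assms(1) unfolding in_span_def by blast
  obtain L d where L: "finite L" "g = (\<lambda>x. \<Sum>\<kappa>\<in>L. d \<kappa> * basis \<kappa> x)"
    using assms(2) unfolding in_span_def by blast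
  have "f x + g x = (\<Sum>\<kappa>\<in>K \<union> L. ((if \<kappa> \<in> K then c \<kappa> else 0) + (if \<kappa> \<in> L then d \<kappa> else 0)) * basis \<kappa> x)" for x
  proof -
    have "f x = (\<Sum>\<kappa>\<in>K \<union> L. (if \<kappa> \<in> K then c \<kappa> else 0) * basis \<kappa> x)"
      unfolding K(2) using K(1) L(1) by (intro sum.mono_neutral_cong_left) auto
    moreover have "g x = (\<Sum>\<kappa>\<in>K \<union> L. (if \<kappa> \<in> L then d \<kappa> else 0) * basis \<kappa> x)"
      unfolding L(2) using K(1) L(1) by (intro sum.mono_neutral_cong_left) auto
    ultimately show ?thesis by (simp add: sum.distrib distrib_right)
  qed
  then show ?thesis unfolding in_span_def using K(1) L(1)
    by (intro exI[of _ "K \<union> L"] exI[of _ "\<lambda>\<kappa>. (if \<kappa> \<in> K then c \<kappa> else 0) + (if \<kappa> \<in> L then d \<kappa> else 0)"]) auto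
qed

lemma in_span_scale:
  assumes "in_span f"
  shows "in_span (\<lambda>x. c * f x)"
proof -
  obtain K d where "finite K" "f = (\<lambda>x. \<Sum>\<kappa>\<in>K. d \<kappa> * basis \<kappa> x)"
    using assms unfolding in_span_def by blast
  then show ?thesis unfolding in_span_def
    by (intro exI[of _ K] exI[of _ "\<lambda>\<kappa>. c * d \<kappa>"]) (auto simp: sum_distrib_left mult.assoc)
qed

lemma in_span_sum:
  assumes "finite I" "\<And>i. i \<in> I \<Longrightarrow> in_span (f i)"
  shows "in_span (\<lambda>x. \<Sum>i\<in>I. f i x)"
  using assms
proof (induction I rule: finite_induct)
  case empty
  show ?case unfolding in_span_def by (intro exI[of _ "{}"]) auto
next
  case (insert i I)
  then show ?case by (simp add: in_span_add)
qed

text \<open>Expanding each factor and multiplying out produces one basis function for each choice of degrees.\<close>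
lemma in_span_product: "in_span (\<lambda>x. \<Prod>i\<in>UNIV. poly (q i) (x $ i))"
proof -
  define N where "N i = Suc (degree (q i))" for i
  have "\<exists>c. q i = (\<Sum>k<N i. smult (c k) (jp i k))" for i
  proof (rule graded_basis_expansion)
    show "degree (jp i k) = k" for k by (rule degree_jacobi_poly[OF alpha_gt(1) beta_gt(1)])
    show "jp i k \<noteq> 0" for k by (rule jacobi_poly_properties(3)[OF alpha_gt(2) beta_gt(2)])
    show "coeff (q i) k = 0" if "k \<ge> N i" for k using that by (simp add: N_def coeff_eq_0)
  qed
  then obtain c where c: "\<And>i. q i = (\<Sum>k<N i. smult (c i k) (jp i k))" by metis
  define G where "G = PiE UNIV (\<lambda>i. {..<N i})"
  have fin: "finite G" unfolding G_def by (intro finite_PiE) auto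
  have inj: "inj_on vec_lambda G" by (auto simp: inj_on_def vec_lambda_inject)
  have "(\<Prod>i\<in>UNIV. poly (q i) (x $ i)) =
      (\<Sum>\<kappa>\<in>vec_lambda ` G. (\<Prod>i\<in>UNIV. c i (\<kappa> $ i)) * basis \<kappa> x)" for x
  proof -
    have "(\<Prod>i\<in>UNIV. poly (q i) (x $ i)) = (\<Prod>i\<in>UNIV. \<Sum>k<N i. c i k * poly (jp i k) (x $ i))"
      by (subst c) (simp add: poly_sum)
    also have "\<dots> = (\<Sum>g\<in>G. \<Prod>i\<in>UNIV. c i (g i) * poly (jp i (g i)) (x $ i))"
      unfolding G_def by (rule prod_sum_PiE) auto
    also have "\<dots> = (\<Sum>\<kappa>\<in>vec_lambda ` G. (\<Prod>i\<in>UNIV. c i (\<kappa> $ i)) * basis \<kappa> x)"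
      by (subst sum.reindex[OF inj]) (simp add: jacobi_basis_def prod.distrib)
    finally show ?thesis .
  qed
  then show ?thesis unfolding in_span_def using fin
    by (intro exI[of _ "vec_lambda ` G"] exI[of _ "\<lambda>\<kappa>. \<Prod>i\<in>UNIV. c i (\<kappa> $ i)"]) auto
qed

lemma in_span_mult:
  assumes "in_span f" "in_span g"
  shows "in_span (\<lambda>x. f x * g x)"
proof -
  obtain K c where K: "finite K" "f = (\<lambda>x. \<Sum>\<kappa>\<in>K. c \<kappa> * basis \<kappa> x)"
    using assms(1) unfolding in_span_def by blast
  obtain L d where L: "finite L" "g = (\<lambda>x. \<Sum>\<kappa>\<in>L. d \<kappa> * basis \<kappa> x)"
    using assms(2) unfolding in_span_def by blast
  have "in_span (\<lambda>x. basis \<kappa> x * basis \<kappa>' x)" for \<kappa> \<kappa>'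
    using in_span_product[of "\<lambda>i. jp i (\<kappa> $ i) * jp i (\<kappa>' $ i)"]
    by (simp add: jacobi_basis_def prod.distrib)
  then have "in_span (\<lambda>x. \<Sum>\<kappa>\<in>K. \<Sum>\<kappa>'\<in>L. (c \<kappa> * d \<kappa>') * (basis \<kappa> x * basis \<kappa>' x))"
    by (intro in_span_sum in_span_scale K L)
  then show ?thesis by (simp add: K(2) L(2) sum_product mult_ac)
qed

lemma in_span_polynomial:
  assumes "real_polynomial_function f"
  shows "in_span f"
  using assms
proof induction
  case (linear f)
  have "in_span (\<lambda>x. x $ i)" for i
  proof -
    have "(\<Prod>j\<in>UNIV. poly (if j = i then [:0, 1:] else 1) (x $ j)) = x $ i" for x :: "real^'n"
      by (simp add: if_distrib[of "\<lambda>p. poly p _"] cong: if_cong)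
    then show ?thesis using in_span_product[of "\<lambda>j. if j = i then [:0, 1:] else 1"] by simp
  qed
  then have "in_span (\<lambda>x. \<Sum>i\<in>UNIV. f (axis i 1) * x $ i)"
    by (intro in_span_sum in_span_scale) auto
  moreover have "f x = (\<Sum>i\<in>UNIV. f (axis i 1) * x $ i)" for x
  proof -
    interpret bounded_linear f by fact
    have "f x = f (\<Sum>i\<in>UNIV. x $ i *\<^sub>R axis i 1)"
      using basis_expansion[of x] by (simp add: scalar_mult_eq_scaleR)
    then show ?thesis by (simp add: sum scaleR mult.commute)
  qed
  then have "f = (\<lambda>x. \<Sum>i\<in>UNIV. f (axis i 1) * x $ i)" by blast
  ultimately show ?case by simp
next
  case (const c)
  show ?case using in_span_scale[OF in_span_product[of "\<lambda>_. 1"], of c] by simp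
next
  case (add f g)
  then show ?case by (intro in_span_add)
next
  case (mult f g)
  then show ?case by (intro in_span_mult)
qed

lemma coeff_expansion:
  assumes K: "finite K"
  shows "cf (\<lambda>x. \<Sum>\<kappa>\<in>K. c \<kappa> * basis \<kappa> x) \<kappa> = (if \<kappa> \<in> K then c \<kappa> else 0)"
proof -
  have "cf (\<lambda>x. \<Sum>\<kappa>\<in>K. c \<kappa> * basis \<kappa> x) \<kappa> = (\<integral>x. (\<Sum>\<kappa>'\<in>K. c \<kappa>' * (basis \<kappa>' x * basis \<kappa> x)) \<partial>\<mu>)"
    by (simp add: jacobi_coeff_def sum_distrib_right mult.assoc)
  also have "\<dots> = (\<Sum>\<kappa>'\<in>K. \<integral>x. c \<kappa>' * (basis \<kappa>' x * basis \<kappa> x) \<partial>\<mu>)"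
    by (intro Bochner_Integration.integral_sum integrable_mult_right integrable_mu_polynomial
        real_polynomial_function.intros(4) basis_polynomial)
  also have "\<dots> = (\<Sum>\<kappa>'\<in>K. if \<kappa>' = \<kappa> then c \<kappa>' else 0)"
    by (intro sum.cong refl) (simp add: basis_orthonormal)
  finally show ?thesis using K by simp
qed

definition spectrum_support :: "(real^'n \<Rightarrow> real) \<Rightarrow> (nat^'n) set" where
  "spectrum_support f = {\<kappa>. cf f \<kappa> \<noteq> 0}"

text \<open>The index set \<open>K\<close> may be larger than the support, so that several polynomials can be expanded over
  a common one.\<close>
lemma polynomial_expansion:
  assumes "real_polynomial_function f"
  shows "finite (spectrum_support f)"
    and "\<lbrakk>finite K; spectrum_support f \<subseteq> K\<rbrakk> \<Longrightarrow> f x = (\<Sum>\<kappa>\<in>K. cf f \<kappa> * basis \<kappa> x)"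
proof -
  obtain L c where L: "finite L" "f = (\<lambda>x. \<Sum>\<kappa>\<in>L. c \<kappa> * basis \<kappa> x)"
    using in_span_polynomial[OF assms] unfolding in_span_def by blast
  have cf: "cf f \<kappa> = (if \<kappa> \<in> L then c \<kappa> else 0)" for \<kappa>
    unfolding L(2) by (rule coeff_expansion[OF L(1)])
  have sub: "spectrum_support f \<subseteq> L" by (auto simp: spectrum_support_def cf)
  then show "finite (spectrum_support f)" using L(1) finite_subset by blast
  assume K: "finite K" "spectrum_support f \<subseteq> K"
  have "f x = (\<Sum>\<kappa>\<in>L. cf f \<kappa> * basis \<kappa> x)"
    unfolding cf by (subst L(2)) (rule sum.cong, auto)
  also have "\<dots> = (\<Sum>\<kappa>\<in>spectrum_support f. cf f \<kappa> * basis \<kappa> x)"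
    by (rule sum.mono_neutral_right) (use L sub in \<open>auto simp: spectrum_support_def\<close>)
  also have "\<dots> = (\<Sum>\<kappa>\<in>K. cf f \<kappa> * basis \<kappa> x)"
    by (rule sum.mono_neutral_left) (use K in \<open>auto simp: spectrum_support_def\<close>)
  finally show "f x = (\<Sum>\<kappa>\<in>K. cf f \<kappa> * basis \<kappa> x)" .
qed

text \<open>A function of the Jacobi operator on polynomials: the spectral multiplier \<open>m\<close>, indexed by modes.\<close>
definition mult_op :: "(nat^'n \<Rightarrow> real) \<Rightarrow> (real^'n \<Rightarrow> real) \<Rightarrow> real^'n \<Rightarrow> real" where
  "mult_op m f x = (\<Sum>\<kappa>\<in>spectrum_support f. m \<kappa> * cf f \<kappa> * basis \<kappa> x)"

lemma mult_op_eq: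
  assumes "finite K" "spectrum_support f \<subseteq> K"
  shows "mult_op m f x = (\<Sum>\<kappa>\<in>K. m \<kappa> * cf f \<kappa> * basis \<kappa> x)"
  unfolding mult_op_def
  by (rule sum.mono_neutral_left) (use assms in \<open>auto simp: spectrum_support_def\<close>)

lemma polynomial_sum:
  "finite I \<Longrightarrow> (\<And>i. i \<in> I \<Longrightarrow> real_polynomial_function (f i)) \<Longrightarrow>
     real_polynomial_function (\<lambda>x. \<Sum>i\<in>I. f i x)"
  by (rule real_polynomial_function_sum) auto

lemma mult_op_polynomial: "real_polynomial_function f \<Longrightarrow> real_polynomial_function (mult_op m f)"
  unfolding mult_op_def[abs_def]
  by (intro polynomial_sum polynomial_expansion real_polynomial_function.intros(4)
      real_polynomial_function.intros(2) basis_polynomial)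

lemma coeff_mult_op:
  assumes "real_polynomial_function f"
  shows "cf (mult_op m f) \<kappa> = m \<kappa> * cf f \<kappa>"
  unfolding mult_op_def[abs_def] coeff_expansion[OF polynomial_expansion(1)[OF assms]]
  by (simp add: spectrum_support_def)

lemma support_mult_op:
  "real_polynomial_function f \<Longrightarrow> spectrum_support (mult_op m f) \<subseteq> spectrum_support f"
  by (auto simp: spectrum_support_def coeff_mult_op)

lemma mult_op_1: "real_polynomial_function f \<Longrightarrow> mult_op (\<lambda>_. 1) f = f"
  by (rule ext) (simp add: mult_op_def polynomial_expansion(2)[OF _ polynomial_expansion(1) order_refl])

lemma mult_op_comp:
  assumes "real_polynomial_function f"
  shows "mult_op m (mult_op l f) = mult_op (\<lambda>\<kappa>. m \<kappa> * l \<kappa>) f"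
proof
  fix x
  show "mult_op m (mult_op l f) x = mult_op (\<lambda>\<kappa>. m \<kappa> * l \<kappa>) f x"
    unfolding mult_op_eq[OF polynomial_expansion(1)[OF assms] support_mult_op[OF assms]]
      mult_op_eq[OF polynomial_expansion(1)[OF assms] order_refl] coeff_mult_op[OF assms]
    by (simp add: mult.assoc)
qed

lemma coeff_lincomb:
  assumes "real_polynomial_function f" "real_polynomial_function g"
  shows "cf (\<lambda>x. a * f x + b * g x) \<kappa> = a * cf f \<kappa> + b * cf g \<kappa>"
proof -
  have i: "integrable \<mu> (\<lambda>x. f x * basis \<kappa> x)" "integrable \<mu> (\<lambda>x. g x * basis \<kappa> x)"
    by (intro integrable_mu_polynomial real_polynomial_function.intros(4) assms basis_polynomial)+
  have "cf (\<lambda>x. a * f x + b * g x) \<kappa> = (\<integral>x. a * (f x * basis \<kappa> x) + b * (g x * basis \<kappa> x) \<partial>\<mu>)"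
    by (simp add: jacobi_coeff_def algebra_simps)
  then show ?thesis using i by (simp add: jacobi_coeff_def)
qed

lemma mult_op_lincomb:
  assumes f: "real_polynomial_function f" and g: "real_polynomial_function g"
  shows "mult_op m (\<lambda>x. a * f x + b * g x) x = a * mult_op m f x + b * mult_op m g x"
proof -
  define K where "K = spectrum_support f \<union> spectrum_support g"
  have K: "finite K" "spectrum_support f \<subseteq> K" "spectrum_support g \<subseteq> K"
    by (auto simp: K_def polynomial_expansion f g)
  have "spectrum_support (\<lambda>x. a * f x + b * g x) \<subseteq> K"
    by (auto simp: spectrum_support_def K_def coeff_lincomb f g)
  then show ?thesis
    using K by (simp add: mult_op_eq[of K] coeff_lincomb f g sum_distrib_left sum.distrib[symmetric] algebra_simps)
qed

lemma basis_0: "\<exists>k. k \<noteq> 0 \<and> basis 0 = (\<lambda>x. k)"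
proof -
  have "\<exists>k. jp i 0 = [:k:] \<and> k \<noteq> 0" for i
    using degree_jacobi_poly[OF alpha_gt(1) beta_gt(1), of 0 i i]
      jacobi_poly_properties(3)[OF alpha_gt(2) beta_gt(2), of 0 i i]
    by (auto elim!: degree_eq_zeroE)
  then obtain k where k: "\<And>i. jp i 0 = [:k i:]" "\<And>i. k i \<noteq> 0" by metis
  then have "basis 0 = (\<lambda>x. \<Prod>i\<in>UNIV. k i)" "(\<Prod>i\<in>UNIV. k i) \<noteq> 0"
    by (simp_all add: jacobi_basis_def[abs_def])
  then show ?thesis by blast
qed

text \<open>The integral is the zeroth coefficient up to the constant value of the zeroth basis function.\<close>
lemma integral_mult_op:
  assumes f: "real_polynomial_function f"
  shows "(\<integral>x. mult_op m f x \<partial>\<mu>) = m 0 * (\<integral>x. f x \<partial>\<mu>)"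
proof -
  obtain k where k: "k \<noteq> 0" "basis 0 = (\<lambda>x. k)" using basis_0 by blast
  have "cf (mult_op m f) 0 = m 0 * cf f 0" by (rule coeff_mult_op[OF f])
  then show ?thesis using k by (simp add: jacobi_coeff_def)
qed

lemma lam_0: "lam 0 = 0"
  by (simp add: jacobi_eigenvalue_def)

lemma mult_op_const: "mult_op m (\<lambda>x. c) x = m 0 * c"
proof -
  obtain k where k: "k \<noteq> 0" "basis 0 = (\<lambda>x. k)" using basis_0 by blast
  have *: "(\<lambda>x::real^'n. c) = (\<lambda>x. \<Sum>\<kappa>\<in>{0}. (c / k) * basis \<kappa> x)"
    using k by simp
  have cf: "cf (\<lambda>x. c) \<kappa> = (if \<kappa> \<in> {0} then c / k else 0)" for \<kappa>
    by (subst *, rule coeff_expansion) simp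
  have "mult_op m (\<lambda>x. c) x = (\<Sum>\<kappa>\<in>{0}. m \<kappa> * cf (\<lambda>x. c) \<kappa> * basis \<kappa> x)"
    by (rule mult_op_eq) (auto simp: spectrum_support_def cf)
  then show ?thesis using k by (simp add: cf)
qed

end

section \<open>Contractive multipliers\<close>

text \<open>A supporting line of the convex function \<open>\<lambda>t. \<bar>t\<bar> powr p\<close> at \<open>c\<close>; by Young's inequality the slope
  \<open>p * \<bar>c\<bar> powr (p - 1) * sgn c\<close> works. All instances of Jensen's inequality rest on it.\<close>
lemma abs_powr_tangent:
  fixes p c :: real
  assumes p: "p > 1"
  shows "\<exists>d. \<forall>t. \<bar>c\<bar> powr p + d * (t - c) \<le> \<bar>t\<bar> powr p"
proof (intro exI allI)
  fix t :: real
  define C where "C = \<bar>c\<bar> powr (p - 1)"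
  have C: "C * \<bar>c\<bar> = \<bar>c\<bar> powr p"
    using p powr_add[of "\<bar>c\<bar>" "p - 1" 1] by (simp add: C_def)
  have q: "p / (p - 1) > 1" "1 / p + 1 / (p / (p - 1)) = 1" using p by (simp_all add: field_simps)
  have "\<bar>t\<bar> * C \<le> \<bar>t\<bar> powr p / p + C powr (p / (p - 1)) / (p / (p - 1))"
    by (rule Youngs_inequality[OF p q]) (auto simp: C_def)
  also have "C powr (p / (p - 1)) = \<bar>c\<bar> powr p" using p by (simp add: C_def powr_powr)
  finally have "p * (\<bar>t\<bar> * C) \<le> \<bar>t\<bar> powr p + (p - 1) * \<bar>c\<bar> powr p"
    using p by (simp add: field_simps)
  moreover have "p * (C * (sgn c * t)) \<le> p * (C * \<bar>t\<bar>)"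
    using p by (intro mult_left_mono) (auto simp: C_def sgn_real_def)
  moreover have e: "p * C * sgn c * (t - c) = p * (C * (sgn c * t)) - p * \<bar>c\<bar> powr p"
    unfolding C[symmetric] by (simp add: algebra_simps abs_sgn)
  ultimately have "\<bar>c\<bar> powr p + (p * (C * (sgn c * t)) - p * \<bar>c\<bar> powr p) \<le> \<bar>t\<bar> powr p"
    by (simp add: left_diff_distrib mult.commute)
  then show "\<bar>c\<bar> powr p + (p * C * sgn c) * (t - c) \<le> \<bar>t\<bar> powr p"
    unfolding e .
qed

lemma abs_powr_add_le:
  fixes a b p :: real
  assumes "p > 0"
  shows "\<bar>a + b\<bar> powr p \<le> 2 powr p * (\<bar>a\<bar> powr p + \<bar>b\<bar> powr p)"
proof -
  have "\<bar>a + b\<bar> powr p \<le> (2 * max \<bar>a\<bar> \<bar>b\<bar>) powr p"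
    using assms by (intro powr_mono2) auto
  also have "\<dots> = 2 powr p * (max \<bar>a\<bar> \<bar>b\<bar>) powr p" by (simp add: powr_mult)
  also have "\<dots> \<le> 2 powr p * (\<bar>a\<bar> powr p + \<bar>b\<bar> powr p)"
    by (intro mult_left_mono) (auto simp: max_def)
  finally show ?thesis .
qed

lemma jacobi_op_add: "jacobi_op a b (p + q) = jacobi_op a b p + jacobi_op a b q"
  unfolding poly_eq_poly_eq_iff[symmetric]
  by (rule ext) (simp add: poly_jacobi_op pderiv_add algebra_simps)

lemma jacobi_op_sum: "finite I \<Longrightarrow> jacobi_op a b (\<Sum>i\<in>I. f i) = (\<Sum>i\<in>I. jacobi_op a b (f i))"
proof (induction I rule: finite_induct)
  case empty
  show ?case by (simp add: jacobi_op_def rodrigues_step_def)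
qed (simp add: jacobi_op_add)

context jacobi
begin

lemma lam_summand_nonneg: "real k * (real k + \<alpha> $ i + \<beta> $ i + 1) \<ge> 0"
  using alpha[of i] beta[of i] by (intro mult_nonneg_nonneg) linarith+

lemma lam_nonneg: "lam \<kappa> \<ge> 0"
  unfolding jacobi_eigenvalue_def by (intro sum_nonneg lam_summand_nonneg)

abbreviation "resolvent h \<equiv> mult_op (\<lambda>\<kappa>. 1 / (1 + h * lam \<kappa>))"

text \<open>At a minimum \<open>z\<close> of \<open>u = resolvent h f\<close> over the cube, each one-variable section of \<open>u\<close> through
  \<open>z\<close> is minimal at \<open>z $ i\<close>, so the Jacobi operator applied to \<open>u\<close> is nonnegative at \<open>z\<close>; hence
  \<open>u z \<ge> f z\<close>.\<close>
lemma resolvent_nonneg: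
  assumes f: "real_polynomial_function f" and h: "h \<ge> 0"
    and pos: "\<And>x. x \<in> cbox (-1) 1 \<Longrightarrow> f x \<ge> 0" and x: "x \<in> cbox (-1) 1"
  shows "resolvent h f x \<ge> 0"
proof -
  define u where "u = resolvent h f"
  define K where "K = spectrum_support f"
  have K: "finite K" unfolding K_def by (rule polynomial_expansion(1)[OF f])
  define c where "c \<kappa> = cf f \<kappa> / (1 + h * lam \<kappa>)" for \<kappa>
  have u: "u y = (\<Sum>\<kappa>\<in>K. c \<kappa> * basis \<kappa> y)" for y
    by (simp add: u_def mult_op_def K_def c_def)
  have "real_polynomial_function u" unfolding u_def by (rule mult_op_polynomial[OF f])
  then have "continuous_on (cbox (-1) 1) u" by (rule polynomial_continuous)
  then have "\<exists>z\<in>cbox (-1) 1. \<forall>y\<in>cbox (-1) 1. u z \<le> u y"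
    using x by (intro continuous_attains_inf) auto
  then obtain z where z: "z \<in> cbox (-1) 1" "\<And>y. y \<in> cbox (-1) 1 \<Longrightarrow> u z \<le> u y"
    by (elim bexE) (rule that, assumption, erule bspec, assumption)
  define B where "B i \<kappa> = (\<Prod>j\<in>UNIV - {i}. poly (jp j (\<kappa> $ j)) (z $ j))" for i and \<kappa> :: "nat^'n"
  define Q where "Q i = (\<Sum>\<kappa>\<in>K. smult (c \<kappa> * B i \<kappa>) (jp i (\<kappa> $ i)))" for i
  have slice: "poly (Q i) y = u (\<chi> j. if j = i then y else z $ j)" for i y
  proof -
    have "basis \<kappa> (\<chi> j. if j = i then y else z $ j) = poly (jp i (\<kappa> $ i)) y * B i \<kappa>" for \<kappa>
      unfolding jacobi_basis_def B_def by (subst prod.remove[of _ i]) auto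
    then show ?thesis by (simp add: Q_def u poly_sum mult_ac)
  qed
  have at_z: "(\<chi> j. if j = i then z $ i else z $ j) = z" for i by (simp add: vec_eq_iff)
  have min: "poly (jacobi_op (\<alpha> $ i) (\<beta> $ i) (Q i)) (z $ i) \<ge> 0" for i
  proof (rule jacobi_op_nonneg_at_min[OF alpha_gt(2) beta_gt(2)])
    show "z $ i \<in> {-1..1}" using z(1) by (simp add: mem_cube_iff)
    show "poly (Q i) (z $ i) \<le> poly (Q i) y" if "y \<in> {-1..1}" for y
      unfolding slice at_z using that z(1) by (intro z(2)) (auto simp: mem_cube_iff)
  qed
  have op: "poly (jacobi_op (\<alpha> $ i) (\<beta> $ i) (Q i)) (z $ i) =
      - (\<Sum>\<kappa>\<in>K. c \<kappa> * (real (\<kappa> $ i) * (real (\<kappa> $ i) + \<alpha> $ i + \<beta> $ i + 1)) * basis \<kappa> z)" for i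
  proof -
    have bz: "basis \<kappa> z = B i \<kappa> * poly (jp i (\<kappa> $ i)) (z $ i)" for \<kappa>
      unfolding jacobi_basis_def B_def by (subst prod.remove[of _ i]) (auto simp: mult.commute)
    show ?thesis
      by (simp add: bz Q_def jacobi_op_sum[OF K] jacobi_op_smult
          jacobi_poly_properties(1)[OF alpha_gt(2) beta_gt(2)] poly_sum sum_negf mult_ac)
  qed
  have "(\<Sum>i\<in>UNIV. poly (jacobi_op (\<alpha> $ i) (\<beta> $ i) (Q i)) (z $ i)) =
      - (\<Sum>i\<in>UNIV. \<Sum>\<kappa>\<in>K. c \<kappa> * (real (\<kappa> $ i) * (real (\<kappa> $ i) + \<alpha> $ i + \<beta> $ i + 1)) * basis \<kappa> z)"
    by (simp add: op sum_negf)
  also have "\<dots> = - (\<Sum>\<kappa>\<in>K. c \<kappa> * lam \<kappa> * basis \<kappa> z)"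
    by (subst sum.swap) (simp add: jacobi_eigenvalue_def sum_distrib_left sum_distrib_right)
  finally have "(\<Sum>\<kappa>\<in>K. c \<kappa> * lam \<kappa> * basis \<kappa> z) \<le> 0"
    using sum_nonneg[of UNIV "\<lambda>i. poly (jacobi_op (\<alpha> $ i) (\<beta> $ i) (Q i)) (z $ i)"] min by simp
  then have "h * (\<Sum>\<kappa>\<in>K. c \<kappa> * lam \<kappa> * basis \<kappa> z) \<le> 0"
    using h by (simp add: mult_nonneg_nonpos)
  moreover have "f z = u z + h * (\<Sum>\<kappa>\<in>K. c \<kappa> * lam \<kappa> * basis \<kappa> z)"
  proof -
    have "f z = (\<Sum>\<kappa>\<in>K. cf f \<kappa> * basis \<kappa> z)"
      using polynomial_expansion(2)[OF f K] by (simp add: K_def)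
    also have "\<dots> = (\<Sum>\<kappa>\<in>K. c \<kappa> * basis \<kappa> z + h * (c \<kappa> * lam \<kappa> * basis \<kappa> z))"
    proof (intro sum.cong refl)
      fix \<kappa>
      have "1 + h * lam \<kappa> > 0" using h lam_nonneg[of \<kappa>] by (simp add: add_pos_nonneg)
      then have "cf f \<kappa> = c \<kappa> * (1 + h * lam \<kappa>)" by (simp add: c_def)
      then show "cf f \<kappa> * basis \<kappa> z = c \<kappa> * basis \<kappa> z + h * (c \<kappa> * lam \<kappa> * basis \<kappa> z)"
        by (simp add: algebra_simps)
    qed
    finally show ?thesis by (simp add: u sum.distrib sum_distrib_left)
  qed
  ultimately have "u z \<ge> 0" using pos[OF z(1)] by linarith
  then show ?thesis using z(2)[OF x] by (simp add: u_def)
qed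

abbreviation "pint p f \<equiv> (\<integral>x. \<bar>f x :: real\<bar> powr p \<partial>\<mu>)"

lemma integrable_mu_abs_powr:
  fixes f :: "real^'n \<Rightarrow> real"
  assumes "real_polynomial_function f" "p > 0"
  shows "integrable \<mu> (\<lambda>x. \<bar>f x\<bar> powr p)"
  using assms by (intro integrable_mu_continuous continuous_on_powr' continuous_on_rabs
      polynomial_continuous continuous_on_const) auto

text \<open>Jensen's inequality for the positive operator \<open>resolvent h\<close>, which fixes constants and preserves
  the integral: \<open>\<bar>f\<bar> powr p\<close> lies above the affine function of \<open>f\<close> tangent at the value
  \<open>resolvent h f x\<close>. As \<open>\<bar>f\<bar> powr p\<close> is no polynomial, a polynomial slightly above it takes its place.\<close>
lemma resolvent_contraction:
  assumes f: "real_polynomial_function f" and h: "h \<ge> 0" and p: "p > 1"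
  shows "pint p (resolvent h f) \<le> pint p f"
proof (rule field_le_epsilon)
  fix e :: real assume e: "e > 0"
  have cont: "continuous_on (cbox (-1) 1) (\<lambda>x. \<bar>f x\<bar> powr p + e / 2)"
    using p by (intro continuous_on_add continuous_on_powr' continuous_on_rabs
      polynomial_continuous continuous_on_const f) auto
  obtain q where q: "real_polynomial_function q"
    "\<And>x. x \<in> cbox (-1) 1 \<Longrightarrow> \<bar>(\<bar>f x\<bar> powr p + e / 2) - q x\<bar> < e / 2"
    by (rule Stone_Weierstrass_real_polynomial_function[OF compact_cbox cont, of "e / 2"]) (use e in auto)
  have bound: "\<bar>resolvent h f x\<bar> powr p \<le> resolvent h q x" if x: "x \<in> cbox (-1) 1" for x
  proof -
    define c where "c = resolvent h f x"
    obtain d where d: "\<And>t. \<bar>c\<bar> powr p + d * (t - c) \<le> \<bar>t\<bar> powr p"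
      using abs_powr_tangent[OF p] by blast
    define b where "b = d * c - \<bar>c\<bar> powr p"
    define r where "r = (\<lambda>y. 1 * q y + (- d) * f y)"
    have r: "real_polynomial_function r"
      unfolding r_def by (intro real_polynomial_function.intros(2-) f q)
    have k: "real_polynomial_function (\<lambda>y::real^'n. b)" by (rule real_polynomial_function.intros(2))
    have "0 \<le> resolvent h (\<lambda>y. 1 * r y + 1 * b) x"
    proof (rule resolvent_nonneg[OF _ h _ x])
      show "real_polynomial_function (\<lambda>y. 1 * r y + 1 * b)"
        by (intro real_polynomial_function.intros(2-) r)
      fix y :: "real^'n" assume y: "y \<in> cbox (-1) 1"
      have "\<bar>f y\<bar> powr p \<le> q y" using q(2)[OF y] by linarith
      with d[of "f y"] show "0 \<le> 1 * r y + 1 * b"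
        by (simp add: r_def b_def algebra_simps)
    qed
    also have "\<dots> = resolvent h q x - d * c + b"
      unfolding mult_op_lincomb[OF r k] unfolding r_def mult_op_lincomb[OF q(1) f] mult_op_const
      by (simp add: lam_0 c_def)
    finally show ?thesis by (simp add: b_def c_def)
  qed
  have "pint p (resolvent h f) \<le> (\<integral>x. resolvent h q x \<partial>\<mu>)"
    using p by (intro integral_mono integrable_mu_abs_powr integrable_mu_polynomial mult_op_polynomial f q bound)
      (auto simp: space_mu)
  also have "\<dots> = (\<integral>x. q x \<partial>\<mu>)" using integral_mult_op[OF q(1)] by (simp add: lam_0)
  also have "\<dots> \<le> (\<integral>x. \<bar>f x\<bar> powr p + e \<partial>\<mu>)"
  proof (rule integral_mono)
    show "integrable \<mu> (\<lambda>x. \<bar>f x\<bar> powr p + e)"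
      using p by (intro Bochner_Integration.integrable_add integrable_mu_abs_powr f) auto
    show "q x \<le> \<bar>f x\<bar> powr p + e" if "x \<in> space \<mu>" for x
      using q(2)[of x] that unfolding space_mu by linarith
  qed (intro integrable_mu_polynomial q)
  also have "\<dots> = pint p f + e"
    using p integrable_mu_abs_powr[OF f, of p] by (simp add: measure_mu)
  finally show "pint p (resolvent h f) \<le> pint p f + e" .
qed

definition contractive :: "real \<Rightarrow> (nat^'n \<Rightarrow> real) \<Rightarrow> bool" where
  "contractive p m \<longleftrightarrow> (\<forall>f. real_polynomial_function f \<longrightarrow> pint p (mult_op m f) \<le> pint p f)"

lemma contractive_resolvent: "h \<ge> 0 \<Longrightarrow> p > 1 \<Longrightarrow> contractive p (\<lambda>\<kappa>. 1 / (1 + h * lam \<kappa>))"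
  unfolding contractive_def by (intro allI impI resolvent_contraction)

lemma contractive_1: "contractive p (\<lambda>_. 1)"
  unfolding contractive_def by (simp add: mult_op_1)

lemma contractive_mult:
  "contractive p m \<Longrightarrow> contractive p l \<Longrightarrow> contractive p (\<lambda>\<kappa>. m \<kappa> * l \<kappa>)"
  unfolding contractive_def
proof (intro allI impI)
  fix f :: "real^'n \<Rightarrow> real"
  assume m: "\<forall>f. real_polynomial_function f \<longrightarrow> pint p (mult_op m f) \<le> pint p f"
    and l: "\<forall>f. real_polynomial_function f \<longrightarrow> pint p (mult_op l f) \<le> pint p f"
    and f: "real_polynomial_function f"
  have "pint p (mult_op m (mult_op l f)) \<le> pint p (mult_op l f)"
    using m mult_op_polynomial[OF f] by blast
  also have "\<dots> \<le> pint p f" using l f by blast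
  finally show "pint p (mult_op (\<lambda>\<kappa>. m \<kappa> * l \<kappa>) f) \<le> pint p f"
    unfolding mult_op_comp[OF f] .
qed

lemma contractive_power: "contractive p m \<Longrightarrow> contractive p (\<lambda>\<kappa>. m \<kappa> ^ k)"
  by (induction k) (auto simp: contractive_1 intro: contractive_mult)

lemma contractive_convex:
  assumes p: "p > 1" and I: "finite I" and w: "\<And>i. i \<in> I \<Longrightarrow> w i \<ge> 0" "(\<Sum>i\<in>I. w i) = 1"
    and m: "\<And>i. i \<in> I \<Longrightarrow> contractive p (m i)"
  shows "contractive p (\<lambda>\<kappa>. \<Sum>i\<in>I. w i * m i \<kappa>)"
  unfolding contractive_def
proof (intro allI impI)
  fix f :: "real^'n \<Rightarrow> real" assume f: "real_polynomial_function f"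
  have int: "integrable \<mu> (\<lambda>x. \<bar>mult_op l f x\<bar> powr p)" for l
    using p by (intro integrable_mu_abs_powr mult_op_polynomial f) auto
  have pt: "\<bar>mult_op (\<lambda>\<kappa>. \<Sum>i\<in>I. w i * m i \<kappa>) f x\<bar> powr p \<le> (\<Sum>i\<in>I. w i * \<bar>mult_op (m i) f x\<bar> powr p)" for x
  proof -
    define c where "c = mult_op (\<lambda>\<kappa>. \<Sum>i\<in>I. w i * m i \<kappa>) f x"
    have "c = (\<Sum>\<kappa>\<in>spectrum_support f. \<Sum>i\<in>I. w i * (m i \<kappa> * cf f \<kappa> * basis \<kappa> x))"
      by (simp add: c_def mult_op_def sum_distrib_left sum_distrib_right mult.assoc)
    also have "\<dots> = (\<Sum>i\<in>I. w i * mult_op (m i) f x)"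
      by (subst sum.swap) (simp add: mult_op_def sum_distrib_left)
    finally have c: "c = (\<Sum>i\<in>I. w i * mult_op (m i) f x)" .
    obtain d where d: "\<And>t. \<bar>c\<bar> powr p + d * (t - c) \<le> \<bar>t\<bar> powr p"
      using abs_powr_tangent[OF p] by blast
    have "(\<Sum>i\<in>I. w i * (\<bar>c\<bar> powr p + d * (mult_op (m i) f x - c)))
        = (\<Sum>i\<in>I. w i) * (\<bar>c\<bar> powr p - d * c) + d * (\<Sum>i\<in>I. w i * mult_op (m i) f x)"
      by (simp add: sum_distrib_left sum_distrib_right sum.distrib[symmetric] algebra_simps)
    also have "\<dots> = \<bar>c\<bar> powr p" using w(2) c by (simp add: algebra_simps)
    finally have "\<bar>c\<bar> powr p = (\<Sum>i\<in>I. w i * (\<bar>c\<bar> powr p + d * (mult_op (m i) f x - c)))" ..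
    also have "\<dots> \<le> (\<Sum>i\<in>I. w i * \<bar>mult_op (m i) f x\<bar> powr p)"
      by (intro sum_mono mult_left_mono d w)
    finally show ?thesis by (simp add: c_def)
  qed
  have "pint p (mult_op (\<lambda>\<kappa>. \<Sum>i\<in>I. w i * m i \<kappa>) f) \<le> (\<integral>x. (\<Sum>i\<in>I. w i * \<bar>mult_op (m i) f x\<bar> powr p) \<partial>\<mu>)"
    by (intro integral_mono Bochner_Integration.integrable_sum integrable_mult_right int pt)
  also have "\<dots> = (\<Sum>i\<in>I. w i * pint p (mult_op (m i) f))"
    by (subst Bochner_Integration.integral_sum) (auto intro: int)
  also have "\<dots> \<le> (\<Sum>i\<in>I. w i * pint p f)"
    using m f by (intro sum_mono mult_left_mono w) (auto simp: contractive_def)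
  also have "\<dots> = pint p f" using w(2) by (simp add: sum_distrib_right[symmetric])
  finally show "pint p (mult_op (\<lambda>\<kappa>. \<Sum>i\<in>I. w i * m i \<kappa>) f) \<le> pint p f" .
qed

text \<open>On a fixed polynomial only finitely many modes count, so the functions converge pointwise under a
  continuous bound, and dominated convergence applies.\<close>
lemma contractive_limit:
  assumes p: "p > 1" and m: "\<And>j::nat. contractive p (m j)" and lim: "\<And>\<kappa>. (\<lambda>j. m j \<kappa>) \<longlonglongrightarrow> l \<kappa>"
  shows "contractive p l"
  unfolding contractive_def
proof (intro allI impI)
  fix f :: "real^'n \<Rightarrow> real" assume f: "real_polynomial_function f"
  define K where "K = spectrum_support f"
  have "\<exists>B. \<forall>j. \<bar>m j \<kappa>\<bar> \<le> B" for \<kappa>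
    using convergent_imp_Bseq[OF convergentI[OF lim[of \<kappa>]]] by (auto simp: Bseq_def)
  then obtain B where B: "\<And>j \<kappa>. \<bar>m j \<kappa>\<bar> \<le> B \<kappa>" by metis
  define W where "W x = (\<Sum>\<kappa>\<in>K. B \<kappa> * \<bar>cf f \<kappa>\<bar> * \<bar>basis \<kappa> x\<bar>)" for x
  have bd: "\<bar>mult_op (m j) f x\<bar> \<le> W x" for j x
  proof -
    have "\<bar>mult_op (m j) f x\<bar> \<le> (\<Sum>\<kappa>\<in>K. \<bar>m j \<kappa> * cf f \<kappa> * basis \<kappa> x\<bar>)"
      unfolding mult_op_def K_def by (rule sum_abs)
    also have "\<dots> \<le> W x" unfolding W_def abs_mult by (intro sum_mono mult_right_mono B) auto
    finally show ?thesis .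
  qed
  have W0: "W x \<ge> 0" for x using bd[of 0 x] by linarith
  have "continuous_on UNIV W" unfolding W_def
    by (intro continuous_on_sum continuous_on_mult continuous_on_const continuous_on_rabs
        polynomial_continuous basis_polynomial)
  then have intW: "integrable \<mu> (\<lambda>x. W x powr p)"
    using p W0 by (intro integrable_mu_continuous continuous_on_powr' continuous_on_const) auto
  have pt: "(\<lambda>j. \<bar>mult_op (m j) f x\<bar> powr p) \<longlonglongrightarrow> \<bar>mult_op l f x\<bar> powr p" for x
  proof -
    have "(\<lambda>j. mult_op (m j) f x) \<longlonglongrightarrow> mult_op l f x"
      unfolding mult_op_def by (intro tendsto_sum tendsto_mult lim tendsto_const)
    then show ?thesis using p by (intro tendsto_powr2 tendsto_rabs tendsto_const) auto
  qed
  have "(\<lambda>j. pint p (mult_op (m j) f)) \<longlonglongrightarrow> pint p (mult_op l f)"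
  proof (rule integral_dominated_convergence[where w = "\<lambda>x. W x powr p"])
    show "(\<lambda>x. \<bar>mult_op l f x\<bar> powr p) \<in> borel_measurable \<mu>"
      "\<And>j. (\<lambda>x. \<bar>mult_op (m j) f x\<bar> powr p) \<in> borel_measurable \<mu>"
      using p by (auto intro!: borel_measurable_integrable integrable_mu_abs_powr mult_op_polynomial f)
    show "AE x in \<mu>. norm (\<bar>mult_op (m j) f x\<bar> powr p) \<le> W x powr p" for j
      using p bd by (intro AE_I2) (auto intro: powr_mono2)
  qed (auto intro: intW pt)
  then show "pint p (mult_op l f) \<le> pint p f"
    by (rule LIMSEQ_le_const2) (use m f in \<open>auto simp: contractive_def\<close>)
qed

definition bounded_mult :: "real \<Rightarrow> (nat^'n \<Rightarrow> real) \<Rightarrow> bool" where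
  "bounded_mult p m \<longleftrightarrow>
     (\<exists>C\<ge>0. \<forall>f. real_polynomial_function f \<longrightarrow> pint p (mult_op m f) \<le> C * pint p f)"

lemma contractive_imp_bounded_mult: "contractive p m \<Longrightarrow> bounded_mult p m"
  unfolding bounded_mult_def contractive_def by (intro exI[of _ 1]) auto

lemma bounded_mult_scale:
  assumes "bounded_mult p m"
  shows "bounded_mult p (\<lambda>\<kappa>. c * m \<kappa>)"
proof -
  obtain C where C: "C \<ge> 0" "\<And>f. real_polynomial_function f \<Longrightarrow> pint p (mult_op m f) \<le> C * pint p f"
    using assms unfolding bounded_mult_def by blast
  have eq: "mult_op (\<lambda>\<kappa>. c * m \<kappa>) f x = c * mult_op m f x" for f x
    by (simp add: mult_op_def sum_distrib_left mult.assoc)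
  have "pint p (mult_op (\<lambda>\<kappa>. c * m \<kappa>) f) \<le> (\<bar>c\<bar> powr p * C) * pint p f" if "real_polynomial_function f" for f
    using mult_left_mono[OF C(2)[OF that], of "\<bar>c\<bar> powr p"] by (simp add: eq abs_mult powr_mult mult.assoc)
  then show ?thesis unfolding bounded_mult_def using C(1) by (intro exI[of _ "\<bar>c\<bar> powr p * C"]) auto
qed

lemma bounded_mult_add:
  assumes p: "p > 0" and "bounded_mult p m" "bounded_mult p l"
  shows "bounded_mult p (\<lambda>\<kappa>. m \<kappa> + l \<kappa>)"
proof -
  obtain C where C: "C \<ge> 0" "\<And>f. real_polynomial_function f \<Longrightarrow> pint p (mult_op m f) \<le> C * pint p f"
    using assms unfolding bounded_mult_def by blast
  obtain D where D: "D \<ge> 0" "\<And>f. real_polynomial_function f \<Longrightarrow> pint p (mult_op l f) \<le> D * pint p f"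
    using assms unfolding bounded_mult_def by blast
  have eq: "mult_op (\<lambda>\<kappa>. m \<kappa> + l \<kappa>) f x = mult_op m f x + mult_op l f x" for f x
    by (simp add: mult_op_def sum.distrib[symmetric] algebra_simps)
  have "pint p (mult_op (\<lambda>\<kappa>. m \<kappa> + l \<kappa>) f) \<le> (2 powr p * (C + D)) * pint p f"
    if f: "real_polynomial_function f" for f
  proof -
    have int: "integrable \<mu> (\<lambda>x. \<bar>mult_op l f x\<bar> powr p)" for l
      using p by (intro integrable_mu_abs_powr mult_op_polynomial f) auto
    have "pint p (mult_op (\<lambda>\<kappa>. m \<kappa> + l \<kappa>) f)
        \<le> (\<integral>x. 2 powr p * (\<bar>mult_op m f x\<bar> powr p + \<bar>mult_op l f x\<bar> powr p) \<partial>\<mu>)"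
      by (intro integral_mono int integrable_mult_right Bochner_Integration.integrable_add)
        (simp add: eq abs_powr_add_le p)
    also have "\<dots> = 2 powr p * (pint p (mult_op m f) + pint p (mult_op l f))"
      using int by simp
    also have "\<dots> \<le> 2 powr p * (C * pint p f + D * pint p f)"
      by (intro mult_left_mono add_mono C D f) auto
    finally show ?thesis by (simp add: algebra_simps)
  qed
  then show ?thesis unfolding bounded_mult_def using C(1) D(1)
    by (intro exI[of _ "2 powr p * (C + D)"]) auto
qed

lemma bounded_mult_sum:
  assumes "p > 1" "finite I" "\<And>i. i \<in> I \<Longrightarrow> bounded_mult p (m i)"
  shows "bounded_mult p (\<lambda>\<kappa>. \<Sum>i\<in>I. m i \<kappa>)"
  using assms(2,3)
proof (induction I rule: finite_induct)
  case empty
  show ?case using bounded_mult_scale[OF contractive_imp_bounded_mult[OF contractive_1], of p 0] by simp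
next
  case (insert i I)
  then show ?case using assms(1) by (simp add: bounded_mult_add)
qed

text \<open>The kernel \<open>\<Sum>\<kappa>. m \<kappa> * basis \<kappa> x * basis \<kappa> y\<close> of the operator is bounded by \<open>B\<close>, so the operator maps
  \<open>L\<^sup>1\<close> to bounded functions.\<close>
lemma bounded_mult_kernel:
  assumes p: "p > 1"
    and S: "\<And>\<kappa> x. x \<in> cbox (-1) 1 \<Longrightarrow> \<bar>basis \<kappa> x\<bar> \<le> S \<kappa>"
    and B: "\<And>K. finite K \<Longrightarrow> (\<Sum>\<kappa>\<in>K. \<bar>m \<kappa>\<bar> * (S \<kappa>)\<^sup>2) \<le> B"
  shows "bounded_mult p m"
proof -
  have B0: "B \<ge> 0" using B[of "{}"] by simp
  have S0: "S \<kappa> \<ge> 0" for \<kappa> using S[of 0 \<kappa>] by (force simp: mem_cube_iff)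
  have "pint p (mult_op m f) \<le> B powr p * pint p f" if f: "real_polynomial_function f" for f
  proof -
    define J where "J = (\<integral>x. \<bar>f x\<bar> \<partial>\<mu>)"
    have J0: "J \<ge> 0" by (simp add: J_def)
    have intf: "integrable \<mu> (\<lambda>x. \<bar>f x\<bar>)"
      by (intro integrable_mu_continuous continuous_on_rabs polynomial_continuous f)
    have cf: "\<bar>cf f \<kappa>\<bar> \<le> S \<kappa> * J" for \<kappa>
    proof -
      have "\<bar>cf f \<kappa>\<bar> \<le> (\<integral>x. \<bar>f x * basis \<kappa> x\<bar> \<partial>\<mu>)"
        unfolding jacobi_coeff_def by (rule integral_abs_bound)
      also have "\<dots> \<le> (\<integral>x. S \<kappa> * \<bar>f x\<bar> \<partial>\<mu>)"
      proof (rule integral_mono)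
        show "integrable \<mu> (\<lambda>x. \<bar>f x * basis \<kappa> x\<bar>)"
          by (intro integrable_abs integrable_mu_polynomial real_polynomial_function.intros(4) f
              basis_polynomial)
        show "\<bar>f x * basis \<kappa> x\<bar> \<le> S \<kappa> * \<bar>f x\<bar>" if "x \<in> space \<mu>" for x
          using mult_left_mono[OF S[of x \<kappa>] abs_ge_zero[of "f x"]] that
          by (simp add: abs_mult space_mu mult.commute)
      qed (intro integrable_mult_right intf)
      finally show ?thesis by (simp add: J_def)
    qed
    have "\<bar>mult_op m f x\<bar> \<le> B * J" if x: "x \<in> cbox (-1) 1" for x
    proof -
      have "\<bar>mult_op m f x\<bar> \<le> (\<Sum>\<kappa>\<in>spectrum_support f. \<bar>m \<kappa> * cf f \<kappa> * basis \<kappa> x\<bar>)"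
        unfolding mult_op_def by (rule sum_abs)
      also have "\<dots> \<le> (\<Sum>\<kappa>\<in>spectrum_support f. \<bar>m \<kappa>\<bar> * (S \<kappa> * J) * S \<kappa>)"
        unfolding abs_mult using J0 S0 by (intro sum_mono mult_mono cf S x) auto
      also have "\<dots> = (\<Sum>\<kappa>\<in>spectrum_support f. \<bar>m \<kappa>\<bar> * (S \<kappa>)\<^sup>2) * J"
        unfolding sum_distrib_right by (intro sum.cong) (simp_all add: power2_eq_square mult_ac)
      also have "\<dots> \<le> B * J"
        using J0 by (intro mult_right_mono B polynomial_expansion f)
      finally show ?thesis .
    qed
    then have "pint p (mult_op m f) \<le> (\<integral>x. (B * J) powr p \<partial>\<mu>)"
      using p by (intro integral_mono integrable_mu_abs_powr mult_op_polynomial f)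
        (auto simp: space_mu intro!: powr_mono2)
    also have "\<dots> = B powr p * J powr p" by (simp add: measure_mu powr_mult)
    also have "\<dots> \<le> B powr p * pint p f"
    proof (rule mult_left_mono)
      obtain d where d: "\<And>t. \<bar>J\<bar> powr p + d * (t - J) \<le> \<bar>t\<bar> powr p"
        using abs_powr_tangent[OF p] by blast
      have "J powr p = (\<integral>x. (J powr p - d * J) + d * \<bar>f x\<bar> \<partial>\<mu>)"
        using intf by (simp add: measure_mu J_def)
      also have "\<dots> \<le> pint p f"
      proof (rule integral_mono)
        show "integrable \<mu> (\<lambda>x. (J powr p - d * J) + d * \<bar>f x\<bar>)" using intf by simp
        show "integrable \<mu> (\<lambda>x. \<bar>f x\<bar> powr p)" using p by (intro integrable_mu_abs_powr f) auto
        show "(J powr p - d * J) + d * \<bar>f x\<bar> \<le> \<bar>f x\<bar> powr p" for x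
          using d[of "\<bar>f x\<bar>"] J0 by (simp add: algebra_simps)
      qed
      finally show "J powr p \<le> pint p f" .
    qed simp
    finally show ?thesis .
  qed
  then show ?thesis unfolding bounded_mult_def by (intro exI[of _ "B powr p"]) auto
qed

end

section \<open>Negative powers of the eigenvalues\<close>

text \<open>The coefficients of \<open>(1 - q) powr (- \<theta>)\<close>; what matters is that they are nonnegative for \<open>\<theta> > 0\<close>.\<close>
definition binom_coeff :: "real \<Rightarrow> nat \<Rightarrow> real" where
  "binom_coeff \<theta> k = pochhammer \<theta> k / fact k"

lemma binom_coeff_nonneg: "\<theta> > 0 \<Longrightarrow> binom_coeff \<theta> k \<ge> 0"
  by (simp add: binom_coeff_def pochhammer_nonneg)

lemma binom_coeff_0 [simp]: "binom_coeff \<theta> 0 = 1"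
  by (simp add: binom_coeff_def)

lemma binom_coeff_sums:
  assumes "\<bar>q\<bar> < 1"
  shows "(\<lambda>k. binom_coeff \<theta> k * q ^ k) sums (1 - q) powr (- \<theta>)"
proof -
  have "((- \<theta>) gchoose k) * (- q) ^ k = binom_coeff \<theta> k * q ^ k" for k
  proof -
    have "((- \<theta>) gchoose k) * (- q) ^ k = ((-1) ^ k * (-1) ^ k) * (binom_coeff \<theta> k * q ^ k)"
      by (simp add: gbinomial_pochhammer binom_coeff_def power_minus[of q])
    then show ?thesis by (simp flip: power_mult_distrib)
  qed
  then show ?thesis using gen_binomial_real[of "- q" "- \<theta>"] assms by simp
qed

lemma sum_vec_product_le:
  fixes g :: "nat \<Rightarrow> real" and K :: "(nat^'n) set"
  assumes g: "\<And>k. g k \<ge> 0" "summable g" and K: "finite K"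
  shows "(\<Sum>\<kappa>\<in>K. \<Prod>i\<in>UNIV. g (\<kappa> $ i)) \<le> (\<Prod>i\<in>(UNIV :: 'n set). suminf g)"
proof -
  have "finite ((\<lambda>(\<kappa>, i). \<kappa> $ i) ` (K \<times> UNIV))" using K by simp
  then obtain L where "\<forall>k\<in>(\<lambda>(\<kappa>, i). \<kappa> $ i) ` (K \<times> UNIV). k < L"
    unfolding finite_nat_set_iff_bounded by blast
  then have L: "\<kappa> $ i < L" if "\<kappa> \<in> K" for \<kappa> i using that by force
  define G where "G = PiE (UNIV :: 'n set) (\<lambda>_. {..<L})"
  have fin: "finite G" unfolding G_def by (intro finite_PiE) auto
  have inj: "inj_on vec_lambda G" by (auto simp: inj_on_def vec_lambda_inject)
  have sub: "K \<subseteq> vec_lambda ` G"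
  proof
    fix \<kappa> assume "\<kappa> \<in> K"
    then have "vec_nth \<kappa> \<in> G" using L by (auto simp: G_def)
    then show "\<kappa> \<in> vec_lambda ` G" by (metis imageI vec_nth_inverse)
  qed
  have "(\<Sum>\<kappa>\<in>K. \<Prod>i\<in>UNIV. g (\<kappa> $ i)) \<le> (\<Sum>\<kappa>\<in>vec_lambda ` G. \<Prod>i\<in>UNIV. g (\<kappa> $ i))"
    using fin g by (intro sum_mono2 sub prod_nonneg) auto
  also have "\<dots> = (\<Sum>h\<in>G. \<Prod>i\<in>UNIV. g (h i))" by (subst sum.reindex[OF inj]) simp
  also have "\<dots> = (\<Prod>i\<in>(UNIV :: 'n set). \<Sum>k<L. g k)"
    unfolding G_def by (rule prod_sum_PiE[symmetric]) auto
  also have "\<dots> \<le> (\<Prod>i\<in>(UNIV :: 'n set). suminf g)"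
    using g by (intro prod_mono conjI sum_nonneg sum_le_suminf) auto
  finally show ?thesis .
qed

context jacobi
begin

text \<open>With \<open>q = 1 / (1 + h * (1 + lam \<kappa>))\<close> and \<open>r = 1 / (1 + h)\<close>, the quotient \<open>q / r\<close> is a resolvent. Hence the
  series for \<open>(1 - q) powr (- \<theta>)\<close> is a combination of powers of this resolvent with the nonnegative
  weights \<open>binom_coeff \<theta> k * r ^ k\<close>, whose sum is \<open>(1 - r) powr (- \<theta>)\<close>. Normalised partial sums are convex
  combinations.\<close>
lemma contractive_quotient:
  assumes p: "p > 1" and \<theta>: "\<theta> > 0" and h: "h > 0"
  shows "contractive p (\<lambda>\<kappa>. ((1 - 1 / (1 + h * (1 + lam \<kappa>))) / (1 - 1 / (1 + h))) powr (- \<theta>))"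
proof -
  define r where "r = 1 / (1 + h)"
  have r: "0 < r" "r < 1" using h by (simp_all add: r_def)
  define h' where "h' = h / (1 + h)"
  have h': "h' \<ge> 0" using h by (simp add: h'_def)
  define R where "R \<kappa> = 1 / (1 + h' * lam \<kappa>)" for \<kappa>
  define q where "q \<kappa> = 1 / (1 + h * (1 + lam \<kappa>))" for \<kappa>
  have den: "1 + h * (1 + lam \<kappa>) > 1" for \<kappa> using h lam_nonneg[of \<kappa>] by simp
  have q: "0 < q \<kappa>" "q \<kappa> < 1" for \<kappa> using den[of \<kappa>] by (simp_all add: q_def)
  have rR: "r * R \<kappa> = q \<kappa>" for \<kappa>
  proof -
    have "(1 + h) * (1 + h' * lam \<kappa>) = 1 + h * (1 + lam \<kappa>)"
      using h by (simp add: h'_def field_simps)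
    then show ?thesis by (simp add: r_def R_def q_def)
  qed
  define w where "w k = binom_coeff \<theta> k * r ^ k" for k
  have w0: "w k \<ge> 0" for k using \<theta> r by (simp add: w_def binom_coeff_nonneg)
  define W where "W N = (\<Sum>k<Suc N. w k)" for N
  have W: "W N > 0" for N
  proof -
    have "w 0 \<le> W N" unfolding W_def by (rule member_le_sum) (use w0 in auto)
    then show ?thesis by (simp add: w_def)
  qed
  have contr: "contractive p (\<lambda>\<kappa>. \<Sum>k<Suc N. (w k / W N) * R \<kappa> ^ k)" for N
  proof (rule contractive_convex[OF p])
    show "(\<Sum>k<Suc N. w k / W N) = 1"
      using W[of N] by (simp only: sum_divide_distrib[symmetric] W_def[symmetric]) simp
    show "contractive p (\<lambda>\<kappa>. R \<kappa> ^ k)" for k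
      unfolding R_def by (intro contractive_power contractive_resolvent h' p)
    show "w k / W N \<ge> 0" for k using w0[of k] W[of N] by simp
  qed simp
  have "(\<lambda>N. \<Sum>k<Suc N. (w k / W N) * R \<kappa> ^ k) \<longlonglongrightarrow> ((1 - q \<kappa>) / (1 - r)) powr (- \<theta>)" for \<kappa>
  proof -
    have "(\<lambda>N. \<Sum>k<Suc N. binom_coeff \<theta> k * q \<kappa> ^ k) \<longlonglongrightarrow> (1 - q \<kappa>) powr (- \<theta>)"
      using LIMSEQ_Suc[OF binom_coeff_sums[of "q \<kappa>" \<theta>, unfolded sums_def]] q[of \<kappa>] by simp
    moreover have "W \<longlonglongrightarrow> (1 - r) powr (- \<theta>)"
      using LIMSEQ_Suc[OF binom_coeff_sums[of r \<theta>, unfolded sums_def]] r by (simp add: W_def[abs_def] w_def)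
    ultimately have "(\<lambda>N. (\<Sum>k<Suc N. binom_coeff \<theta> k * q \<kappa> ^ k) / W N) \<longlonglongrightarrow>
        (1 - q \<kappa>) powr (- \<theta>) / (1 - r) powr (- \<theta>)"
      using r by (intro tendsto_divide) auto
    moreover have "(\<Sum>k<Suc N. binom_coeff \<theta> k * q \<kappa> ^ k) / W N = (\<Sum>k<Suc N. (w k / W N) * R \<kappa> ^ k)" for N
      unfolding sum_divide_distrib rR[symmetric]
      by (intro sum.cong refl) (simp add: w_def power_mult_distrib)
    moreover have "(1 - q \<kappa>) powr (- \<theta>) / (1 - r) powr (- \<theta>) = ((1 - q \<kappa>) / (1 - r)) powr (- \<theta>)"
      using q[of \<kappa>] r by (simp add: powr_divide)
    ultimately show ?thesis by simp
  qed
  from contractive_limit[OF p contr this] show ?thesis by (simp add: q_def r_def)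
qed

text \<open>As \<open>h\<close> tends to \<open>0\<close>, the base of the power in \<open>contractive_quotient\<close> tends to \<open>1 + lam \<kappa>\<close>.\<close>
lemma contractive_powr:
  assumes p: "p > 1" and \<theta>: "\<theta> > 0"
  shows "contractive p (\<lambda>\<kappa>. (1 + lam \<kappa>) powr (- \<theta>))"
proof (rule contractive_limit[OF p])
  let ?h = "\<lambda>j. 1 / real (Suc j)"
  show "contractive p (\<lambda>\<kappa>. ((1 - 1 / (1 + ?h j * (1 + lam \<kappa>))) / (1 - 1 / (1 + ?h j))) powr (- \<theta>))" for j
    by (rule contractive_quotient[OF p \<theta>]) simp
  fix \<kappa>
  define s where "s = 1 + lam \<kappa>"
  have s: "s \<ge> 1" using lam_nonneg[of \<kappa>] by (simp add: s_def)
  have eq: "(1 - 1 / (1 + h * s)) / (1 - 1 / (1 + h)) = s * (1 + h) / (1 + h * s)" if "h > 0" for h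
  proof -
    have "1 + h * s > 0" using s that by (simp add: add_pos_pos)
    then have "1 - 1 / (1 + h * s) = h * s / (1 + h * s)" by (simp add: field_simps)
    moreover have "1 - 1 / (1 + h) = h / (1 + h)" using that by (simp add: field_simps)
    ultimately show ?thesis using that by simp
  qed
  have h0: "?h \<longlonglongrightarrow> 0" using LIMSEQ_inverse_real_of_nat by (simp add: inverse_eq_divide)
  have "(\<lambda>j. s * (1 + ?h j) / (1 + ?h j * s)) \<longlonglongrightarrow> s * (1 + 0) / (1 + 0 * s)"
    by (intro tendsto_divide tendsto_mult tendsto_add tendsto_const h0) simp
  then have "(\<lambda>j. (1 - 1 / (1 + ?h j * s)) / (1 - 1 / (1 + ?h j))) \<longlonglongrightarrow> s"
    by (subst eq) simp_all
  then have "(\<lambda>j. ((1 - 1 / (1 + ?h j * s)) / (1 - 1 / (1 + ?h j))) powr (- \<theta>)) \<longlonglongrightarrow> s powr (- \<theta>)"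
    using s by (intro tendsto_powr tendsto_const) auto
  then show "(\<lambda>j. ((1 - 1 / (1 + ?h j * (1 + lam \<kappa>))) / (1 - 1 / (1 + ?h j))) powr (- \<theta>))
      \<longlonglongrightarrow> (1 + lam \<kappa>) powr (- \<theta>)"
    by (simp add: s_def)
qed

lemma lam_ge_component: "lam \<kappa> \<ge> real (\<kappa> $ i)"
proof -
  have "real (\<kappa> $ i) \<le> real (\<kappa> $ i) * real (\<kappa> $ i)" by (cases "\<kappa> $ i") auto
  also have "\<dots> \<le> real (\<kappa> $ i) * (real (\<kappa> $ i) + \<alpha> $ i + \<beta> $ i + 1)"
    using alpha[of i] beta[of i] by (intro mult_left_mono) auto
  also have "\<dots> \<le> lam \<kappa>"
    unfolding jacobi_eigenvalue_def
    by (rule member_le_sum[of i UNIV "\<lambda>i. real (\<kappa> $ i) * (real (\<kappa> $ i) + \<alpha> $ i + \<beta> $ i + 1)"])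
      (auto intro: lam_summand_nonneg)
  finally show ?thesis .
qed

lemma lam_ge_1: "\<kappa> \<noteq> 0 \<Longrightarrow> lam \<kappa> \<ge> 1"
proof -
  assume "\<kappa> \<noteq> 0"
  then obtain i where "\<kappa> $ i \<noteq> 0" by (auto simp: vec_eq_iff)
  then have "real (\<kappa> $ i) \<ge> 1" by simp
  then show ?thesis using lam_ge_component[of \<kappa> i] by linarith
qed

text \<open>The sup norms of the basis functions are bounded by a product of powers of the \<open>1 + \<kappa> $ i\<close>, and each
  \<open>1 + \<kappa> $ i\<close> is at most \<open>1 + lam \<kappa>\<close>; so a high power of \<open>1 + lam \<kappa>\<close> in the denominator makes the kernel
  series converge absolutely.\<close>
lemma bounded_mult_rapid_decay:
  assumes p: "p > 1"
  shows "\<exists>M. \<forall>m. (\<exists>D. \<forall>\<kappa>. \<bar>m \<kappa>\<bar> \<le> D / (1 + lam \<kappa>) ^ M) \<longrightarrow> bounded_mult p m"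
proof -
  have "\<exists>C N. 0 \<le> C \<and> (\<forall>n. \<forall>x\<in>{-1..1}. \<bar>poly (jp i n) x\<bar> \<le> C * real (Suc n) ^ N)" for i
    by (rule jacobi_poly_polynomial_growth[OF alpha_gt(1) beta_gt(1)])
  then obtain C N where C: "\<And>i. 0 \<le> C i"
    and CN: "\<And>i n x. x \<in> {-1..1} \<Longrightarrow> \<bar>poly (jp i n) x\<bar> \<le> C i * real (Suc n) ^ N i"
    by metis
  define S where "S \<kappa> = (\<Prod>i\<in>UNIV. C i * real (Suc (\<kappa> $ i)) ^ N i)" for \<kappa> :: "nat^'n"
  have S: "\<bar>basis \<kappa> x\<bar> \<le> S \<kappa>" if "x \<in> cbox (-1) 1" for \<kappa> x
    unfolding jacobi_basis_def S_def abs_prod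
    using that CN by (intro prod_mono) (auto simp: mem_cube_iff)
  \<comment> \<open>The square of the basis function costs \<open>2 * N i\<close> powers per coordinate; two more make the series
    converge.\<close>
  define L where "L = 2 + (\<Sum>i\<in>UNIV. 2 * N i)"
  have L: "2 * N i + 2 \<le> L" for i
    using member_le_sum[of i UNIV "\<lambda>i. 2 * N i"] by (simp add: L_def)
  define M where "M = L * CARD('n)"
  define g where "g k = 1 / real (Suc k) ^ 2" for k
  have g: "g k \<ge> 0" "summable g" for k
    using inverse_power_summable[of 2, where 'a = real, THEN summable_Suc_iff[THEN iffD2]]
    by (simp_all add: g_def[abs_def] inverse_eq_divide power_one_over)
  define C2 where "C2 = (\<Prod>i\<in>UNIV. (C i)\<^sup>2)"
  have C2: "C2 \<ge> 0" by (simp add: C2_def prod_nonneg)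
  have decay: "(S \<kappa>)\<^sup>2 / (1 + lam \<kappa>) ^ M \<le> C2 * (\<Prod>i\<in>UNIV. g (\<kappa> $ i))" for \<kappa>
  proof -
    have s: "1 + lam \<kappa> > 0" using lam_nonneg[of \<kappa>] by simp
    have "(S \<kappa>)\<^sup>2 / (1 + lam \<kappa>) ^ M = (\<Prod>i\<in>UNIV. (C i)\<^sup>2 * (real (Suc (\<kappa> $ i)) ^ (2 * N i) / (1 + lam \<kappa>) ^ L))"
    proof -
      have "(S \<kappa>)\<^sup>2 = (\<Prod>i\<in>UNIV. (C i)\<^sup>2 * real (Suc (\<kappa> $ i)) ^ (2 * N i))"
        unfolding S_def prod_power_distrib power_mult_distrib power_even_eq ..
      moreover have "(1 + lam \<kappa>) ^ M = (\<Prod>i\<in>(UNIV :: 'n set). (1 + lam \<kappa>) ^ L)"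
        by (simp only: M_def power_mult prod_constant)
      ultimately show ?thesis by (simp only: prod_dividef[symmetric] times_divide_eq_right)
    qed
    also have "\<dots> \<le> (\<Prod>i\<in>UNIV. (C i)\<^sup>2 * g (\<kappa> $ i))"
    proof (intro prod_mono conjI mult_left_mono)
      fix i
      have "real (Suc (\<kappa> $ i)) ^ (2 * N i + 2) \<le> real (Suc (\<kappa> $ i)) ^ L"
        using L[of i] by (intro power_increasing) auto
      also have "\<dots> \<le> (1 + lam \<kappa>) ^ L"
        using lam_ge_component[of \<kappa> i] by (intro power_mono) auto
      finally have "real (Suc (\<kappa> $ i)) ^ (2 * N i) * real (Suc (\<kappa> $ i)) ^ 2 \<le> (1 + lam \<kappa>) ^ L"
        by (simp only: power_add)
      then show "real (Suc (\<kappa> $ i)) ^ (2 * N i) / (1 + lam \<kappa>) ^ L \<le> g (\<kappa> $ i)"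
        using s unfolding g_def by (simp add: divide_simps mult.commute)
      show "0 \<le> (C i)\<^sup>2 * (real (Suc (\<kappa> $ i)) ^ (2 * N i) / (1 + lam \<kappa>) ^ L)"
        using s by simp
    qed simp
    finally show ?thesis by (simp add: prod.distrib C2_def)
  qed
  show ?thesis
  proof (intro exI[of _ M] allI impI)
    fix m assume "\<exists>D. \<forall>\<kappa>. \<bar>m \<kappa>\<bar> \<le> D / (1 + lam \<kappa>) ^ M"
    then obtain D where D: "\<And>\<kappa>. \<bar>m \<kappa>\<bar> \<le> D / (1 + lam \<kappa>) ^ M" by blast
    have D0: "D \<ge> 0" using D[of 0] by (simp add: lam_0)
    show "bounded_mult p m"
    proof (rule bounded_mult_kernel[OF p S])
      fix K :: "(nat^'n) set" assume K: "finite K"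
      have "(\<Sum>\<kappa>\<in>K. \<bar>m \<kappa>\<bar> * (S \<kappa>)\<^sup>2) \<le> (\<Sum>\<kappa>\<in>K. D * C2 * (\<Prod>i\<in>UNIV. g (\<kappa> $ i)))"
      proof (rule sum_mono)
        fix \<kappa>
        have "\<bar>m \<kappa>\<bar> * (S \<kappa>)\<^sup>2 \<le> D / (1 + lam \<kappa>) ^ M * (S \<kappa>)\<^sup>2"
          by (intro mult_right_mono D) simp
        also have "\<dots> = D * ((S \<kappa>)\<^sup>2 / (1 + lam \<kappa>) ^ M)" by simp
        also have "\<dots> \<le> D * (C2 * (\<Prod>i\<in>UNIV. g (\<kappa> $ i)))"
          by (intro mult_left_mono decay D0)
        finally show "\<bar>m \<kappa>\<bar> * (S \<kappa>)\<^sup>2 \<le> D * C2 * (\<Prod>i\<in>UNIV. g (\<kappa> $ i))" by simp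
      qed
      also have "\<dots> = D * C2 * (\<Sum>\<kappa>\<in>K. \<Prod>i\<in>UNIV. g (\<kappa> $ i))" by (simp add: sum_distrib_left)
      also have "\<dots> \<le> D * C2 * (\<Prod>i\<in>(UNIV :: 'n set). suminf g)"
        using D0 C2 by (intro mult_left_mono sum_vec_product_le g K) auto
      finally show "(\<Sum>\<kappa>\<in>K. \<bar>m \<kappa>\<bar> * (S \<kappa>)\<^sup>2) \<le> D * C2 * (\<Prod>i\<in>(UNIV :: 'n set). suminf g)" .
    qed
  qed
qed

text \<open>With \<open>s = 1 + lam \<kappa>\<close> and \<open>q = 1 / s\<close>, the multiplier is \<open>s powr (- \<theta>) * (1 - q) powr (- \<theta>)\<close> for
  \<open>\<kappa> \<noteq> 0\<close>, and \<open>q \<le> 1 / 2\<close> there because of the gap \<open>lam \<kappa> \<ge> 1\<close>. Expanding the second factor, \<open>M\<close> terms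
  give contractive multipliers and the rest is at most a constant times \<open>q ^ M\<close>. The mode \<open>\<kappa> = 0\<close>, where
  the series diverges, is left to the remainder.\<close>
lemma bounded_mult_fractional:
  assumes p: "p > 1" and \<theta>: "\<theta> > 0"
  shows "bounded_mult p (\<lambda>\<kappa>. if \<kappa> = 0 then 0 else lam \<kappa> powr (- \<theta>))"
proof -
  define c where "c = binom_coeff \<theta>"
  have c: "c j \<ge> 0" for j unfolding c_def by (rule binom_coeff_nonneg[OF \<theta>])
  obtain M where M: "\<And>m. \<exists>D. \<forall>\<kappa>. \<bar>m \<kappa>\<bar> \<le> D / (1 + lam \<kappa>) ^ M \<Longrightarrow> bounded_mult p m"
    using bounded_mult_rapid_decay[OF p] by blast
  define head where "head \<kappa> = (\<Sum>j<M. c j * (1 + lam \<kappa>) powr (- (\<theta> + real j)))" for \<kappa>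
  define tail where "tail \<kappa> = (if \<kappa> = 0 then 0 else lam \<kappa> powr (- \<theta>)) - head \<kappa>" for \<kappa>
  have "contractive p (\<lambda>\<kappa>. (1 + lam \<kappa>) powr (- (\<theta> + real j)))" for j
    using \<theta> by (intro contractive_powr p) auto
  then have head: "bounded_mult p head"
    unfolding head_def[abs_def]
    by (intro bounded_mult_sum p bounded_mult_scale contractive_imp_bounded_mult) auto
  define D1 where "D1 = (\<Sum>j. c (j + M) * (1 / 2) ^ j)"
  have sm: "summable (\<lambda>j. c (j + M) * (1 / 2) ^ j)"
  proof -
    have "summable (\<lambda>j. c j * (1 / 2) ^ j)"
      unfolding c_def by (rule sums_summable[OF binom_coeff_sums]) simp
    then have "summable (\<lambda>j. c (j + M) * (1 / 2) ^ (j + M))"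
      by (simp add: summable_iff_shift[of "\<lambda>j. c j * (1 / 2) ^ j"])
    then have "summable (\<lambda>j. c (j + M) * (1 / 2) ^ (j + M) * 2 ^ M)" by (rule summable_mult2)
    then show ?thesis by (simp add: power_add power_one_over)
  qed
  have D1: "D1 \<ge> 0" unfolding D1_def using c by (intro suminf_nonneg sm) auto
  have "\<bar>tail \<kappa>\<bar> \<le> (\<bar>tail 0\<bar> + D1) / (1 + lam \<kappa>) ^ M" for \<kappa>
  proof (cases "\<kappa> = 0")
    case True
    then show ?thesis using D1 by (simp add: lam_0)
  next
    case False
    define s where "s = 1 + lam \<kappa>"
    have l: "lam \<kappa> \<ge> 1" using lam_ge_1[OF False] .
    have s: "s \<ge> 2" using l by (simp add: s_def)
    define q where "q = 1 / s"
    have q: "0 < q" "q \<le> 1 / 2" using s by (simp_all add: q_def field_simps)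
    have pw: "s powr (- (\<theta> + real j)) = s powr (- \<theta>) * q ^ j" for j
      using s by (simp add: powr_diff powr_realpow q_def power_one_over divide_inverse power_inverse)
    have sums: "(\<lambda>j. c j * q ^ j) sums (1 - q) powr (- \<theta>)"
      unfolding c_def using q by (intro binom_coeff_sums) auto
    have "lam \<kappa> = s * (1 - q)" using s by (simp add: q_def s_def field_simps)
    then have "lam \<kappa> powr (- \<theta>) = s powr (- \<theta>) * (\<Sum>j. c j * q ^ j)"
      using s q sums_unique[OF sums] by (simp add: powr_mult)
    moreover have "head \<kappa> = s powr (- \<theta>) * (\<Sum>j<M. c j * q ^ j)"
      unfolding head_def s_def[symmetric] pw by (simp add: sum_distrib_left mult_ac)
    ultimately have "tail \<kappa> = s powr (- \<theta>) * ((\<Sum>j. c j * q ^ j) - (\<Sum>j<M. c j * q ^ j))"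
      using False by (simp add: tail_def right_diff_distrib)
    also have "(\<Sum>j. c j * q ^ j) - (\<Sum>j<M. c j * q ^ j) = (\<Sum>j. c (j + M) * q ^ (j + M))"
      using suminf_split_initial_segment[OF sums_summable[OF sums], of M] by simp
    finally have tl: "tail \<kappa> = s powr (- \<theta>) * (\<Sum>j. c (j + M) * q ^ (j + M))" .
    have sm': "summable (\<lambda>j. c (j + M) * q ^ (j + M))"
      using sums_summable[OF sums] by (simp add: summable_iff_shift[of "\<lambda>j. c j * q ^ j"])
    have "(\<Sum>j. c (j + M) * q ^ (j + M)) \<le> (\<Sum>j. q ^ M * (c (j + M) * (1 / 2) ^ j))"
    proof (rule suminf_le[OF _ sm' summable_mult[OF sm]])
      fix j
      have "q ^ j \<le> (1 / 2) ^ j" using q by (intro power_mono) auto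
      then have "c (j + M) * q ^ M * q ^ j \<le> c (j + M) * q ^ M * (1 / 2) ^ j"
        using q c by (intro mult_left_mono) auto
      then show "c (j + M) * q ^ (j + M) \<le> q ^ M * (c (j + M) * (1 / 2) ^ j)"
        by (simp add: power_add mult_ac)
    qed
    also have "\<dots> = q ^ M * D1" unfolding D1_def by (rule suminf_mult[OF sm])
    finally have up: "(\<Sum>j. c (j + M) * q ^ (j + M)) \<le> q ^ M * D1" .
    have nn: "(\<Sum>j. c (j + M) * q ^ (j + M)) \<ge> 0"
      using q c by (intro suminf_nonneg sm') auto
    have "s powr (- \<theta>) \<le> 1" using s \<theta> powr_mono[of "- \<theta>" 0 s] by simp
    then have "\<bar>tail \<kappa>\<bar> \<le> 1 * (q ^ M * D1)"
      unfolding tl abs_mult using up nn by (intro mult_mono) auto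
    also have "\<dots> \<le> (\<bar>tail 0\<bar> + D1) * q ^ M" using q by (simp add: distrib_right mult.commute)
    finally show ?thesis by (simp add: q_def s_def power_one_over divide_inverse power_inverse)
  qed
  then have "bounded_mult p tail" by (intro M) blast
  then have "bounded_mult p (\<lambda>\<kappa>. head \<kappa> + tail \<kappa>)"
    using p by (intro bounded_mult_add head) auto
  then show ?thesis by (simp add: tail_def)
qed

end

section \<open>Extending bounded operators from dense subspaces of $L^p$\<close>

lemma Lp_space_lincomb:
  assumes p: "p > 0" and f: "f \<in> Lp_space M p" and g: "g \<in> Lp_space M p"
  shows "(\<lambda>x. a * f x + b * g x) \<in> Lp_space M p"
    and "(\<integral>x. \<bar>a * f x + b * g x\<bar> powr p \<partial>M) \<le>
      2 powr p * (\<bar>a\<bar> powr p * (\<integral>x. \<bar>f x\<bar> powr p \<partial>M) + \<bar>b\<bar> powr p * (\<integral>x. \<bar>g x\<bar> powr p \<partial>M))"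
proof -
  have [measurable]: "f \<in> borel_measurable M" "g \<in> borel_measurable M"
    using f g by (auto simp: Lp_space_def)
  have int: "integrable M (\<lambda>x. \<bar>f x\<bar> powr p)" "integrable M (\<lambda>x. \<bar>g x\<bar> powr p)"
    using f g by (auto simp: Lp_space_def)
  define h where "h x = 2 powr p * (\<bar>a\<bar> powr p * \<bar>f x\<bar> powr p + \<bar>b\<bar> powr p * \<bar>g x\<bar> powr p)" for x
  have h: "integrable M h" unfolding h_def using int by simp
  have le: "\<bar>a * f x + b * g x\<bar> powr p \<le> h x" for x
    using abs_powr_add_le[OF p, of "a * f x" "b * g x"] by (simp add: h_def abs_mult powr_mult)
  have "integrable M (\<lambda>x. \<bar>a * f x + b * g x\<bar> powr p)"
    by (rule Bochner_Integration.integrable_bound[OF h])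
      (use le in \<open>auto intro!: AE_I2 intro: order_trans[OF _ abs_ge_self]\<close>)
  then show "(\<lambda>x. a * f x + b * g x) \<in> Lp_space M p" by (simp add: Lp_space_def)
  have "(\<integral>x. \<bar>a * f x + b * g x\<bar> powr p \<partial>M) \<le> (\<integral>x. h x \<partial>M)"
    by (rule integral_mono) (fact | rule h le)+
  also have "\<dots> = 2 powr p * (\<bar>a\<bar> powr p * (\<integral>x. \<bar>f x\<bar> powr p \<partial>M) + \<bar>b\<bar> powr p * (\<integral>x. \<bar>g x\<bar> powr p \<partial>M))"
    unfolding h_def using int by simp
  finally show "(\<integral>x. \<bar>a * f x + b * g x\<bar> powr p \<partial>M) \<le>
      2 powr p * (\<bar>a\<bar> powr p * (\<integral>x. \<bar>f x\<bar> powr p \<partial>M) + \<bar>b\<bar> powr p * (\<integral>x. \<bar>g x\<bar> powr p \<partial>M))" .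
qed

lemma Lp_fatou:
  fixes u :: "nat \<Rightarrow> 'a \<Rightarrow> real"
  assumes p: "p > 0" and u: "\<And>n. u n \<in> Lp_space M p" and g: "g \<in> borel_measurable M"
    and lim: "AE x in M. (\<lambda>n. u n x) \<longlonglongrightarrow> g x"
    and b: "\<And>n. (\<integral>x. \<bar>u n x\<bar> powr p \<partial>M) \<le> b n" "b \<longlonglongrightarrow> B"
  shows "g \<in> Lp_space M p" and "(\<integral>x. \<bar>g x\<bar> powr p \<partial>M) \<le> B"
proof -
  have [measurable]: "u n \<in> borel_measurable M" for n using u[of n] by (simp add: Lp_space_def)
  note g [measurable]
  have int: "integrable M (\<lambda>x. \<bar>u n x\<bar> powr p)" for n using u[of n] by (simp add: Lp_space_def)
  have B: "B \<ge> 0"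
  proof (rule LIMSEQ_le_const[OF b(2)], intro exI allI impI)
    have "0 \<le> (\<integral>x. \<bar>u n x\<bar> powr p \<partial>M)" for n by simp
    then show "0 \<le> b n" for n using b(1)[of n] order_trans by blast
  qed
  have "(\<integral>\<^sup>+x. ennreal (\<bar>g x\<bar> powr p) \<partial>M) = (\<integral>\<^sup>+x. liminf (\<lambda>n. ennreal (\<bar>u n x\<bar> powr p)) \<partial>M)"
  proof (rule nn_integral_cong_AE)
    show "AE x in M. ennreal (\<bar>g x\<bar> powr p) = liminf (\<lambda>n. ennreal (\<bar>u n x\<bar> powr p))"
      using lim
    proof eventually_elim
      case (elim x)
      then have "(\<lambda>n. ennreal (\<bar>u n x\<bar> powr p)) \<longlonglongrightarrow> ennreal (\<bar>g x\<bar> powr p)"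
        using p by (intro tendsto_ennrealI tendsto_powr2 tendsto_rabs tendsto_const) auto
      then show ?case by (intro lim_imp_Liminf[symmetric]) auto
    qed
  qed
  also have "\<dots> \<le> liminf (\<lambda>n. \<integral>\<^sup>+x. ennreal (\<bar>u n x\<bar> powr p) \<partial>M)"
    by (rule nn_integral_liminf) measurable
  also have "\<dots> \<le> liminf (\<lambda>n. ennreal (b n))"
  proof (rule Liminf_mono, rule always_eventually, rule allI)
    fix n
    have "(\<integral>\<^sup>+x. ennreal (\<bar>u n x\<bar> powr p) \<partial>M) = ennreal (\<integral>x. \<bar>u n x\<bar> powr p \<partial>M)"
      by (rule nn_integral_eq_integral[OF int]) simp
    then show "(\<integral>\<^sup>+x. ennreal (\<bar>u n x\<bar> powr p) \<partial>M) \<le> ennreal (b n)"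
      using b(1)[of n] by (simp add: ennreal_leI)
  qed
  also have "\<dots> = ennreal B"
    by (intro lim_imp_Liminf tendsto_ennrealI b(2)) simp
  finally have le: "(\<integral>\<^sup>+x. ennreal (\<bar>g x\<bar> powr p) \<partial>M) \<le> ennreal B" .
  have int_g: "integrable M (\<lambda>x. \<bar>g x\<bar> powr p)"
    by (rule integrableI_bounded) (use le in \<open>auto simp: le_less_trans\<close>)
  then show "g \<in> Lp_space M p" by (simp add: Lp_space_def g)
  have "ennreal (\<integral>x. \<bar>g x\<bar> powr p \<partial>M) \<le> ennreal B"
    using le nn_integral_eq_integral[OF int_g] by simp
  then show "(\<integral>x. \<bar>g x\<bar> powr p \<partial>M) \<le> B" using B by (simp add: ennreal_le_iff)
qed

text \<open>The elementary bound \<open>v \<le> t powr (1 - p) * v powr p + t\<close> with \<open>t = (1/2) ^ n\<close> turns the assumption into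
  a summable bound on the means of the increments, so the series of increments converges absolutely
  almost everywhere.\<close>
lemma AE_convergent_of_geometric_increments:
  fixes u :: "nat \<Rightarrow> 'a \<Rightarrow> real"
  assumes fin: "finite_measure M" and p: "p > 1" and u: "\<And>n. u n \<in> Lp_space M p"
    and incr: "\<And>n. (\<integral>x. \<bar>u (Suc n) x - u n x\<bar> powr p \<partial>M) \<le> D * ((1/2) ^ n) powr p"
  shows "AE x in M. convergent (\<lambda>n. u n x)"
proof -
  interpret finite_measure M by fact
  define v where "v n x = \<bar>u (Suc n) x - u n x\<bar>" for n x
  have v0: "v n x \<ge> 0" for n x by (simp add: v_def)
  have diff: "(\<lambda>x. u (Suc n) x - u n x) \<in> Lp_space M p" for n
    using Lp_space_lincomb(1)[OF _ u[of "Suc n"] u[of n], of 1 "-1"] p by simp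
  have [measurable]: "u n \<in> borel_measurable M" for n using u[of n] by (simp add: Lp_space_def)
  have [measurable]: "v n \<in> borel_measurable M" for n
    unfolding v_def[abs_def] by measurable
  have intv: "integrable M (\<lambda>x. v n x powr p)" for n
    using diff[of n] by (simp add: Lp_space_def v_def)
  define E where "E = \<bar>D\<bar> + measure M (space M)"
  have E: "E \<ge> 0" by (simp add: E_def)
  have nn: "(\<integral>\<^sup>+x. ennreal (v n x) \<partial>M) \<le> ennreal (E * (1/2) ^ n)" for n
  proof -
    define t :: real where "t = (1/2) ^ n"
    have t: "t > 0" by (simp add: t_def)
    have pt: "v n x \<le> t powr (1 - p) * v n x powr p + t" for x
    proof (cases "v n x \<le> t")
      case True
      then show ?thesis by (simp add: add_increasing)
    next
      case False
      then have "v n x powr (1 - p) \<le> t powr (1 - p)" using t p by (intro powr_mono2') auto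
      then have "v n x powr (1 - p) * v n x powr p \<le> t powr (1 - p) * v n x powr p"
        by (intro mult_right_mono) auto
      moreover have "v n x powr (1 - p) * v n x powr p = v n x"
        using False t by (simp flip: powr_add)
      ultimately show ?thesis using t by linarith
    qed
    have "(\<integral>\<^sup>+x. ennreal (v n x) \<partial>M) \<le> (\<integral>\<^sup>+x. ennreal (t powr (1 - p) * v n x powr p + t) \<partial>M)"
      by (intro nn_integral_mono ennreal_leI pt)
    also have "\<dots> = ennreal (\<integral>x. t powr (1 - p) * v n x powr p + t \<partial>M)"
      using intv t by (intro nn_integral_eq_integral) (auto intro!: AE_I2 add_nonneg_nonneg)
    also have "(\<integral>x. t powr (1 - p) * v n x powr p + t \<partial>M) =
        t powr (1 - p) * (\<integral>x. v n x powr p \<partial>M) + t * measure M (space M)"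
      using intv by simp
    also have "\<dots> \<le> t powr (1 - p) * (\<bar>D\<bar> * t powr p) + t * measure M (space M)"
    proof (intro add_mono mult_left_mono)
      have "(\<integral>x. v n x powr p \<partial>M) \<le> D * t powr p" using incr[of n] by (simp add: v_def t_def)
      also have "\<dots> \<le> \<bar>D\<bar> * t powr p" by (intro mult_right_mono) auto
      finally show "(\<integral>x. v n x powr p \<partial>M) \<le> \<bar>D\<bar> * t powr p" .
    qed (use t in auto)
    also have "t powr (1 - p) * (\<bar>D\<bar> * t powr p) = \<bar>D\<bar> * t"
    proof -
      have "t powr (1 - p) * t powr p = t" using t by (simp flip: powr_add)
      then show ?thesis by (metis mult.left_commute)
    qed
    finally show ?thesis by (simp add: E_def t_def algebra_simps ennreal_leI)
  qed
  have "(\<integral>\<^sup>+x. (\<Sum>n. ennreal (v n x)) \<partial>M) = (\<Sum>n. \<integral>\<^sup>+x. ennreal (v n x) \<partial>M)"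
    by (rule nn_integral_suminf) measurable
  also have "\<dots> \<le> (\<Sum>n. ennreal (E * (1/2) ^ n))" by (intro suminf_le nn) auto
  also have "\<dots> = ennreal (\<Sum>n. E * (1/2) ^ n)"
    using E by (intro suminf_ennreal2 summable_mult summable_geometric) auto
  also have "\<dots> < \<infinity>" by simp
  finally have "AE x in M. (\<Sum>n. ennreal (v n x)) \<noteq> \<infinity>"
    by (intro nn_integral_PInf_AE) auto
  then show ?thesis
  proof eventually_elim
    case (elim x)
    then have "summable (\<lambda>n. v n x)" using v0 by (intro summable_suminf_not_top) auto
    then have "summable (\<lambda>n. u (Suc n) x - u n x)"
      unfolding v_def by (rule summable_rabs_cancel)
    then have "convergent (\<lambda>n. \<Sum>k<n. u (Suc k) x - u k x)" by (simp add: summable_iff_convergent)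
    then have "convergent (\<lambda>n. u n x - u 0 x)" 
      by (simp only: sum_lessThan_telescope[of "\<lambda>k. u k x"])
    then have "convergent (\<lambda>n. (u n x - u 0 x) + u 0 x)"
      by (rule convergent_add) (rule convergent_const)
    then show ?case by simp
  qed
qed

text \<open>\<open>T f\<close> is the almost everywhere limit of \<open>A\<close> along a sequence in \<open>V\<close> that converges to \<open>f\<close> geometrically
  fast.\<close>
theorem Lp_bounded_extension:
  fixes A :: "('a \<Rightarrow> real) \<Rightarrow> 'a \<Rightarrow> real"
  assumes fin: "finite_measure M" and p: "p > 1"
    and V: "V \<subseteq> Lp_space M p" "\<And>f g a b. f \<in> V \<Longrightarrow> g \<in> V \<Longrightarrow> (\<lambda>x. a * f x + b * g x) \<in> V"
    and dense: "\<And>f e. f \<in> Lp_space M p \<Longrightarrow> e > 0 \<Longrightarrow> \<exists>g\<in>V. (\<integral>x. \<bar>f x - g x\<bar> powr p \<partial>M) < e"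
    and A: "\<And>f. f \<in> V \<Longrightarrow> A f \<in> V"
      "\<And>f g a b x. f \<in> V \<Longrightarrow> g \<in> V \<Longrightarrow> A (\<lambda>x. a * f x + b * g x) x = a * A f x + b * A g x"
      "\<And>f. f \<in> V \<Longrightarrow> (\<integral>x. \<bar>A f x\<bar> powr p \<partial>M) \<le> C * (\<integral>x. \<bar>f x\<bar> powr p \<partial>M)"
    and C: "C \<ge> 0"
  shows "\<exists>T. Lp_bounded_linear M p T \<and> (\<forall>f\<in>V. AE x in M. T f x = A f x)"
proof -
  have p0: "p > 0" using p by simp
  define N where "N f = (\<integral>x. \<bar>f x\<bar> powr p \<partial>M)" for f :: "'a \<Rightarrow> real"
  have N0: "N f \<ge> 0" for f by (simp add: N_def)
  note Lp_lincomb = Lp_space_lincomb[OF p0, of _ M, folded N_def]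
  have Lp_diff: "(\<lambda>x. f x - g x) \<in> Lp_space M p" "N (\<lambda>x. f x - g x) \<le> 2 powr p * (N f + N g)"
    if "f \<in> Lp_space M p" "g \<in> Lp_space M p" for f g
    using Lp_lincomb[OF that, of 1 "-1"] by auto
  have VL: "f \<in> Lp_space M p" if "f \<in> V" for f using V(1) that by blast
  have V_diff: "(\<lambda>x. f x - g x) \<in> V" if "f \<in> V" "g \<in> V" for f g
    using V(2)[OF that, of 1 "-1"] by simp
  have A_diff: "A (\<lambda>x. f x - g x) x = A f x - A g x" if "f \<in> V" "g \<in> V" for f g x
    using A(2)[OF that, of 1 "-1"] by simp
  have N_zero: "AE x in M. f x = 0" if f: "f \<in> Lp_space M p" and z: "\<And>e. e > 0 \<Longrightarrow> N f \<le> D * e" for f D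
  proof -
    have "N f = 0"
    proof (rule ccontr)
      assume "N f \<noteq> 0"
      then have "N f > 0" using N0[of f] by linarith
      moreover have "N f \<le> D * (N f / (2 * (\<bar>D\<bar> + 1)))" using calculation by (intro z) auto
      moreover have "D * (N f / (2 * (\<bar>D\<bar> + 1))) \<le> (\<bar>D\<bar> + 1) * (N f / (2 * (\<bar>D\<bar> + 1)))"
        using N0[of f] by (intro mult_right_mono) auto
      moreover have "k * (r / (2 * k)) = r / 2" if "k > 0" for k r :: real using that by simp
      then have "(\<bar>D\<bar> + 1) * (N f / (2 * (\<bar>D\<bar> + 1))) = N f / 2" by this simp
      ultimately show False by linarith
    qed
    then have "AE x in M. \<bar>f x\<bar> powr p = 0"
      using f by (subst integral_nonneg_eq_0_iff_AE[symmetric]) (auto simp: N_def Lp_space_def)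
    then show ?thesis by simp
  qed
  have ex: "\<exists>q. \<forall>n. q n \<in> V \<and> N (\<lambda>x. f x - q n x) < ((1/2) ^ n) powr p" if "f \<in> Lp_space M p" for f
  proof -
    have "\<forall>n. \<exists>g. g \<in> V \<and> N (\<lambda>x. f x - g x) < ((1/2) ^ n) powr p"
      using dense[OF that, of "((1/2) ^ n) powr p" for n] by (auto simp: N_def)
    then show ?thesis by (rule choice)
  qed
  define q where "q f = (SOME q. \<forall>n. q n \<in> V \<and> N (\<lambda>x. f x - q n x) < ((1/2) ^ n) powr p)" for f
  have q: "q f n \<in> V" "N (\<lambda>x. f x - q f n x) < ((1/2) ^ n) powr p" if "f \<in> Lp_space M p" for f n
    using someI_ex[OF ex[OF that]] unfolding q_def[symmetric] by auto
  define T where "T f x = lim (\<lambda>n. A (q f n) x)" for f x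
  have T_lim: "AE x in M. (\<lambda>n. A (q f n) x) \<longlonglongrightarrow> T f x" if f: "f \<in> Lp_space M p" for f
  proof -
    have "AE x in M. convergent (\<lambda>n. A (q f n) x)"
    proof (rule AE_convergent_of_geometric_increments[OF fin p])
      show "A (q f n) \<in> Lp_space M p" for n by (intro VL A(1) q f)
      fix n
      have d: "(\<lambda>x. f x - q f n x) \<in> Lp_space M p" for n by (intro Lp_diff VL q f)
      have "N (\<lambda>x. q f (Suc n) x - q f n x) = N (\<lambda>x. (f x - q f n x) - (f x - q f (Suc n) x))"
        by (rule arg_cong[where f = N]) auto
      also have "\<dots> \<le> 2 powr p * (N (\<lambda>x. f x - q f n x) + N (\<lambda>x. f x - q f (Suc n) x))"
        by (intro Lp_diff d)
      also have "\<dots> \<le> 2 powr p * (((1/2) ^ n) powr p + ((1/2) ^ n) powr p)"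
      proof (intro mult_left_mono add_mono)
        have "N (\<lambda>x. f x - q f (Suc n) x) \<le> ((1/2) ^ Suc n) powr p" using q(2)[OF f, of "Suc n"] by simp
        also have "\<dots> \<le> ((1/2) ^ n) powr p" using p0 by (intro powr_mono2) auto
        finally show "N (\<lambda>x. f x - q f (Suc n) x) \<le> ((1/2) ^ n) powr p" .
      qed (use q(2)[OF f, of n] in auto)
      finally have "C * N (\<lambda>x. q f (Suc n) x - q f n x) \<le> C * (2 powr p * 2) * ((1/2) ^ n) powr p"
        using mult_left_mono[OF _ C] by (fastforce simp: mult.assoc)
      moreover have "N (\<lambda>x. A (q f (Suc n)) x - A (q f n) x) \<le> C * N (\<lambda>x. q f (Suc n) x - q f n x)"
        using A(3)[OF V_diff[OF q(1)[OF f] q(1)[OF f]], of "Suc n" n] q(1)[OF f]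
        by (simp add: N_def A_diff)
      ultimately show "(\<integral>x. \<bar>A (q f (Suc n)) x - A (q f n) x\<bar> powr p \<partial>M)
          \<le> C * (2 powr p * 2) * ((1/2) ^ n) powr p"
        by (simp add: N_def)
    qed
    then show ?thesis
      by eventually_elim (simp add: T_def convergent_LIMSEQ_iff)
  qed
  have Am: "A (q f n) \<in> borel_measurable M" if "f \<in> Lp_space M p" for f n
    using VL[OF A(1)[OF q(1)[OF that]]] by (simp add: Lp_space_def)
  have T_meas: "T f \<in> borel_measurable M" if "f \<in> Lp_space M p" for f
    unfolding T_def[abs_def] using Am[OF that] by (rule borel_measurable_lim_metric)
  \<comment> \<open>Everything else follows from this estimate: it pins down \<open>T f\<close> by the values of \<open>A\<close> near \<open>f\<close>.\<close>
  have key: "(\<lambda>x. T f x - A h x) \<in> Lp_space M p"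
    "N (\<lambda>x. T f x - A h x) \<le> C * 2 powr p * N (\<lambda>x. f x - h x)"
    if f: "f \<in> Lp_space M p" and h: "h \<in> V" for f h
  proof -
    define b where "b n = C * (2 powr p * (N (\<lambda>x. f x - h x) + ((1/2) ^ n) powr p))" for n
    have u: "(\<lambda>x. A (q f n) x - A h x) \<in> Lp_space M p" for n by (intro Lp_diff VL A(1) q f h)
    have bn: "(\<integral>x. \<bar>A (q f n) x - A h x\<bar> powr p \<partial>M) \<le> b n" for n
    proof -
      have "(\<integral>x. \<bar>A (q f n) x - A h x\<bar> powr p \<partial>M) \<le> C * N (\<lambda>x. q f n x - h x)"
        using A(3)[OF V_diff[OF q(1)[OF f] h], of n] q(1)[OF f] h by (simp add: N_def A_diff)
      also have "N (\<lambda>x. q f n x - h x) = N (\<lambda>x. (f x - h x) - (f x - q f n x))"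
        by (rule arg_cong[where f = N]) auto
      also have "C * \<dots> \<le> b n"
        unfolding b_def
      proof (rule mult_left_mono[OF _ C])
        have "N (\<lambda>x. (f x - h x) - (f x - q f n x)) \<le>
            2 powr p * (N (\<lambda>x. f x - h x) + N (\<lambda>x. f x - q f n x))"
          by (intro Lp_diff f VL h q)
        also have "\<dots> \<le> 2 powr p * (N (\<lambda>x. f x - h x) + ((1/2) ^ n) powr p)"
          using q(2)[OF f, of n] by (intro mult_left_mono add_left_mono) auto
        finally show "N (\<lambda>x. (f x - h x) - (f x - q f n x)) \<le>
            2 powr p * (N (\<lambda>x. f x - h x) + ((1/2) ^ n) powr p)" .
      qed
      finally show ?thesis .
    qed
    have "(\<lambda>n. ((1/2) ^ n) powr p) \<longlonglongrightarrow> (0::real) powr p"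
      using p0 by (intro tendsto_powr2 LIMSEQ_power_zero tendsto_const) auto
    then have "b \<longlonglongrightarrow> C * (2 powr p * (N (\<lambda>x. f x - h x) + 0))"
      unfolding b_def by (intro tendsto_mult tendsto_add tendsto_const) simp
    then have bl: "b \<longlonglongrightarrow> C * 2 powr p * N (\<lambda>x. f x - h x)" by (simp add: mult.assoc)
    have g: "(\<lambda>x. T f x - A h x) \<in> borel_measurable M"
      using T_meas[OF f] VL[OF A(1)[OF h]] unfolding Lp_space_def
      by (intro borel_measurable_diff) auto
    have lim: "AE x in M. (\<lambda>n. A (q f n) x - A h x) \<longlonglongrightarrow> T f x - A h x"
      using T_lim[OF f] by eventually_elim (intro tendsto_diff tendsto_const)
    show "(\<lambda>x. T f x - A h x) \<in> Lp_space M p" by (rule Lp_fatou(1)[OF p0 u g lim bn bl])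
    show "N (\<lambda>x. T f x - A h x) \<le> C * 2 powr p * N (\<lambda>x. f x - h x)"
      unfolding N_def[of "\<lambda>x. T f x - A h x"] by (rule Lp_fatou(2)[OF p0 u g lim bn bl])
  qed
  have zero: "(\<lambda>x. 0) \<in> V" "A (\<lambda>x. 0) = (\<lambda>x. 0)"
  proof -
    have "(\<lambda>x. 0) \<in> Lp_space M p" using p0 by (simp add: Lp_space_def)
    then obtain g where g: "g \<in> V" using dense[of "\<lambda>x. 0" 1] by auto
    show "(\<lambda>x. 0) \<in> V" using V(2)[OF g g, of 0 0] by simp
    show "A (\<lambda>x. 0) = (\<lambda>x. 0)" using A(2)[OF g g, of 0 0] by (simp add: fun_eq_iff)
  qed
  have TL: "T f \<in> Lp_space M p" and TN: "N (T f) \<le> C * 2 powr p * N f" if "f \<in> Lp_space M p" for f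
    using key[OF that zero(1)] by (simp_all add: zero(2))
  have T_ext: "AE x in M. T f x = A f x" if f: "f \<in> V" for f
  proof -
    have "AE x in M. T f x - A f x = 0"
      by (rule N_zero[OF key(1)[OF VL[OF f] f], of 0])
        (use key(2)[OF VL[OF f] f] p0 in \<open>simp add: N_def\<close>)
    then show ?thesis by simp
  qed
  have T_lin: "AE x in M. T (\<lambda>y. a * f y + b * g y) x = a * T f x + b * T g x"
    if f: "f \<in> Lp_space M p" and g: "g \<in> Lp_space M p" for f g a b
  proof -
    let ?s = "\<lambda>y. a * f y + b * g y"
    let ?D = "\<lambda>x. T ?s x - (a * T f x + b * T g x)"
    have s: "?s \<in> Lp_space M p" by (intro Lp_lincomb f g)
    have D: "?D \<in> Lp_space M p" by (intro Lp_diff Lp_lincomb TL s f g)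
    define G where "G = 2 powr p * (C * 2 powr p * (2 powr p * (\<bar>a\<bar> powr p + \<bar>b\<bar> powr p)) +
        2 powr p * ((\<bar>a\<bar> powr p + \<bar>b\<bar> powr p) * (C * 2 powr p)))"
    have "AE x in M. ?D x = 0"
    proof (rule N_zero[OF D, of G])
      fix e :: real assume e: "e > 0"
      obtain h where h: "h \<in> V" "N (\<lambda>x. f x - h x) < e" using dense[OF f e] by (auto simp: N_def)
      obtain k where k: "k \<in> V" "N (\<lambda>x. g x - k x) < e" using dense[OF g e] by (auto simp: N_def)
      let ?hk = "\<lambda>x. a * h x + b * k x"
      let ?P = "\<lambda>x. T ?s x - A ?hk x"
      let ?Q = "\<lambda>x. a * (T f x - A h x) + b * (T g x - A k x)"
      have hk: "?hk \<in> V" by (intro V h k)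
      have D_eq: "?D = (\<lambda>x. ?P x - ?Q x)"
        by (rule ext) (simp add: A(2)[OF h(1) k(1)] algebra_simps)
      have P: "?P \<in> Lp_space M p" by (intro key s hk)
      have Q: "?Q \<in> Lp_space M p" by (intro Lp_lincomb key f g h k)
      have "N ?P \<le> C * 2 powr p * N (\<lambda>x. ?s x - ?hk x)" by (intro key s hk)
      also have "(\<lambda>x. ?s x - ?hk x) = (\<lambda>x. a * (f x - h x) + b * (g x - k x))"
        by (auto simp: algebra_simps)
      also have "C * 2 powr p * N \<dots> \<le> C * 2 powr p * (2 powr p * (\<bar>a\<bar> powr p * e + \<bar>b\<bar> powr p * e))"
      proof (intro mult_left_mono)
        have "N (\<lambda>x. a * (f x - h x) + b * (g x - k x)) \<le>
            2 powr p * (\<bar>a\<bar> powr p * N (\<lambda>x. f x - h x) + \<bar>b\<bar> powr p * N (\<lambda>x. g x - k x))"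
          by (intro Lp_lincomb Lp_diff f g VL h k)
        also have "\<dots> \<le> 2 powr p * (\<bar>a\<bar> powr p * e + \<bar>b\<bar> powr p * e)"
          using h(2) k(2) by (intro mult_left_mono add_mono) auto
        finally show "N (\<lambda>x. a * (f x - h x) + b * (g x - k x)) \<le>
            2 powr p * (\<bar>a\<bar> powr p * e + \<bar>b\<bar> powr p * e)" .
      qed (use C in auto)
      finally have NP: "N ?P \<le> C * 2 powr p * (2 powr p * (\<bar>a\<bar> powr p * e + \<bar>b\<bar> powr p * e))" .
      have "N ?Q \<le> 2 powr p * (\<bar>a\<bar> powr p * N (\<lambda>x. T f x - A h x) + \<bar>b\<bar> powr p * N (\<lambda>x. T g x - A k x))"
        by (intro Lp_lincomb key f g h k)
      also have "\<dots> \<le> 2 powr p * (\<bar>a\<bar> powr p * (C * 2 powr p * e) + \<bar>b\<bar> powr p * (C * 2 powr p * e))"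
      proof (intro mult_left_mono add_mono)
        show "N (\<lambda>x. T f x - A h x) \<le> C * 2 powr p * e"
          by (rule order_trans[OF key(2)[OF f h(1)]]) (use C h(2) in \<open>auto intro!: mult_left_mono\<close>)
        show "N (\<lambda>x. T g x - A k x) \<le> C * 2 powr p * e"
          by (rule order_trans[OF key(2)[OF g k(1)]]) (use C k(2) in \<open>auto intro!: mult_left_mono\<close>)
      qed auto
      finally have NQ: "N ?Q \<le> 2 powr p * (\<bar>a\<bar> powr p * (C * 2 powr p * e) + \<bar>b\<bar> powr p * (C * 2 powr p * e))" .
      have "N ?D \<le> 2 powr p * (N ?P + N ?Q)" unfolding D_eq by (rule Lp_diff(2)[OF P Q])
      also have "\<dots> \<le> 2 powr p * (C * 2 powr p * (2 powr p * (\<bar>a\<bar> powr p * e + \<bar>b\<bar> powr p * e)) +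
          2 powr p * (\<bar>a\<bar> powr p * (C * 2 powr p * e) + \<bar>b\<bar> powr p * (C * 2 powr p * e)))"
        by (intro mult_left_mono add_mono NP NQ) auto
      also have "\<dots> = G * e" by (simp add: G_def algebra_simps)
      finally show "N ?D \<le> G * e" .
    qed
    then show ?thesis by simp
  qed
  have "Lp_bounded_linear M p T"
    unfolding Lp_bounded_linear_def
  proof (intro conjI ballI allI impI)
    show "T f \<in> Lp_space M p" if "f \<in> Lp_space M p" for f by (rule TL[OF that])
    show "AE x in M. T (\<lambda>y. f y + g y) x = T f x + T g x"
      if "f \<in> Lp_space M p" "g \<in> Lp_space M p" for f g
      using T_lin[OF that, of 1 1] by simp
    show "AE x in M. T (\<lambda>y. c * f y) x = c * T f x" if "f \<in> Lp_space M p" for f c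
      using T_lin[OF that that, of c 0] by simp
    show "AE x in M. T f x = T g x"
      if f: "f \<in> Lp_space M p" and g: "g \<in> Lp_space M p" and eq: "AE x in M. f x = g x" for f g
    proof -
      have d: "(\<lambda>x. f x - g x) \<in> Lp_space M p" by (intro Lp_diff f g)
      have "N (\<lambda>x. f x - g x) = (\<integral>x. 0 \<partial>M)" unfolding N_def
      proof (rule integral_cong_AE)
        show "AE x in M. \<bar>f x - g x\<bar> powr p = 0" using eq by eventually_elim simp
        show "(\<lambda>x. \<bar>f x - g x\<bar> powr p) \<in> borel_measurable M" using d by (auto simp: Lp_space_def)
      qed simp
      then have TN0: "N (T (\<lambda>x. f x - g x)) \<le> 0" using TN[OF d] by simp
      have "AE x in M. T (\<lambda>x. f x - g x) x = 0"
        by (rule N_zero[OF TL[OF d], of 0]) (simp add: TN0)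
      moreover have "AE x in M. T (\<lambda>x. f x - g x) x = T f x - T g x"
        using T_lin[OF f g, of 1 "-1"] by simp
      ultimately show ?thesis by eventually_elim simp
    qed
    show "\<exists>c. \<forall>f\<in>Lp_space M p. Lp_norm M p (T f) \<le> c * Lp_norm M p f"
    proof (intro exI ballI)
      fix f assume f: "f \<in> Lp_space M p"
      have "Lp_norm M p (T f) \<le> (C * 2 powr p * N f) powr (1 / p)"
        unfolding Lp_norm_def N_def[symmetric] using TN[OF f] N0[of "T f"] p0
        by (intro powr_mono2) auto
      also have "\<dots> = (C * 2 powr p) powr (1 / p) * Lp_norm M p f"
        using C N0[of f] by (simp add: Lp_norm_def N_def powr_mult)
      finally show "Lp_norm M p (T f) \<le> (C * 2 powr p) powr (1 / p) * Lp_norm M p f" .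
    qed
  qed
  then show ?thesis by (intro exI[of _ T] conjI ballI T_ext)
qed

section \<open>Enumeration of the spectrum\<close>

text \<open>The number of elements of \<open>E\<close> below \<open>x\<close> is strictly increasing in \<open>x\<close>, and its values form an infinite
  initial segment of the natural numbers; the enumeration is its inverse.\<close>
lemma ex1_increasing_enumeration:
  fixes E :: "real set"
  assumes inf: "infinite E" and fin: "\<And>B. finite {x \<in> E. x \<le> B}"
  shows "\<exists>!r :: nat \<Rightarrow> real. strict_mono r \<and> range r = E"
proof (rule ex_ex1I)
  define N where "N x = card {y \<in> E. y < x}" for x
  have fin': "finite {y \<in> E. y < x}" for x by (rule finite_subset[OF _ fin[of x]]) auto
  have mono: "N x < N y" if "x \<in> E" "y \<in> E" "x < y" for x y
    unfolding N_def using that by (intro psubset_card_mono fin') auto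
  have inj: "inj_on N E"
  proof (rule inj_onI)
    fix x y assume "x \<in> E" "y \<in> E" "N x = N y"
    then show "x = y" using mono[of x y] mono[of y x] by (cases x y rule: linorder_cases) auto
  qed
  have down: "n \<in> N ` E" if n: "Suc n \<in> N ` E" for n
  proof -
    obtain x where x: "x \<in> E" "N x = Suc n" using n by auto
    let ?S = "{y \<in> E. y < x}"
    have ne: "?S \<noteq> {}"
    proof
      assume "?S = {}"
      then have "N x = 0" unfolding N_def by (simp only: card.empty)
      then show False using x by simp
    qed
    define z where "z = Max ?S"
    have z: "z \<in> ?S" unfolding z_def by (rule Max_in[OF fin' ne])
    have "?S = insert z {y \<in> E. y < z}"
    proof
      show "?S \<subseteq> insert z {y \<in> E. y < z}"
      proof
        fix y assume y: "y \<in> ?S"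
        then have "y \<le> z" unfolding z_def by (intro Max_ge fin')
        then show "y \<in> insert z {y \<in> E. y < z}" using y by auto
      qed
      show "insert z {y \<in> E. y < z} \<subseteq> ?S" using z by auto
    qed
    then have "N x = Suc (N z)" unfolding N_def using card_insert_disjoint[OF fin'[of z], of z] by simp
    then have "N z = n" using x by simp
    then show ?thesis using z by auto
  qed
  have "infinite (N ` E)" using inf inj by (simp add: finite_image_iff)
  have "n \<in> N ` E" for n
  proof -
    obtain m where m: "m \<in> N ` E" "n < m"
      using \<open>infinite (N ` E)\<close> unfolding infinite_nat_iff_unbounded by blast
    show ?thesis
      by (rule inc_induct[where P = "\<lambda>k. k \<in> N ` E", OF less_imp_le[OF m(2)] m(1)]) (rule down)
  qed
  then have surj: "N ` E = UNIV" by auto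
  define r where "r = inv_into E N"
  have r: "r n \<in> E" "N (r n) = n" for n
    using surj inv_into_into[of n N E] f_inv_into_f[of n N E] by (auto simp: r_def)
  have "strict_mono r"
  proof (rule strict_monoI)
    fix m n :: nat assume "m < n"
    show "r m < r n"
    proof (rule ccontr)
      assume "\<not> ?thesis"
      then consider "r n = r m" | "r n < r m" by linarith
      then show False
      proof cases
        case 1
        then show False using r(2)[of m] r(2)[of n] \<open>m < n\<close> by simp
      next
        case 2
        then show False using mono[OF r(1) r(1), of n m] r(2) \<open>m < n\<close> by simp
      qed
    qed
  qed
  moreover have "range r = E"
  proof
    show "range r \<subseteq> E" using r by auto
    show "E \<subseteq> range r"
    proof
      fix x assume "x \<in> E"
      then have "r (N x) = x" unfolding r_def by (rule inv_into_f_f[OF inj])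
      then show "x \<in> range r" by (metis rangeI)
    qed
  qed
  ultimately show "\<exists>r :: nat \<Rightarrow> real. strict_mono r \<and> range r = E" by blast
next
  have le: "r n \<le> s n" if r: "strict_mono r" and s: "strict_mono s" and eq: "range r = range s"
    and IH: "\<And>k. k < n \<Longrightarrow> r k = s k" for r s :: "nat \<Rightarrow> real" and n
  proof -
    have "s n \<in> range r" using eq by auto
    then obtain m where m: "s n = r m" by auto
    have "m \<ge> n"
    proof (rule ccontr)
      assume "\<not> m \<ge> n"
      then have "s n = s m" using m IH by simp
      then show False using s \<open>\<not> m \<ge> n\<close> by (simp add: strict_mono_eq)
    qed
    then show ?thesis using r m by (simp add: strict_mono_less_eq)
  qed
  fix r s :: "nat \<Rightarrow> real"
  assume r: "strict_mono r \<and> range r = E" and s: "strict_mono s \<and> range s = E"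
  have "r n = s n" for n
  proof (induction n rule: less_induct)
    case (less n)
    show ?case using le[of r s n] le[of s r n] r s less by (intro antisym) auto
  qed
  then show "r = s" by auto
qed

context jacobi
begin

lemma finite_lam_le: "finite {\<kappa>. lam \<kappa> \<le> B}"
proof (rule finite_subset)
  show "finite (vec_lambda ` (PiE (UNIV :: 'n set) (\<lambda>_. {..nat \<lfloor>B\<rfloor>})))"
    by (intro finite_imageI finite_PiE) auto
  show "{\<kappa>. lam \<kappa> \<le> B} \<subseteq> vec_lambda ` (PiE (UNIV :: 'n set) (\<lambda>_. {..nat \<lfloor>B\<rfloor>}))"
  proof
    fix \<kappa> assume "\<kappa> \<in> {\<kappa>. lam \<kappa> \<le> B}"
    then have "real (\<kappa> $ i) \<le> B" for i using lam_ge_component[of \<kappa> i] by simp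
    then have "\<kappa> $ i \<le> nat \<lfloor>B\<rfloor>" for i using le_nat_floor by blast
    then have "vec_nth \<kappa> \<in> PiE (UNIV :: 'n set) (\<lambda>_. {..nat \<lfloor>B\<rfloor>})" by auto
    then show "\<kappa> \<in> vec_lambda ` (PiE (UNIV :: 'n set) (\<lambda>_. {..nat \<lfloor>B\<rfloor>}))"
      by (metis imageI vec_nth_inverse)
  qed
qed

lemma spectrum: "strict_mono (jacobi_spectrum \<alpha> \<beta>)" "range (jacobi_spectrum \<alpha> \<beta>) = range lam"
proof -
  have "infinite (range lam)"
  proof
    assume "finite (range lam)"
    then obtain B where B: "\<And>\<kappa>. lam \<kappa> \<le> B" by (meson Max_ge rangeI)
    obtain k :: nat where k: "B < real k" using reals_Archimedean2 by blast
    show False using B[of "\<chi> i. k"] lam_ge_component[of "\<chi> i. k"] k by simp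
  qed
  moreover have "finite {x \<in> range lam. x \<le> B}" for B
    by (rule finite_subset[OF _ finite_imageI[OF finite_lam_le[of B], of lam]]) auto
  ultimately have "\<exists>!r :: nat \<Rightarrow> real. strict_mono r \<and> range r = range lam"
    by (rule ex1_increasing_enumeration)
  from theI'[OF this] show "strict_mono (jacobi_spectrum \<alpha> \<beta>)" "range (jacobi_spectrum \<alpha> \<beta>) = range lam"
    unfolding jacobi_spectrum_def by auto
qed

lemma spectrum_0: "jacobi_spectrum \<alpha> \<beta> 0 = 0"
proof -
  obtain n where n: "jacobi_spectrum \<alpha> \<beta> n = 0"
    using spectrum(2) lam_0 by (metis rangeE rangeI)
  obtain \<kappa> where "jacobi_spectrum \<alpha> \<beta> 0 = lam \<kappa>" using spectrum(2) by (metis rangeE rangeI)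
  then have "jacobi_spectrum \<alpha> \<beta> 0 \<ge> 0" using lam_nonneg by simp
  moreover have "jacobi_spectrum \<alpha> \<beta> 0 \<le> jacobi_spectrum \<alpha> \<beta> n"
    using spectrum(1) by (simp add: strict_mono_less_eq)
  ultimately show ?thesis using n by simp
qed

lemma finite_level: "finite (jacobi_level \<alpha> \<beta> n)"
  by (rule finite_subset[OF _ finite_lam_le[of "jacobi_spectrum \<alpha> \<beta> n"]]) (simp add: jacobi_level_def subset_eq)

lemma level_0: "jacobi_level \<alpha> \<beta> 0 = {0}"
proof -
  have "lam \<kappa> = 0 \<longleftrightarrow> \<kappa> = 0" for \<kappa>
    using lam_ge_1[of \<kappa>] lam_0 by (cases "\<kappa> = 0") auto
  then show ?thesis by (simp add: jacobi_level_def spectrum_0)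
qed

lemma levels_disjoint:
  assumes "m \<noteq> n"
  shows "jacobi_level \<alpha> \<beta> m \<inter> jacobi_level \<alpha> \<beta> n = {}"
proof -
  have "jacobi_spectrum \<alpha> \<beta> m \<noteq> jacobi_spectrum \<alpha> \<beta> n"
    using assms by (simp add: strict_mono_eq[OF spectrum(1)])
  then show ?thesis by (auto simp: jacobi_level_def)
qed

text \<open>The levels partition the modes, level \<open>0\<close> consists of the constant mode, and a polynomial meets only
  finitely many levels; so the series is a finite sum that can be regrouped by modes.\<close>
lemma frac_integral_eq_mult_op:
  assumes f: "real_polynomial_function f"
  shows "jacobi_frac_integral \<alpha> \<beta> \<gamma> f x =
    mult_op (\<lambda>\<kappa>. if \<kappa> = 0 then 0 else lam \<kappa> powr (- (\<gamma> / 2))) f x"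
proof -
  define m where "m \<kappa> = (if \<kappa> = 0 then 0 else lam \<kappa> powr (- (\<gamma> / 2)))" for \<kappa> :: "nat^'n"
  define G where "G n = (\<Sum>\<kappa>\<in>jacobi_level \<alpha> \<beta> n. m \<kappa> * cf f \<kappa> * basis \<kappa> x)" for n
  have "\<exists>n. \<kappa> \<in> jacobi_level \<alpha> \<beta> n" for \<kappa>
  proof -
    have "lam \<kappa> \<in> range (jacobi_spectrum \<alpha> \<beta>)" unfolding spectrum(2) by (rule rangeI)
    then show ?thesis by (auto simp: jacobi_level_def)
  qed
  then obtain idx where idx: "\<And>\<kappa>. \<kappa> \<in> jacobi_level \<alpha> \<beta> (idx \<kappa>)" by metis
  obtain L where L: "\<And>\<kappa>. \<kappa> \<in> spectrum_support f \<Longrightarrow> idx \<kappa> < L"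
    using finite_imageI[OF polynomial_expansion(1)[OF f], of idx] unfolding finite_nat_set_iff_bounded
    by blast
  have vanish: "G n = 0" if "n \<ge> L" for n
    unfolding G_def
  proof (intro sum.neutral ballI)
    fix \<kappa> assume \<kappa>: "\<kappa> \<in> jacobi_level \<alpha> \<beta> n"
    then have "idx \<kappa> = n" using idx[of \<kappa>] levels_disjoint[of "idx \<kappa>" n] by blast
    then have "\<kappa> \<notin> spectrum_support f" using L[of \<kappa>] that by auto
    then show "m \<kappa> * cf f \<kappa> * basis \<kappa> x = 0" by (simp add: spectrum_support_def)
  qed
  have G: "jacobi_spectrum \<alpha> \<beta> (Suc n) powr (- \<gamma> / 2) * jacobi_proj \<alpha> \<beta> (Suc n) f x = G (Suc n)" for n
  proof -
    have "m \<kappa> = jacobi_spectrum \<alpha> \<beta> (Suc n) powr (- \<gamma> / 2)" if "\<kappa> \<in> jacobi_level \<alpha> \<beta> (Suc n)" for \<kappa>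
    proof -
      have "\<kappa> \<noteq> 0" using that levels_disjoint[of 0 "Suc n"] level_0 by auto
      then show ?thesis using that by (simp add: m_def jacobi_level_def)
    qed
    then show ?thesis by (simp add: G_def jacobi_proj_def sum_distrib_left mult.assoc)
  qed
  have "jacobi_frac_integral \<alpha> \<beta> \<gamma> f x = (\<Sum>n. G (Suc n))"
    unfolding jacobi_frac_integral_def G ..
  also have "\<dots> = (\<Sum>n<L. G (Suc n))"
    by (rule suminf_finite) (auto intro: vanish)
  also have "\<dots> = (\<Sum>n<Suc L. G n)"
    unfolding sum.lessThan_Suc_shift by (simp add: G_def level_0 m_def)
  also have "\<dots> = (\<Sum>\<kappa>\<in>(\<Union>n\<in>{..<Suc L}. jacobi_level \<alpha> \<beta> n). m \<kappa> * cf f \<kappa> * basis \<kappa> x)"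
    unfolding G_def by (rule sum.UNION_disjoint[symmetric]) (auto simp: finite_level levels_disjoint)
  also have "\<dots> = mult_op m f x"
  proof (rule mult_op_eq[symmetric])
    show "finite (\<Union>n\<in>{..<Suc L}. jacobi_level \<alpha> \<beta> n)" by (auto simp: finite_level)
    show "spectrum_support f \<subseteq> (\<Union>n\<in>{..<Suc L}. jacobi_level \<alpha> \<beta> n)"
      using idx L by (fastforce intro: less_SucI)
  qed
  finally show ?thesis by (simp add: m_def[abs_def])
qed

section \<open>Density of polynomials\<close>

lemma measurable_mu_restrict: "measurable \<mu> borel = measurable (restrict_space lborel (cbox (-1) 1)) borel"
  by (rule measurable_cong_sets) (simp_all add: jacobi_measure_def)

lemma AE_mu:
  assumes "AE x in lborel. P x"
  shows "AE x in \<mu>. P x"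
proof -
  have "AE x in restrict_space lborel (cbox (-1) 1). P x"
    using assms by (subst AE_restrict_space_iff) (auto elim: eventually_mono)
  then show ?thesis unfolding jacobi_measure_def
    by (subst AE_density) (auto elim: eventually_mono intro!: measurable_restrict_space1)
qed

lemma Lp_space_bounded:
  assumes p: "p > 0" and "f \<in> borel_measurable \<mu>" "\<And>x. x \<in> cbox (-1) 1 \<Longrightarrow> \<bar>f x\<bar> \<le> B"
  shows "f \<in> Lp_space \<mu> p"
proof -
  have "integrable \<mu> (\<lambda>x. \<bar>f x\<bar> powr p)"
    using assms by (intro integrable_mu_bounded[of _ "B powr p"]) (auto intro: powr_mono2)
  then show ?thesis using assms by (simp add: Lp_space_def)
qed

text \<open>A measurable function is an almost everywhere limit of continuous ones. Clamping these to
  \<open>[- B, B]\<close> provides the bound that dominated convergence needs.\<close>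
lemma bounded_measurable_approx:
  fixes g :: "real^'n \<Rightarrow> real"
  assumes p: "p > 0" and g: "g \<in> borel_measurable \<mu>" "\<And>x. x \<in> cbox (-1) 1 \<Longrightarrow> \<bar>g x\<bar> \<le> B"
    and e: "e > 0"
  shows "\<exists>v. continuous_on UNIV v \<and> pint p (\<lambda>x. g x - v x) < e"
proof -
  have "0 \<in> cbox (-1) (1 :: real^'n)" by (simp add: mem_cube_iff)
  from g(2)[OF this] have B: "B \<ge> 0" by linarith
  define G where "G x = indicator (cbox (-1) 1) x *\<^sub>R g x" for x
  have G_meas: "G \<in> borel_measurable lborel"
    unfolding G_def[abs_def] using g(1)
    by (subst borel_measurable_restrict_space_iff[symmetric]) (auto simp: measurable_mu_restrict)
  have G_bd: "\<bar>G x\<bar> \<le> B" for x using g(2)[of x] B by (auto simp: G_def indicator_def)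
  have "G \<in> borel_measurable lebesgue" using G_meas by (rule measurable_completion)
  then have "G measurable_on UNIV" by (rule lebesgue_measurable_imp_measurable_on) simp
  then obtain N u where N: "negligible N" and u: "\<And>n::nat. continuous_on UNIV (u n)"
    and lim: "\<And>x. x \<notin> N \<Longrightarrow> (\<lambda>n. u n x) \<longlonglongrightarrow> G x"
    unfolding measurable_on_def by auto
  define v where "v n x = max (- B) (min B (u n x))" for n x
  have v: "continuous_on UNIV (v n)" for n
    unfolding v_def using u by (intro continuous_on_max continuous_on_min continuous_on_const)
  have v_meas: "v n \<in> borel_measurable \<mu>" for n
    by (intro borel_measurable_mu borel_measurable_continuous_onI v)
  have "N \<in> null_sets lebesgue" using N by (simp add: negligible_iff_null_sets)
  then have "AE x in lebesgue. x \<notin> N" by (rule AE_not_in)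
  then have "AE x in lborel. x \<notin> N" by (simp add: AE_completion_iff)
  then have aeN: "AE x in \<mu>. x \<notin> N" by (rule AE_mu)
  have "(\<lambda>n. pint p (\<lambda>x. g x - v n x)) \<longlonglongrightarrow> (\<integral>x. 0 \<partial>\<mu>)"
  proof (rule integral_dominated_convergence[where w = "\<lambda>_. (2 * B) powr p"])
    show "(\<lambda>x. \<bar>g x - v n x\<bar> powr p) \<in> borel_measurable \<mu>" for n
      using g(1) v_meas[of n] by measurable
    show "AE x in \<mu>. norm (\<bar>g x - v n x\<bar> powr p) \<le> (2 * B) powr p" for n
    proof (rule AE_I2)
      fix x assume "x \<in> space \<mu>"
      then have "\<bar>g x\<bar> \<le> B" using g(2) by (simp add: space_mu)
      moreover have "\<bar>v n x\<bar> \<le> B" using B by (auto simp: v_def)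
      ultimately have "\<bar>g x - v n x\<bar> \<le> 2 * B" by linarith
      then show "norm (\<bar>g x - v n x\<bar> powr p) \<le> (2 * B) powr p" using p by (simp add: powr_mono2)
    qed
    show "AE x in \<mu>. (\<lambda>n. \<bar>g x - v n x\<bar> powr p) \<longlonglongrightarrow> 0"
      using aeN AE_space
    proof eventually_elim
      case (elim x)
      have Gx: "G x = g x" using elim(2) by (simp add: G_def space_mu)
      have "(\<lambda>n. v n x) \<longlonglongrightarrow> max (- B) (min B (g x))"
        unfolding v_def using lim[OF elim(1)] Gx by (intro tendsto_max tendsto_min tendsto_const) simp
      also have "max (- B) (min B (g x)) = g x" using G_bd[of x] Gx by (auto simp: max_def min_def)
      finally have "(\<lambda>n. \<bar>g x - v n x\<bar>) \<longlonglongrightarrow> \<bar>g x - g x\<bar>"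
        by (intro tendsto_rabs tendsto_diff tendsto_const)
      then have "(\<lambda>n. \<bar>g x - v n x\<bar> powr p) \<longlonglongrightarrow> \<bar>g x - g x\<bar> powr p"
        using p by (intro tendsto_powr2 tendsto_const) auto
      then show ?case by simp
    qed
  qed auto
  then have "\<forall>\<^sub>F n in sequentially. pint p (\<lambda>x. g x - v n x) < e"
    using e by (intro order_tendstoD) auto
  then obtain n where "pint p (\<lambda>x. g x - v n x) < e" by (auto simp: eventually_sequentially)
  then show ?thesis using v by blast
qed

lemma truncation_approx:
  fixes f :: "real^'n \<Rightarrow> real"
  assumes p: "p > 0" and f: "f \<in> Lp_space \<mu> p" and e: "e > 0"
  shows "\<exists>k::nat. pint p (\<lambda>x. f x - max (- real k) (min (real k) (f x))) < e"
proof -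
  have f_meas [measurable]: "f \<in> borel_measurable \<mu>" and int: "integrable \<mu> (\<lambda>x. \<bar>f x\<bar> powr p)"
    using f by (auto simp: Lp_space_def)
  have "(\<lambda>k. pint p (\<lambda>x. f x - max (- real k) (min (real k) (f x)))) \<longlonglongrightarrow> (\<integral>x. 0 \<partial>\<mu>)"
  proof (rule integral_dominated_convergence[where w = "\<lambda>x. \<bar>f x\<bar> powr p"])
    show "(\<lambda>x. \<bar>f x - max (- real k) (min (real k) (f x))\<bar> powr p) \<in> borel_measurable \<mu>" for k
      by measurable
    show "AE x in \<mu>. norm (\<bar>f x - max (- real k) (min (real k) (f x))\<bar> powr p) \<le> \<bar>f x\<bar> powr p" for k
      using p by (intro AE_I2) (auto intro!: powr_mono2 simp: max_def min_def)
    show "AE x in \<mu>. (\<lambda>k. \<bar>f x - max (- real k) (min (real k) (f x))\<bar> powr p) \<longlonglongrightarrow> 0"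
    proof (rule AE_I2)
      fix x
      obtain K :: nat where K: "\<bar>f x\<bar> < real K" using reals_Archimedean2 by blast
      have "\<forall>\<^sub>F k in sequentially. \<bar>f x - max (- real k) (min (real k) (f x))\<bar> powr p = 0"
        using eventually_ge_at_top[of K]
      proof eventually_elim
        case (elim k)
        then have "\<bar>f x\<bar> < real k" using K by linarith
        then have "min (real k) (f x) = f x" "max (- real k) (f x) = f x" by auto
        then show ?case by simp
      qed
      then show "(\<lambda>k. \<bar>f x - max (- real k) (min (real k) (f x))\<bar> powr p) \<longlonglongrightarrow> 0"
        by (rule tendsto_eventually)
    qed
  qed (use int in auto)
  then have "\<forall>\<^sub>F k in sequentially. pint p (\<lambda>x. f x - max (- real k) (min (real k) (f x))) < e"
    using e by (intro order_tendstoD) auto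
  then show ?thesis by (auto simp: eventually_sequentially)
qed

lemma polynomials_dense:
  assumes p: "p > 0" and f: "f \<in> Lp_space \<mu> p" and e: "e > 0"
  shows "\<exists>q. real_polynomial_function q \<and> pint p (\<lambda>x. f x - q x) < e"
proof -
  \<comment> \<open>Two applications of the quasi-triangle inequality to three errors of at most \<open>d\<close>.\<close>
  define d where "d = e / (2 powr p * (1 + 2 powr p * 2) + 1)"
  have P: "2 powr p * (1 + 2 powr p * 2) + 1 > 0" by (intro add_nonneg_pos mult_nonneg_nonneg) auto
  have d: "d > 0" using e P by (simp add: d_def)
  obtain k :: nat where k: "pint p (\<lambda>x. f x - max (- real k) (min (real k) (f x))) < d"
    using truncation_approx[OF p f d] by blast
  define g where "g x = max (- real k) (min (real k) (f x))" for x
  have f_meas [measurable]: "f \<in> borel_measurable \<mu>" using f by (simp add: Lp_space_def)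
  have g_meas: "g \<in> borel_measurable \<mu>" unfolding g_def[abs_def] by measurable
  have g_bd: "\<bar>g x\<bar> \<le> real k" for x by (auto simp: g_def)
  have g: "g \<in> Lp_space \<mu> p" using p g_meas g_bd by (rule Lp_space_bounded)
  obtain v where v: "continuous_on UNIV v" "pint p (\<lambda>x. g x - v x) < d"
    using bounded_measurable_approx[OF p g_meas g_bd d] by blast
  define s where "s = d powr (1 / p)"
  have s: "s > 0" "s powr p = d" using d p by (simp_all add: s_def powr_powr)
  obtain q where q: "real_polynomial_function q" "\<And>x. x \<in> cbox (-1) 1 \<Longrightarrow> \<bar>v x - q x\<bar> < s"
    by (rule Stone_Weierstrass_real_polynomial_function[OF compact_cbox
          continuous_on_subset[OF v(1) subset_UNIV] s(1)]) auto
  have cont_Lp: "u \<in> Lp_space \<mu> p" if u: "continuous_on UNIV u" for u :: "real^'n \<Rightarrow> real"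
  proof -
    have "integrable \<mu> (\<lambda>x. \<bar>u x\<bar> powr p)"
      using p u by (intro integrable_mu_continuous continuous_on_powr' continuous_on_rabs continuous_on_const) auto
    then show ?thesis
      using u by (simp add: Lp_space_def borel_measurable_mu borel_measurable_continuous_onI)
  qed
  have vL: "v \<in> Lp_space \<mu> p" by (rule cont_Lp[OF v(1)])
  have qL: "q \<in> Lp_space \<mu> p" by (intro cont_Lp polynomial_continuous q)
  have diff: "(\<lambda>x. a x - b x) \<in> Lp_space \<mu> p"
    "pint p (\<lambda>x. a x - b x) \<le> 2 powr p * (pint p a + pint p b)"
    if "a \<in> Lp_space \<mu> p" "b \<in> Lp_space \<mu> p" for a b
    using Lp_space_lincomb[OF p that, of 1 "-1"] by auto
  have vq: "pint p (\<lambda>x. v x - q x) \<le> d"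
  proof -
    have "pint p (\<lambda>x. v x - q x) \<le> (\<integral>x. s powr p \<partial>\<mu>)"
    proof (rule integral_mono)
      show "integrable \<mu> (\<lambda>x. \<bar>v x - q x\<bar> powr p)" using diff(1)[OF vL qL] by (simp add: Lp_space_def)
      show "\<bar>v x - q x\<bar> powr p \<le> s powr p" if "x \<in> space \<mu>" for x
        using q(2)[of x] that p by (intro powr_mono2) (auto simp: space_mu)
    qed simp
    then show ?thesis by (simp add: measure_mu s)
  qed
  have "pint p (\<lambda>x. g x - q x) = pint p (\<lambda>x. (g x - v x) - (q x - v x))"
    by (rule Bochner_Integration.integral_cong) auto
  also have "\<dots> \<le> 2 powr p * (pint p (\<lambda>x. g x - v x) + pint p (\<lambda>x. q x - v x))"
    by (intro diff g vL qL)
  also have "\<dots> \<le> 2 powr p * (d + d)"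
    using v(2) vq by (intro mult_left_mono add_mono) (auto simp: abs_minus_commute)
  finally have gq: "pint p (\<lambda>x. g x - q x) \<le> 2 powr p * (d + d)" .
  have "pint p (\<lambda>x. f x - q x) = pint p (\<lambda>x. (f x - g x) - (q x - g x))"
    by (rule Bochner_Integration.integral_cong) auto
  also have "\<dots> \<le> 2 powr p * (pint p (\<lambda>x. f x - g x) + pint p (\<lambda>x. q x - g x))"
    by (intro diff f g qL)
  also have "\<dots> \<le> 2 powr p * (d + 2 powr p * (d + d))"
    using k gq by (intro mult_left_mono add_mono) (auto simp: g_def abs_minus_commute)
  also have "\<dots> < (2 powr p * (1 + 2 powr p * 2) + 1) * d"
    using d by (simp add: algebra_simps)
  also have "\<dots> = e" using P by (simp add: d_def)
  finally show ?thesis using q(1) by blast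
qed

section \<open>The fractional integral\<close>

lemma frac_integral_extends:
  assumes \<gamma>: "\<gamma> > 0" and p: "p > 1"
  shows "\<exists>T. Lp_bounded_linear \<mu> p T \<and>
    (\<forall>f. real_polynomial_function f \<longrightarrow> (AE x in \<mu>. T f x = jacobi_frac_integral \<alpha> \<beta> \<gamma> f x))"
proof -
  define m where "m \<kappa> = (if \<kappa> = 0 then 0 else lam \<kappa> powr (- (\<gamma> / 2)))" for \<kappa> :: "nat^'n"
  have "bounded_mult p m"
    unfolding m_def[abs_def] using \<gamma> by (intro bounded_mult_fractional p) simp
  then obtain C where C: "C \<ge> 0" "\<And>f. real_polynomial_function f \<Longrightarrow> pint p (mult_op m f) \<le> C * pint p f"
    unfolding bounded_mult_def by blast
  have "\<exists>T. Lp_bounded_linear \<mu> p T \<and>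
      (\<forall>f\<in>Collect real_polynomial_function. AE x in \<mu>. T f x = mult_op m f x)"
  proof (rule Lp_bounded_extension[OF mu.finite_measure_axioms p])
    show "Collect real_polynomial_function \<subseteq> Lp_space \<mu> p"
      using p by (auto simp: Lp_space_def intro!: integrable_mu_abs_powr
          borel_measurable_integrable[OF integrable_mu_polynomial])
    show "(\<lambda>x. a * f x + b * g x) \<in> Collect real_polynomial_function"
      if "f \<in> Collect real_polynomial_function" "g \<in> Collect real_polynomial_function"
      for f g :: "real^'n \<Rightarrow> real" and a b
      using that by (auto intro!: real_polynomial_function.intros(2-))
    show "\<exists>g\<in>Collect real_polynomial_function. pint p (\<lambda>x. f x - g x) < e"
      if "f \<in> Lp_space \<mu> p" "e > 0" for f e
      using polynomials_dense[OF _ that] p by auto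
    show "mult_op m (\<lambda>x. a * f x + b * g x) x = a * mult_op m f x + b * mult_op m g x"
      if "f \<in> Collect real_polynomial_function" "g \<in> Collect real_polynomial_function" for f g a b x
      using that by (intro mult_op_lincomb) auto
  qed (use C mult_op_polynomial in auto)
  then show ?thesis by (simp add: frac_integral_eq_mult_op m_def[abs_def])
qed

end

theorem theorem3p3:
  fixes \<alpha> \<beta> :: "real ^ 'n" and \<gamma> p :: real
  assumes "\<And>i. \<alpha> $ i > - 1 / 2" and "\<And>i. \<beta> $ i > - 1 / 2"
    and "\<gamma> > 0" and "1 < p"
  shows "\<exists>T. Lp_bounded_linear (jacobi_measure \<alpha> \<beta>) p T \<and>
    (\<forall>f. real_polynomial_function f \<longrightarrow>
      (AE x in jacobi_measure \<alpha> \<beta>. T f x = jacobi_frac_integral \<alpha> \<beta> \<gamma> f x))"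
proof -
  interpret jacobi \<alpha> \<beta> by standard (rule assms(1) assms(2))+
  show ?thesis by (rule frac_integral_extends[OF assms(3,4)])
qed

end
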